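(* Let $P$ be a distributive lattice, let $\mathcal{M}$ be a good model category, let $F\colon P\to\mathcal{M}$ be a functor, and let $k\ge 0$ be an integer. Then the codegree $k$ approximation $T_kF\colon P\to\mathcal{M}$ is a codegree $k$ functor.
   Context: A lattice is a poset with all binary joins $\vee$ and meets $\wedge$, viewed as a category; it is distributive if $x\wedge(y\vee z)=(x\wedge y)\vee(x\wedge z)$ for all $x,y,z$. Cubes. Let $[n]=\{0,\dots,n\}$ and let $\mathcal{P}_{n+1}$ be the power set of $[n]$ ordered by inclusion. An $(n+1)$-cube in a category $C$ is a functor $\mathcal{X}\colon\mathcal{P}_{n+1}\to C$. It is cocartesian if $\operatorname{colim}_{S\subsetneq[n]}\mathcal{X}(S)\to\mathcal{X}([n])$ is an isomorphism, and cartesian if $\mathcal{X}(\emptyset)\to\lim_{\emptyset\ne S\subseteq[n]}\mathcal{X}(S)$ is an isomorphism. It is strongly bicartesian if every face of dimension $\ge 2$ is both cartesian and cocartesian (so every 1-cube is strongly bicartesian). A cube in a model category is homotopy cocartesian if $\operatorname{hocolim}_{S\subsetneq[n]}\mathcal{X}(S)\to\mathcal{X}([n])$ is a weak equivalence. A model category $\mathcal{M}$ is good if $\operatorname{Fun}(P,\mathcal{M})$ admits the projective model structure for every poset $P$. A functor $F\colon P\to\mathcal{M}$ from a lattice to a good model category is codegree $n$ if for every strongly bicartesian $(n+1)$-cube $\mathcal{X}$ in $P$, the cube $F\circ\mathcal{X}$ is homotopy cocartesian. Join-dimension. Let $P$ be a distributive lattice. An element $v$ is join-irreducible if there are no $x,y<v$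 with $v=x\vee y$. A join-decomposition of $v$ of size $k$ is a finite collection $p^0,\dots,p^{k-1}$ with $v=p^0\vee\dots\vee p^{k-1}$; it is reduced if omitting any one $p^i$ gives a join different from $v$ (by convention the size 1 decomposition $p^0=v$ is reduced unless $v$ is minimal), and indecomposable if all $p^i$ are join-irreducible. An indecomposable reduced join-decomposition is unique if it exists. Put $\operatorname{jdim}(v)=0$ if $v$ is minimal in $P$; $\operatorname{jdim}(v)=k$ if $v$ is not minimal and has a reduced indecomposable join-decomposition of size $k$; and $\operatorname{jdim}(v)=\infty$ otherwise. Let $P_{\le k}=\{v\in P:\operatorname{jdim}(v)\le k\}$. The codegree $k$ approximation $T_kF$ of $F\colon P\to\mathcal{M}$ is the homotopy left Kan extension of $F|_{P_{\le k}}$ along the inclusion $P_{\le k}\hookrightarrow P$; on objects $T_kF(x)=\operatorname{hocolim}_{v\in P_{\le k},\,v\le x}F(v)$. *)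

theory Defs
  imports
    "HOL-Algebra.Lattice"
    "HOL-Library.FuncSet"
    "HOL-Library.Extended_Nat"
    "HOL-Library.Infinite_Typeclass"
begin

section \<open>Categories, functors, natural transformations\<close>

record ('o, 'm) cat =
  Obj :: "'o set"
  Arr :: "'m set"
  Dom :: "'m \<Rightarrow> 'o"
  Cod :: "'m \<Rightarrow> 'o"
  Ide :: "'o \<Rightarrow> 'm"
  Comp :: "'m \<Rightarrow> 'm \<Rightarrow> 'm"  \<comment> \<open>\<open>Comp C g f\<close> is \<open>g\<close> after \<open>f\<close>\<close>

definition Hom :: "('o, 'm, 'z) cat_scheme \<Rightarrow> 'o \<Rightarrow> 'o \<Rightarrow> 'm set" where
  "Hom C a b = {f \<in> Arr C. Dom C f = a \<and> Cod C f = b}"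

locale category =
  fixes C :: "('o, 'm, 'z) cat_scheme"
  assumes Dom_closed: "f \<in> Arr C \<Longrightarrow> Dom C f \<in> Obj C"
    and Cod_closed: "f \<in> Arr C \<Longrightarrow> Cod C f \<in> Obj C"
    and Ide_closed: "a \<in> Obj C \<Longrightarrow> Ide C a \<in> Hom C a a"
    and Comp_closed: "\<lbrakk>f \<in> Hom C a b; g \<in> Hom C b c\<rbrakk> \<Longrightarrow> Comp C g f \<in> Hom C a c"
    and Comp_Ide: "f \<in> Hom C a b \<Longrightarrow> Comp C f (Ide C a) = f"
    and Ide_Comp: "f \<in> Hom C a b \<Longrightarrow> Comp C (Ide C b) f = f"
    and Comp_assoc: "\<lbrakk>f \<in> Hom C a b; g \<in> Hom C b c; h \<in> Hom C c d\<rbrakk>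
      \<Longrightarrow> Comp C h (Comp C g f) = Comp C (Comp C h g) f"

definition is_iso :: "('o, 'm, 'z) cat_scheme \<Rightarrow> 'm \<Rightarrow> bool" where
  "is_iso C f \<longleftrightarrow> f \<in> Arr C \<and>
    (\<exists>g \<in> Hom C (Cod C f) (Dom C f).
      Comp C g f = Ide C (Dom C f) \<and> Comp C f g = Ide C (Cod C f))"

definition is_initial :: "('o, 'm, 'z) cat_scheme \<Rightarrow> 'o \<Rightarrow> bool" where
  "is_initial C a \<longleftrightarrow> a \<in> Obj C \<and> (\<forall>b \<in> Obj C. \<exists>!f. f \<in> Hom C a b)"

record ('o1, 'm1, 'o2, 'm2) ftor =
  fobj :: "'o1 \<Rightarrow> 'o2"
  farr :: "'m1 \<Rightarrow> 'm2"

text \<open>Functors and natural transformations are extensional (\<open>undefined\<close> outside their source), so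
  that equality of functors is the intended one and \<open>fun_cat\<close> below is the usual functor category.\<close>

definition is_functor ::
  "('o1, 'm1, 'y) cat_scheme \<Rightarrow> ('o2, 'm2, 'z) cat_scheme \<Rightarrow> ('o1, 'm1, 'o2, 'm2) ftor \<Rightarrow> bool" where
  "is_functor J C F \<longleftrightarrow>
    fobj F \<in> Obj J \<rightarrow>\<^sub>E Obj C \<and> farr F \<in> Arr J \<rightarrow>\<^sub>E Arr C \<and>
    (\<forall>f \<in> Arr J. farr F f \<in> Hom C (fobj F (Dom J f)) (fobj F (Cod J f))) \<and>
    (\<forall>a \<in> Obj J. farr F (Ide J a) = Ide C (fobj F a)) \<and>
    (\<forall>f \<in> Arr J. \<forall>g \<in> Arr J. Cod J f = Dom J g \<longrightarrow>
       farr F (Comp J g f) = Comp C (farr F g) (farr F f))"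

definition fcomp ::
  "('o1, 'm1, 'y) cat_scheme \<Rightarrow> ('o2, 'm2, 'o3, 'm3) ftor \<Rightarrow> ('o1, 'm1, 'o2, 'm2) ftor
    \<Rightarrow> ('o1, 'm1, 'o3, 'm3) ftor" where
  "fcomp J G F = \<lparr>fobj = (\<lambda>a \<in> Obj J. fobj G (fobj F a)), farr = (\<lambda>f \<in> Arr J. farr G (farr F f))\<rparr>"

definition inclusion :: "('o, 'm, 'y) cat_scheme \<Rightarrow> ('o, 'm, 'o, 'm) ftor" where
  "inclusion J = \<lparr>fobj = (\<lambda>a \<in> Obj J. a), farr = (\<lambda>f \<in> Arr J. f)\<rparr>"

record ('o1, 'm1, 'o2, 'm2) ntrans =
  nsrc :: "('o1, 'm1, 'o2, 'm2) ftor"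
  ntrg :: "('o1, 'm1, 'o2, 'm2) ftor"
  ncmp :: "'o1 \<Rightarrow> 'm2"

definition is_ntrans ::
  "('o1, 'm1, 'y) cat_scheme \<Rightarrow> ('o2, 'm2, 'z) cat_scheme \<Rightarrow> ('o1, 'm1, 'o2, 'm2) ntrans \<Rightarrow> bool" where
  "is_ntrans J C t \<longleftrightarrow>
    is_functor J C (nsrc t) \<and> is_functor J C (ntrg t) \<and> ncmp t \<in> extensional (Obj J) \<and>
    (\<forall>a \<in> Obj J. ncmp t a \<in> Hom C (fobj (nsrc t) a) (fobj (ntrg t) a)) \<and>
    (\<forall>f \<in> Arr J. Comp C (ncmp t (Cod J f)) (farr (nsrc t) f) =
                  Comp C (farr (ntrg t) f) (ncmp t (Dom J f)))"

definition fun_cat ::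
  "('o1, 'm1, 'y) cat_scheme \<Rightarrow> ('o2, 'm2, 'z) cat_scheme
    \<Rightarrow> (('o1, 'm1, 'o2, 'm2) ftor, ('o1, 'm1, 'o2, 'm2) ntrans) cat" where
  "fun_cat J C = \<lparr>
    Obj = {F. is_functor J C F},
    Arr = {t. is_ntrans J C t},
    Dom = nsrc,
    Cod = ntrg,
    Ide = (\<lambda>F. \<lparr>nsrc = F, ntrg = F, ncmp = (\<lambda>a \<in> Obj J. Ide C (fobj F a))\<rparr>),
    Comp = (\<lambda>s t. \<lparr>nsrc = nsrc t, ntrg = ntrg s, ncmp = (\<lambda>a \<in> Obj J. Comp C (ncmp s a) (ncmp t a))\<rparr>)\<rparr>"

text \<open>\<open>whisker A t K\<close> is the transformation \<open>t\<close> restricted along a functor \<open>K\<close> with source \<open>A\<close>.\<close>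

definition whisker ::
  "('o1, 'm1, 'y) cat_scheme \<Rightarrow> ('o2, 'm2, 'o3, 'm3) ntrans \<Rightarrow> ('o1, 'm1, 'o2, 'm2) ftor
    \<Rightarrow> ('o1, 'm1, 'o3, 'm3) ntrans" where
  "whisker A t K = \<lparr>nsrc = fcomp A (nsrc t) K, ntrg = fcomp A (ntrg t) K,
    ncmp = (\<lambda>a \<in> Obj A. ncmp t (fobj K a))\<rparr>"

definition is_left_kan_extension ::
  "('o1, 'm1, 'x) cat_scheme \<Rightarrow> ('o2, 'm2, 'y) cat_scheme \<Rightarrow> ('o3, 'm3, 'z) cat_scheme
    \<Rightarrow> ('o1, 'm1, 'o2, 'm2) ftor \<Rightarrow> ('o1, 'm1, 'o3, 'm3) ftor
    \<Rightarrow> ('o2, 'm2, 'o3, 'm3) ftor \<Rightarrow> ('o1, 'm1, 'o3, 'm3) ntrans \<Rightarrow> bool" where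
  "is_left_kan_extension A B C K Q T \<eta> \<longleftrightarrow>
    is_functor B C T \<and> \<eta> \<in> Hom (fun_cat A C) Q (fcomp A T K) \<and>
    (\<forall>T' \<eta>'. is_functor B C T' \<and> \<eta>' \<in> Hom (fun_cat A C) Q (fcomp A T' K) \<longrightarrow>
      (\<exists>!\<alpha>. \<alpha> \<in> Hom (fun_cat B C) T T' \<and> Comp (fun_cat A C) (whisker A \<alpha> K) \<eta> = \<eta>'))"

section \<open>Limits and colimits\<close>

definition is_cocone ::
  "('o, 'm, 'z) cat_scheme \<Rightarrow> ('o1, 'm1, 'y) cat_scheme \<Rightarrow> ('o1, 'm1, 'o, 'm) ftor
    \<Rightarrow> 'o \<Rightarrow> ('o1 \<Rightarrow> 'm) \<Rightarrow> bool" where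
  "is_cocone C J D c \<iota> \<longleftrightarrow> c \<in> Obj C \<and> (\<forall>j \<in> Obj J. \<iota> j \<in> Hom C (fobj D j) c) \<and>
    (\<forall>u \<in> Arr J. Comp C (\<iota> (Cod J u)) (farr D u) = \<iota> (Dom J u))"

definition is_colimit ::
  "('o, 'm, 'z) cat_scheme \<Rightarrow> ('o1, 'm1, 'y) cat_scheme \<Rightarrow> ('o1, 'm1, 'o, 'm) ftor
    \<Rightarrow> 'o \<Rightarrow> ('o1 \<Rightarrow> 'm) \<Rightarrow> bool" where
  "is_colimit C J D c \<iota> \<longleftrightarrow> is_cocone C J D c \<iota> \<and>
    (\<forall>d \<kappa>. is_cocone C J D d \<kappa> \<longrightarrow>
      (\<exists>!h. h \<in> Hom C c d \<and> (\<forall>j \<in> Obj J. Comp C h (\<iota> j) = \<kappa> j)))"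

definition is_cone ::
  "('o, 'm, 'z) cat_scheme \<Rightarrow> ('o1, 'm1, 'y) cat_scheme \<Rightarrow> ('o1, 'm1, 'o, 'm) ftor
    \<Rightarrow> 'o \<Rightarrow> ('o1 \<Rightarrow> 'm) \<Rightarrow> bool" where
  "is_cone C J D c \<pi> \<longleftrightarrow> c \<in> Obj C \<and> (\<forall>j \<in> Obj J. \<pi> j \<in> Hom C c (fobj D j)) \<and>
    (\<forall>u \<in> Arr J. Comp C (farr D u) (\<pi> (Dom J u)) = \<pi> (Cod J u))"

definition is_limit ::
  "('o, 'm, 'z) cat_scheme \<Rightarrow> ('o1, 'm1, 'y) cat_scheme \<Rightarrow> ('o1, 'm1, 'o, 'm) ftor
    \<Rightarrow> 'o \<Rightarrow> ('o1 \<Rightarrow> 'm) \<Rightarrow> bool" where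
  "is_limit C J D c \<pi> \<longleftrightarrow> is_cone C J D c \<pi> \<and>
    (\<forall>d \<kappa>. is_cone C J D d \<kappa> \<longrightarrow>
      (\<exists>!h. h \<in> Hom C d c \<and> (\<forall>j \<in> Obj J. Comp C (\<pi> j) h = \<kappa> j)))"

text \<open>Size convention: the infinite type \<open>'u\<close> is the universe of small sets, i.e.\ a category is
  small if its objects and arrows are elements of \<open>'u\<close>, and small posets are posets in \<open>'u\<close>.
  Model categories are required to have limits and colimits of small shape; their own objects and
  arrows live in arbitrary types.\<close>

definition small_complete :: "'u::infinite itself \<Rightarrow> ('o, 'm, 'z) cat_scheme \<Rightarrow> bool" where
  "small_complete U C \<longleftrightarrow> (\<forall>(J :: ('u, 'u) cat) D. category J \<and> is_functor J C D \<longrightarrow>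
    (\<exists>c \<pi>. is_limit C J D c \<pi>))"

definition small_cocomplete :: "'u::infinite itself \<Rightarrow> ('o, 'm, 'z) cat_scheme \<Rightarrow> bool" where
  "small_cocomplete U C \<longleftrightarrow> (\<forall>(J :: ('u, 'u) cat) D. category J \<and> is_functor J C D \<longrightarrow>
    (\<exists>c \<iota>. is_colimit C J D c \<iota>))"

section \<open>Model categories\<close>

record ('o, 'm) mcat = "('o, 'm) cat" +
  Weq :: "'m set"
  Fib :: "'m set"
  Cof :: "'m set"

definition has_lifting :: "('o, 'm, 'z) cat_scheme \<Rightarrow> 'm \<Rightarrow> 'm \<Rightarrow> bool" where
  "has_lifting C i p \<longleftrightarrow>
    (\<forall>u v. u \<in> Hom C (Dom C i) (Dom C p) \<and> v \<in> Hom C (Cod C i) (Cod C p) \<and>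
           Comp C p u = Comp C v i \<longrightarrow>
      (\<exists>h \<in> Hom C (Cod C i) (Dom C p). Comp C h i = u \<and> Comp C p h = v))"

definition retract_of :: "('o, 'm, 'z) cat_scheme \<Rightarrow> 'm \<Rightarrow> 'm \<Rightarrow> bool" where
  "retract_of C f g \<longleftrightarrow> f \<in> Arr C \<and> g \<in> Arr C \<and>
    (\<exists>s \<in> Hom C (Dom C f) (Dom C g). \<exists>r \<in> Hom C (Dom C g) (Dom C f).
     \<exists>s' \<in> Hom C (Cod C f) (Cod C g). \<exists>r' \<in> Hom C (Cod C g) (Cod C f).
       Comp C r s = Ide C (Dom C f) \<and> Comp C r' s' = Ide C (Cod C f) \<and>
       Comp C g s = Comp C s' f \<and> Comp C f r = Comp C r' g)"

locale model_category =
  fixes U :: "'u::infinite itself" and M :: "('o, 'm, 'z) mcat_scheme"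
  assumes category: "category M"
    and complete: "small_complete U M"
    and cocomplete: "small_cocomplete U M"
    and Weq_Arr: "Weq M \<subseteq> Arr M"
    and Fib_Arr: "Fib M \<subseteq> Arr M"
    and Cof_Arr: "Cof M \<subseteq> Arr M"
    and two_of_three:
      "\<lbrakk>f \<in> Hom M a b; g \<in> Hom M b c; f \<in> Weq M; g \<in> Weq M\<rbrakk> \<Longrightarrow> Comp M g f \<in> Weq M"
      "\<lbrakk>f \<in> Hom M a b; g \<in> Hom M b c; f \<in> Weq M; Comp M g f \<in> Weq M\<rbrakk> \<Longrightarrow> g \<in> Weq M"
      "\<lbrakk>f \<in> Hom M a b; g \<in> Hom M b c; g \<in> Weq M; Comp M g f \<in> Weq M\<rbrakk> \<Longrightarrow> f \<in> Weq M"
    and Weq_retract: "\<lbrakk>retract_of M f g; g \<in> Weq M\<rbrakk> \<Longrightarrow> f \<in> Weq M"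
    and Fib_retract: "\<lbrakk>retract_of M f g; g \<in> Fib M\<rbrakk> \<Longrightarrow> f \<in> Fib M"
    and Cof_retract: "\<lbrakk>retract_of M f g; g \<in> Cof M\<rbrakk> \<Longrightarrow> f \<in> Cof M"
    and lifting:
      "\<lbrakk>i \<in> Cof M; p \<in> Fib M \<inter> Weq M\<rbrakk> \<Longrightarrow> has_lifting M i p"
      "\<lbrakk>i \<in> Cof M \<inter> Weq M; p \<in> Fib M\<rbrakk> \<Longrightarrow> has_lifting M i p"
    and factorization:
      "f \<in> Hom M a b \<Longrightarrow> \<exists>c. \<exists>i \<in> Hom M a c \<inter> Cof M. \<exists>p \<in> Hom M c b \<inter> Fib M \<inter> Weq M. f = Comp M p i"
      "f \<in> Hom M a b \<Longrightarrow> \<exists>c. \<exists>i \<in> Hom M a c \<inter> Cof M \<inter> Weq M. \<exists>p \<in> Hom M c b \<inter> Fib M. f = Comp M p i"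

definition objectwise ::
  "('o1, 'm1, 'y) cat_scheme \<Rightarrow> ('o, 'm, 'z) cat_scheme \<Rightarrow> 'm set \<Rightarrow> ('o1, 'm1, 'o, 'm) ntrans set" where
  "objectwise J C W = {t \<in> Arr (fun_cat J C). \<forall>a \<in> Obj J. ncmp t a \<in> W}"

definition projective ::
  "('o1, 'm1, 'y) cat_scheme \<Rightarrow> ('o, 'm, 'z) mcat_scheme
    \<Rightarrow> (('o1, 'm1, 'o, 'm) ftor, ('o1, 'm1, 'o, 'm) ntrans) mcat" where
  "projective J M = cat.extend (fun_cat J M) (mcat.fields
    (objectwise J M (Weq M))
    (objectwise J M (Fib M))
    {i \<in> Arr (fun_cat J M).
      \<forall>p \<in> objectwise J M (Fib M) \<inter> objectwise J M (Weq M). has_lifting (fun_cat J M) i p})"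

definition cofibrant :: "('o, 'm, 'z) mcat_scheme \<Rightarrow> 'o \<Rightarrow> bool" where
  "cofibrant M x \<longleftrightarrow> x \<in> Obj M \<and> (\<exists>a. is_initial M a \<and> (\<exists>f \<in> Hom M a x. f \<in> Cof M))"

definition cofibrant_replacement :: "('o, 'm, 'z) mcat_scheme \<Rightarrow> 'o \<Rightarrow> 'o \<Rightarrow> 'm \<Rightarrow> bool" where
  "cofibrant_replacement M x x' q \<longleftrightarrow> cofibrant M x' \<and> q \<in> Hom M x' x \<and> q \<in> Weq M"

section \<open>Posets as categories; good model categories\<close>

definition poset_cat :: "('a, 'z) gorder_scheme \<Rightarrow> ('a, 'a \<times> 'a) cat" where
  "poset_cat L = \<lparr>
    Obj = carrier L,
    Arr = {(x, y). x \<in> carrier L \<and> y \<in> carrier L \<and> x \<sqsubseteq>\<^bsub>L\<^esub> y},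
    Dom = fst,
    Cod = snd,
    Ide = (\<lambda>x. (x, x)),
    Comp = (\<lambda>g f. (fst f, snd g))\<rparr>"

definition good_model_category :: "'u::infinite itself \<Rightarrow> ('o, 'm, 'z) mcat_scheme \<Rightarrow> bool" where
  "good_model_category U M \<longleftrightarrow> model_category U M \<and>
    (\<forall>L :: 'u gorder. partial_order L \<longrightarrow> model_category U (projective (poset_cat L) M))"

section \<open>Homotopy colimits and homotopy left Kan extensions\<close>

text \<open>Both are the left derived functors with respect to the projective model structure: replace the
  diagram by a projectively cofibrant one and apply the strict construction. They are determined only
  up to weak equivalence, so they are rendered as relations ranging over all choices of a cofibrant
  replacement and of a colimit (respectively left Kan extension).

  \<open>hocolim_map M J D y \<kappa> h\<close>: the morphism \<open>h\<close> is the canonical map from a model of \<open>hocolim D\<close> to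
  \<open>y\<close> induced by the cocone \<open>\<kappa>\<close> under \<open>D\<close> with apex \<open>y\<close>.\<close>

definition hocolim_map ::
  "('o, 'm, 'z) mcat_scheme \<Rightarrow> ('o1, 'm1, 'y) cat_scheme \<Rightarrow> ('o1, 'm1, 'o, 'm) ftor
    \<Rightarrow> 'o \<Rightarrow> ('o1 \<Rightarrow> 'm) \<Rightarrow> 'm \<Rightarrow> bool" where
  "hocolim_map M J D y \<kappa> h \<longleftrightarrow>
    (\<exists>Q q c \<iota>. cofibrant_replacement (projective J M) D Q q \<and> is_colimit M J Q c \<iota> \<and>
      h \<in> Hom M c y \<and> (\<forall>j \<in> Obj J. Comp M h (\<iota> j) = Comp M (\<kappa> j) (ncmp q j)))"

definition is_homotopy_left_kan_extension ::
  "('o1, 'm1, 'x) cat_scheme \<Rightarrow> ('o2, 'm2, 'y) cat_scheme \<Rightarrow> ('o, 'm, 'z) mcat_scheme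
    \<Rightarrow> ('o1, 'm1, 'o2, 'm2) ftor \<Rightarrow> ('o1, 'm1, 'o, 'm) ftor \<Rightarrow> ('o2, 'm2, 'o, 'm) ftor \<Rightarrow> bool" where
  "is_homotopy_left_kan_extension A B M K F T \<longleftrightarrow>
    (\<exists>Q q \<eta>. cofibrant_replacement (projective A M) F Q q \<and> is_left_kan_extension A B M K Q T \<eta>)"

section \<open>Cubes\<close>

definition subset_poset :: "'a set set \<Rightarrow> 'a set gorder" where
  "subset_poset A = \<lparr>carrier = A, eq = (=), le = (\<subseteq>)\<rparr>"

definition cube_shape :: "nat \<Rightarrow> (nat set, nat set \<times> nat set) cat" where
  "cube_shape n = poset_cat (subset_poset (Pow {0..n}))"

text \<open>A cube of dimension \<open>n + 1\<close> in \<open>C\<close> is a functor \<open>cube_shape n \<rightarrow> C\<close>. The faces of a cube \<open>X\<close> are its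
  restrictions to the intervals \<open>{S..T}\<close> of the power set; the dimension of such a face is
  \<open>card (T - S)\<close>. The predicates \<open>cocartesian\<close> and \<open>cartesian\<close> are stated for the face \<open>{S..T}\<close>; here
  \<open>{S..<T}\<close> and \<open>{S<..T}\<close> are intervals with respect to inclusion, that is, the face without its
  terminal, respectively initial, vertex.\<close>

definition cocartesian ::
  "('o, 'm, 'z) cat_scheme \<Rightarrow> (nat set, nat set \<times> nat set, 'o, 'm) ftor \<Rightarrow> nat set \<Rightarrow> nat set \<Rightarrow> bool" where
  "cocartesian C X S T \<longleftrightarrow>
    (let J = poset_cat (subset_poset {S..<T}) in
      \<exists>c \<iota> h. is_colimit C J (fcomp J X (inclusion J)) c \<iota> \<and>
        h \<in> Hom C c (fobj X T) \<and> (\<forall>V \<in> Obj J. Comp C h (\<iota> V) = farr X (V, T)) \<and> is_iso C h)"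

definition cartesian ::
  "('o, 'm, 'z) cat_scheme \<Rightarrow> (nat set, nat set \<times> nat set, 'o, 'm) ftor \<Rightarrow> nat set \<Rightarrow> nat set \<Rightarrow> bool" where
  "cartesian C X S T \<longleftrightarrow>
    (let J = poset_cat (subset_poset {S<..T}) in
      \<exists>c \<pi> h. is_limit C J (fcomp J X (inclusion J)) c \<pi> \<and>
        h \<in> Hom C (fobj X S) c \<and> (\<forall>V \<in> Obj J. Comp C (\<pi> V) h = farr X (S, V)) \<and> is_iso C h)"

definition strongly_bicartesian ::
  "('o, 'm, 'z) cat_scheme \<Rightarrow> nat \<Rightarrow> (nat set, nat set \<times> nat set, 'o, 'm) ftor \<Rightarrow> bool" where
  "strongly_bicartesian C n X \<longleftrightarrow>
    (\<forall>S T. S \<subseteq> T \<and> T \<subseteq> {0..n} \<and> 2 \<le> card (T - S) \<longrightarrow> cartesian C X S T \<and> cocartesian C X S T)"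

text \<open>The first conjunct (a model of the homotopy colimit exists) holds in every good model category;
  it keeps the second from being vacuous in general.\<close>

definition homotopy_cocartesian ::
  "('o, 'm, 'z) mcat_scheme \<Rightarrow> nat \<Rightarrow> (nat set, nat set \<times> nat set, 'o, 'm) ftor \<Rightarrow> bool" where
  "homotopy_cocartesian M n X \<longleftrightarrow>
    (let J = poset_cat (subset_poset {{}..<{0..n}});
         comparison = hocolim_map M J (fcomp J X (inclusion J)) (fobj X {0..n}) (\<lambda>S. farr X (S, {0..n}))
     in (\<exists>h. comparison h) \<and> (\<forall>h. comparison h \<longrightarrow> h \<in> Weq M))"

definition codegree ::
  "('a, 'z) gorder_scheme \<Rightarrow> ('o, 'm, 'y) mcat_scheme \<Rightarrow> nat \<Rightarrow> ('a, 'a \<times> 'a, 'o, 'm) ftor \<Rightarrow> bool" where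
  "codegree P M n F \<longleftrightarrow> is_functor (poset_cat P) M F \<and>
    (\<forall>X. is_functor (cube_shape n) (poset_cat P) X \<and> strongly_bicartesian (poset_cat P) n X \<longrightarrow>
      homotopy_cocartesian M n (fcomp (cube_shape n) F X))"

section \<open>Join-dimension\<close>

locale distributive_lattice = lattice +
  assumes meet_join_distrib:
    "\<lbrakk>x \<in> carrier L; y \<in> carrier L; z \<in> carrier L\<rbrakk> \<Longrightarrow> x \<sqinter> (y \<squnion> z) = (x \<sqinter> y) \<squnion> (x \<sqinter> z)"

definition is_minimal :: "('a, 'z) gorder_scheme \<Rightarrow> 'a \<Rightarrow> bool" where
  "is_minimal L v \<longleftrightarrow> v \<in> carrier L \<and> \<not> (\<exists>x \<in> carrier L. x \<sqsubset>\<^bsub>L\<^esub> v)"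

definition join_irreducible :: "('a, 'z) gorder_scheme \<Rightarrow> 'a \<Rightarrow> bool" where
  "join_irreducible L v \<longleftrightarrow> v \<in> carrier L \<and>
    \<not> (\<exists>x \<in> carrier L. \<exists>y \<in> carrier L. x \<sqsubset>\<^bsub>L\<^esub> v \<and> y \<sqsubset>\<^bsub>L\<^esub> v \<and> v = x \<squnion>\<^bsub>L\<^esub> y)"

text \<open>Join-decompositions are nonempty families \<open>p 0, \<dots>, p (k - 1)\<close>, possibly with repetitions.\<close>

definition join_decomposition :: "('a, 'z) gorder_scheme \<Rightarrow> 'a \<Rightarrow> nat \<Rightarrow> (nat \<Rightarrow> 'a) \<Rightarrow> bool" where
  "join_decomposition L v k p \<longleftrightarrow> 1 \<le> k \<and> (\<forall>i < k. p i \<in> carrier L) \<and> v = \<Squnion>\<^bsub>L\<^esub>(p ` {..<k})"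

definition reduced_decomposition :: "('a, 'z) gorder_scheme \<Rightarrow> 'a \<Rightarrow> nat \<Rightarrow> (nat \<Rightarrow> 'a) \<Rightarrow> bool" where
  "reduced_decomposition L v k p \<longleftrightarrow>
    (if k = 1 then \<not> is_minimal L v else \<forall>i < k. \<Squnion>\<^bsub>L\<^esub>(p ` ({..<k} - {i})) \<noteq> v)"

definition indecomposable_decomposition :: "('a, 'z) gorder_scheme \<Rightarrow> nat \<Rightarrow> (nat \<Rightarrow> 'a) \<Rightarrow> bool" where
  "indecomposable_decomposition L k p \<longleftrightarrow> (\<forall>i < k. join_irreducible L (p i))"

definition has_rid_of_size :: "('a, 'z) gorder_scheme \<Rightarrow> 'a \<Rightarrow> nat \<Rightarrow> bool" where
  "has_rid_of_size L v k \<longleftrightarrow>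
    (\<exists>p. join_decomposition L v k p \<and> reduced_decomposition L v k p \<and> indecomposable_decomposition L k p)"

text \<open>In a distributive lattice the reduced indecomposable join-decomposition of \<open>v\<close> is unique up to
  order if it exists, so the size chosen by \<open>THE\<close> is well defined.\<close>

definition jdim :: "('a, 'z) gorder_scheme \<Rightarrow> 'a \<Rightarrow> enat" where
  "jdim L v =
    (if is_minimal L v then 0
     else if \<exists>k. has_rid_of_size L v k then enat (THE k. has_rid_of_size L v k)
     else \<infinity>)"

definition jdim_le :: "('a, 'z) gorder_scheme \<Rightarrow> nat \<Rightarrow> ('a, 'z) gorder_scheme" where
  "jdim_le P k = P\<lparr>carrier := {v \<in> carrier P. jdim P v \<le> enat k}\<rparr>"

section \<open>The codegree approximation\<close>

definition is_codegree_approximation ::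
  "('a, 'z) gorder_scheme \<Rightarrow> ('o, 'm, 'y) mcat_scheme \<Rightarrow> nat
    \<Rightarrow> ('a, 'a \<times> 'a, 'o, 'm) ftor \<Rightarrow> ('a, 'a \<times> 'a, 'o, 'm) ftor \<Rightarrow> bool" where
  "is_codegree_approximation P M k F T \<longleftrightarrow>
    (let A = poset_cat (jdim_le P k) in
      is_homotopy_left_kan_extension A (poset_cat P) M (inclusion A) (fcomp A F (inclusion A)) T)"

end

theory Submission
  imports Defs
begin

text \<open>Write \<open>T\<close> for the left Kan extension of a projectively cofibrant diagram \<open>Q\<close> on
  \<open>P\<^sub>\<le>\<^sub>k\<close>, and let \<open>X\<close> be a strongly bicartesian \<open>(k + 1)\<close>-cube. Since \<open>X\<close> preserves meets, the
  elements of \<open>P\<close> below some proper vertex form a lower set \<open>B\<close>, and each of them lies below a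
  smallest vertex \<open>X (\<sigma> x)\<close>. Right Kan extension along the punctured cube is therefore \<open>Y \<circ> \<sigma>\<close> on
  \<open>B\<close> and terminal elsewhere. By adjunction, lifting problems for the punctured diagram of \<open>T \<circ> X\<close>
  become lifting problems for \<open>Q\<close>, so this diagram is itself projectively cofibrant. A
  join-irreducible element below the top vertex is join-prime, so it lies below all but at most one of
  the \<open>k + 1\<close> maximal proper vertices; hence every element of \<open>P\<^sub>\<le>\<^sub>k\<close> below the top vertex belongs to
  \<open>B\<close>, and the top value of \<open>T \<circ> X\<close> is the strict colimit of the punctured diagram. Ken Brown's lemma
  compares this colimit with that of any other cofibrant replacement.\<close>

section \<open>Lifting and weak equivalences in model categories\<close>

text \<open>\<open>T\<close> is known only through its universal property, and homotopy colimits
  range over all replacements, so neither a pointwise formula nor a chosen model is at hand. Facts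
  about \<open>T\<close> come from mapping it into functors on \<open>P\<close> built by hand. Their
  shape is forced: a right Kan extension at \<open>x\<close> is a limit over the proper vertices
  above \<open>x\<close>; if there are any, the smallest one gives the value, and otherwise the
  limit is empty, hence terminal. Off the lower set one thus lifts against an identity, which is a
  trivial fibration. The number \<open>k\<close> enters by counting. Two distinct maximal proper
  vertices join to the top because they span a cocartesian square below it, so a join-prime element
  can miss only one of them, and at most \<open>k\<close> irreducible parts cannot miss all
  \<open>k + 1\<close> vertices. A model structure on diagrams is needed only to compare two
  cofibrant ones. It is given only for posets in the universe, so the punctured cube is first copied
  there.\<close>

lemma HomD:
  assumes "f \<in> Hom C a b"
  shows "f \<in> Arr C" "Dom C f = a" "Cod C f = b"
  using assms by (simp_all add: Hom_def)

lemma (in category) Hom_Obj: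
  assumes "f \<in> Hom C a b"
  shows "a \<in> Obj C" "b \<in> Obj C"
  using HomD[OF assms] Dom_closed Cod_closed by blast+

lemma has_liftingD:
  assumes "has_lifting C i p"
    and "u \<in> Hom C (Dom C i) (Dom C p)" "v \<in> Hom C (Cod C i) (Cod C p)" "Comp C p u = Comp C v i"
  obtains h where "h \<in> Hom C (Cod C i) (Dom C p)" "Comp C h i = u" "Comp C p h = v"
  using assms unfolding has_lifting_def by blast

text \<open>Lifting the square with top \<open>i\<close> and bottom \<open>Ide C b\<close> gives a
  section \<open>t\<close> of \<open>p\<close> that takes the composite to \<open>i\<close>. Then
  \<open>t\<close> and \<open>p\<close> exhibit the composite as a retract of \<open>i\<close>, with
  the common source fixed.\<close>

lemma (in category) retract_argument:
  assumes i: "i \<in> Hom C a c" and p: "p \<in> Hom C c b"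
    and lift: "has_lifting C (Comp C p i) p"
  shows "retract_of C (Comp C p i) i"
proof -
  let ?f = "Comp C p i"
  have f: "?f \<in> Hom C a b" by (rule Comp_closed[OF i p])
  have b: "Ide C b \<in> Hom C b b" and a: "Ide C a \<in> Hom C a a"
    using Hom_Obj[OF f] Ide_closed by auto
  have "Comp C p i = Comp C (Ide C b) ?f" by (simp add: Ide_Comp[OF f])
  then obtain t where t: "t \<in> Hom C b c" "Comp C t ?f = i" "Comp C p t = Ide C b"
    using lift i p f b unfolding has_lifting_def by (metis HomD(2) HomD(3))
  show ?thesis
    unfolding retract_of_def
    using f i p t a b Comp_Ide[OF i] Comp_Ide[OF f] Ide_Comp[OF a] HomD[OF i] HomD[OF f]
    by metis
qed

lemma (in category) has_lifting_Comp:
  assumes i: "i \<in> Hom C a b" and j: "j \<in> Hom C b c"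
    and li: "has_lifting C i p" and lj: "has_lifting C j p" and p: "p \<in> Arr C"
  shows "has_lifting C (Comp C j i) p"
proof -
  have p': "p \<in> Hom C (Dom C p) (Cod C p)" using p by (simp add: Hom_def)
  have ji: "Comp C j i \<in> Hom C a c" by (rule Comp_closed[OF i j])
  show ?thesis
    unfolding has_lifting_def HomD[OF ji]
  proof (intro allI impI, elim conjE)
    fix u v assume u: "u \<in> Hom C a (Dom C p)" and v: "v \<in> Hom C c (Cod C p)"
      and eq: "Comp C p u = Comp C v (Comp C j i)"
    have vj: "Comp C v j \<in> Hom C b (Cod C p)" by (rule Comp_closed[OF j v])
    have "Comp C p u = Comp C (Comp C v j) i" using eq Comp_assoc[OF i j v] by simp
    then obtain h where h: "h \<in> Hom C b (Dom C p)" "Comp C h i = u" "Comp C p h = Comp C v j"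
      using li u vj HomD[OF i] unfolding has_lifting_def by metis
    then obtain g where g: "g \<in> Hom C c (Dom C p)" "Comp C g j = h" "Comp C p g = v"
      using lj v HomD[OF j] unfolding has_lifting_def by metis
    show "\<exists>h\<in>Hom C c (Dom C p). Comp C h (Comp C j i) = u \<and> Comp C p h = v"
      using g h Comp_assoc[OF i j g(1)] by metis
  qed
qed

definition is_coproduct :: "('o, 'm, 'z) cat_scheme \<Rightarrow> 'o \<Rightarrow> 'o \<Rightarrow> 'o \<Rightarrow> 'm \<Rightarrow> 'm \<Rightarrow> bool" where
  "is_coproduct C a b c i j \<longleftrightarrow> i \<in> Hom C a c \<and> j \<in> Hom C b c \<and>
    (\<forall>d f g. f \<in> Hom C a d \<and> g \<in> Hom C b d \<longrightarrow>
      (\<exists>!h. h \<in> Hom C c d \<and> Comp C h i = f \<and> Comp C h j = g))"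

lemma is_coproduct_commute: "is_coproduct C a b c i j \<Longrightarrow> is_coproduct C b a c j i"
  unfolding is_coproduct_def by (metis (no_types, lifting))

text \<open>Lifting against the map from an initial object to \<open>x\<close>, stated without that
  object: the square would commute anyway.\<close>

definition has_left_lifting :: "('o, 'm, 'z) cat_scheme \<Rightarrow> 'o \<Rightarrow> 'm \<Rightarrow> bool" where
  "has_left_lifting C x p \<longleftrightarrow>
    (\<forall>v \<in> Hom C x (Cod C p). \<exists>h \<in> Hom C x (Dom C p). Comp C p h = v)"

text \<open>The lift is glued from \<open>u\<close> on the summand \<open>a\<close> and a lift of
  the restriction of \<open>v\<close> on the summand \<open>b\<close>.\<close>

lemma (in category) coproduct_inclusion_lifting:
  assumes cop: "is_coproduct C a b c i j" and p: "p \<in> Arr C" and b: "has_left_lifting C b p"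
  shows "has_lifting C i p"
proof -
  have i: "i \<in> Hom C a c" and j: "j \<in> Hom C b c"
    and univ: "\<And>d f g. f \<in> Hom C a d \<Longrightarrow> g \<in> Hom C b d \<Longrightarrow>
      \<exists>!h. h \<in> Hom C c d \<and> Comp C h i = f \<and> Comp C h j = g"
    using cop unfolding is_coproduct_def by blast+
  have p': "p \<in> Hom C (Dom C p) (Cod C p)" using p by (simp add: Hom_def)
  show ?thesis
    unfolding has_lifting_def HomD[OF i]
  proof (intro allI impI, elim conjE)
    fix u v assume u: "u \<in> Hom C a (Dom C p)" and v: "v \<in> Hom C c (Cod C p)"
      and eq: "Comp C p u = Comp C v i"
    have "Comp C v j \<in> Hom C b (Cod C p)" by (rule Comp_closed[OF j v])
    then obtain w where w: "w \<in> Hom C b (Dom C p)" "Comp C p w = Comp C v j"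
      using b unfolding has_left_lifting_def by blast
    obtain h where h: "h \<in> Hom C c (Dom C p)" "Comp C h i = u" "Comp C h j = w"
      using univ[OF u w(1)] by blast
    have ph: "Comp C p h \<in> Hom C c (Cod C p)" by (rule Comp_closed[OF h(1) p'])
    have "Comp C (Comp C p h) i = Comp C v i" "Comp C (Comp C p h) j = Comp C v j"
      using Comp_assoc[OF i h(1) p'] Comp_assoc[OF j h(1) p'] h eq w by simp_all
    then have "Comp C p h = v"
      using univ[OF Comp_closed[OF i v] Comp_closed[OF j v]] ph v by blast
    then show "\<exists>h\<in>Hom C c (Dom C p). Comp C h i = u \<and> Comp C p h = v" using h by blast
  qed
qed

section \<open>Terminal objects, initial objects and binary coproducts from small limits and
  colimits\<close>

definition is_terminal :: "('o, 'm, 'z) cat_scheme \<Rightarrow> 'o \<Rightarrow> bool" where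
  "is_terminal C a \<longleftrightarrow> a \<in> Obj C \<and> (\<forall>b \<in> Obj C. \<exists>!f. f \<in> Hom C b a)"

lemma is_initialD:
  assumes "is_initial C a" "b \<in> Obj C"
  shows "\<exists>f. f \<in> Hom C a b" "f \<in> Hom C a b \<Longrightarrow> g \<in> Hom C a b \<Longrightarrow> f = g"
  using assms unfolding is_initial_def by blast+

lemma small_complete_terminal:
  fixes U :: "'u::infinite itself"
  assumes "small_complete U C"
  shows "\<exists>t. is_terminal C t"
proof -
  let ?J = "\<lparr>Obj = {}, Arr = {}, Dom = undefined, Cod = undefined, Ide = undefined,
    Comp = undefined\<rparr> :: ('u, 'u) cat"
  let ?D = "\<lparr>fobj = \<lambda>_. undefined, farr = \<lambda>_. undefined\<rparr> :: ('u, 'u, 'a, 'b) ftor"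
  have J: "category ?J" by (unfold_locales) (auto simp: Hom_def)
  have D: "is_functor ?J C ?D" by (auto simp: is_functor_def)
  obtain c \<pi> where "is_limit C ?J ?D c \<pi>"
    using assms J D unfolding small_complete_def by blast
  then show ?thesis
    by (intro exI[of _ c]) (simp add: is_limit_def is_cone_def is_terminal_def)
qed

lemma small_cocomplete_initial:
  fixes U :: "'u::infinite itself"
  assumes "small_cocomplete U C"
  shows "\<exists>t. is_initial C t"
proof -
  let ?J = "\<lparr>Obj = {}, Arr = {}, Dom = undefined, Cod = undefined, Ide = undefined,
    Comp = undefined\<rparr> :: ('u, 'u) cat"
  let ?D = "\<lparr>fobj = \<lambda>_. undefined, farr = \<lambda>_. undefined\<rparr> :: ('u, 'u, 'a, 'b) ftor"
  have J: "category ?J" by (unfold_locales) (auto simp: Hom_def)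
  have D: "is_functor ?J C ?D" by (auto simp: is_functor_def)
  obtain c \<iota> where "is_colimit C ?J ?D c \<iota>"
    using assms J D unfolding small_cocomplete_def by blast
  then show ?thesis
    by (intro exI[of _ c]) (simp add: is_colimit_def is_cocone_def is_initial_def)
qed

lemma (in category) small_cocomplete_coproduct:
  fixes U :: "'u::infinite itself"
  assumes "small_cocomplete U C" and a: "a \<in> Obj C" and b: "b \<in> Obj C"
  shows "\<exists>c i j. is_coproduct C a b c i j"
proof -
  \<comment> \<open>The discrete shape with two objects has to live in the universe; an infinite
    type supplies two distinct points.\<close>
  obtain x y :: 'u where xy: "x \<noteq> y"
    using infinite_UNIV[where 'a='u] by (metis (full_types) UNIV_eq_I finite.simps insertI1)
  let ?J = "\<lparr>Obj = {x, y}, Arr = {x, y}, Dom = \<lambda>x. x, Cod = \<lambda>x. x, Ide = \<lambda>x. x,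
    Comp = \<lambda>g f. f\<rparr> :: ('u, 'u) cat"
  let ?o = "\<lambda>z. if z = x then a else b"
  let ?D = "\<lparr>fobj = \<lambda>z\<in>{x, y}. ?o z, farr = \<lambda>z\<in>{x, y}. Ide C (?o z)\<rparr>"
  have J: "category ?J" by (unfold_locales) (auto simp: Hom_def)
  have D: "is_functor ?J C ?D"
    using a b xy Ide_closed[OF a] Ide_closed[OF b] Comp_Ide[OF Ide_closed[OF a]]
      Comp_Ide[OF Ide_closed[OF b]]
    by (auto simp: is_functor_def HomD)
  obtain c \<iota> where c: "is_colimit C ?J ?D c \<iota>"
    using assms J D unfolding small_cocomplete_def by blast
  have cocone: "is_cocone C ?J ?D d \<kappa> \<longleftrightarrow> d \<in> Obj C \<and> \<kappa> x \<in> Hom C a d \<and> \<kappa> y \<in> Hom C b d" for d \<kappa>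
    using xy Comp_Ide by (auto simp: is_cocone_def)
  have "is_coproduct C a b c (\<iota> x) (\<iota> y)"
    unfolding is_coproduct_def
  proof (intro conjI allI impI)
    show "\<iota> x \<in> Hom C a c" "\<iota> y \<in> Hom C b c"
      using c cocone unfolding is_colimit_def by blast+
    fix d f g assume fg: "f \<in> Hom C a d \<and> g \<in> Hom C b d"
    then have "is_cocone C ?J ?D d (\<lambda>z. if z = x then f else g)"
      using cocone xy Hom_Obj by auto
    then have "\<exists>!h. h \<in> Hom C c d \<and> (\<forall>j \<in> Obj ?J. Comp C h (\<iota> j) = (if j = x then f else g))"
      using c unfolding is_colimit_def by blast
    then show "\<exists>!h. h \<in> Hom C c d \<and> Comp C h (\<iota> x) = f \<and> Comp C h (\<iota> y) = g"
      using xy by (simp cong: conj_cong)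
  qed
  then show ?thesis by blast
qed

section \<open>Ken Brown's factorization of a weak equivalence\<close>

sublocale model_category \<subseteq> category M by (rule category)

context model_category
begin

text \<open>Not among the axioms. Factor the identity as a trivial fibration \<open>p\<close> after
  some \<open>i\<close>: the identity after \<open>p\<close> is \<open>p\<close> again, so
  two-of-three applies, and the identity is a retract of \<open>p\<close>.\<close>

lemma Ide_Weq_Fib:
  assumes a: "a \<in> Obj M"
  shows "Ide M a \<in> Weq M" "Ide M a \<in> Fib M"
proof -
  have ia: "Ide M a \<in> Hom M a a" by (rule Ide_closed[OF a])
  then obtain c i p where i: "i \<in> Hom M a c" and p: "p \<in> Hom M c a" "p \<in> Fib M" "p \<in> Weq M"
    and eq: "Ide M a = Comp M p i"
    using factorization(1)[OF ia] by blast
  show "Ide M a \<in> Weq M"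
    using two_of_three(2)[OF p(1) ia p(3)] Ide_Comp[OF p(1)] p(3) by simp
  have "retract_of M (Ide M a) p"
    unfolding retract_of_def
    using HomD[OF ia] HomD[OF p(1)] i p ia eq Comp_Ide[OF ia] Ide_Comp[OF p(1)] by metis
  then show "Ide M a \<in> Fib M" using Fib_retract p(2) by blast
qed

text \<open>The axiom \<open>lifting\<close> only provides lifts; this converse, by the retract
  argument, recognizes cofibrations.\<close>

lemma lifting_imp_Cof:
  assumes f: "f \<in> Hom M a b" and lift: "\<And>p. p \<in> Fib M \<inter> Weq M \<Longrightarrow> has_lifting M f p"
  shows "f \<in> Cof M"
proof -
  obtain c i p where "i \<in> Hom M a c" "i \<in> Cof M" "p \<in> Hom M c b" "p \<in> Fib M" "p \<in> Weq M"
    "f = Comp M p i"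
    using factorization(1)[OF f] by blast
  then show ?thesis using retract_argument lift Cof_retract by blast
qed

text \<open>Here the factorization starts with a trivial cofibration. That its retract is a weak
  equivalence is all that Ken Brown's lemma asks of the induced map of colimits.\<close>

lemma lifting_imp_Weq:
  assumes f: "f \<in> Hom M a b" and lift: "\<And>p. p \<in> Fib M \<Longrightarrow> has_lifting M f p"
  shows "f \<in> Weq M"
proof -
  obtain c i p where "i \<in> Hom M a c" "i \<in> Weq M" "p \<in> Hom M c b" "p \<in> Fib M"
    "f = Comp M p i"
    using factorization(2)[OF f] by blast
  then show ?thesis using retract_argument lift Weq_retract by blast
qed

text \<open>\<open>W\<close> comes from factoring the map from the coproduct of \<open>R\<close> and
  \<open>D\<close> with components \<open>q\<close> and the identity into a cofibration and a
  trivial fibration \<open>p\<close>. Both inclusions are cofibrations by the lifting hypotheses,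
  and two-of-three makes \<open>j\<close> and \<open>s\<close> weak equivalences. The point is that
  a functor which turns trivial cofibrations into weak equivalences then also does so with
  \<open>q\<close>.\<close>

lemma Ken_Brown_factorization:
  assumes q: "q \<in> Hom M R D" "q \<in> Weq M"
    and R: "\<And>p. p \<in> Fib M \<inter> Weq M \<Longrightarrow> has_left_lifting M R p"
    and D: "\<And>p. p \<in> Fib M \<inter> Weq M \<Longrightarrow> has_left_lifting M D p"
  shows "\<exists>W p j s. p \<in> Hom M W D \<and> j \<in> Hom M R W \<and> s \<in> Hom M D W \<and>
    j \<in> Cof M \<inter> Weq M \<and> s \<in> Cof M \<inter> Weq M \<and> Comp M p j = q \<and> Comp M p s = Ide M D"
proof -
  have RD: "R \<in> Obj M" "D \<in> Obj M" using Hom_Obj[OF q(1)] by auto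
  have iD: "Ide M D \<in> Hom M D D" by (rule Ide_closed[OF RD(2)])
  obtain B i1 i2 where cop: "is_coproduct M R D B i1 i2"
    using small_cocomplete_coproduct[OF cocomplete RD] by blast
  then have i: "i1 \<in> Hom M R B" "i2 \<in> Hom M D B" by (auto simp: is_coproduct_def)
  obtain f where f: "f \<in> Hom M B D" "Comp M f i1 = q" "Comp M f i2 = Ide M D"
    using cop q(1) iD unfolding is_coproduct_def by metis
  obtain W k p where k: "k \<in> Hom M B W" "k \<in> Cof M"
    and p: "p \<in> Hom M W D" "p \<in> Fib M" "p \<in> Weq M" and fpk: "f = Comp M p k"
    using factorization(1)[OF f(1)] by blast
  have j: "Comp M k i1 \<in> Hom M R W" and s: "Comp M k i2 \<in> Hom M D W"
    using Comp_closed i k by blast+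
  have pj: "Comp M p (Comp M k i1) = q" and ps: "Comp M p (Comp M k i2) = Ide M D"
    using Comp_assoc[OF i(1) k(1) p(1)] Comp_assoc[OF i(2) k(1) p(1)] f fpk by simp_all
  have "Comp M k i1 \<in> Cof M"
  proof (rule lifting_imp_Cof[OF j])
    fix r assume r: "r \<in> Fib M \<inter> Weq M"
    then have "r \<in> Arr M" using Fib_Arr by blast
    then show "has_lifting M (Comp M k i1) r"
      using has_lifting_Comp[OF i(1) k(1)] coproduct_inclusion_lifting[OF cop _ D[OF r]]
        lifting(1)[OF k(2) r] by blast
  qed
  moreover have "Comp M k i2 \<in> Cof M"
  proof (rule lifting_imp_Cof[OF s])
    fix r assume r: "r \<in> Fib M \<inter> Weq M"
    then have "r \<in> Arr M" using Fib_Arr by blast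
    then show "has_lifting M (Comp M k i2) r"
      using has_lifting_Comp[OF i(2) k(1)] lifting(1)[OF k(2) r]
        coproduct_inclusion_lifting[OF is_coproduct_commute[OF cop] _ R[OF r]] by blast
  qed
  moreover have "Comp M k i1 \<in> Weq M"
    using two_of_three(3)[OF j p(1) p(3)] pj q(2) by simp
  moreover have "Comp M k i2 \<in> Weq M"
    using two_of_three(3)[OF s p(1) p(3)] ps Ide_Weq_Fib(1)[OF RD(2)] by simp
  ultimately show ?thesis using j s pj ps p(1) by blast
qed

end

section \<open>Natural families and projective cofibrancy\<close>

text \<open>A bare family of components instead of an \<open>ntrans\<close> record: its values off
  \<open>Obj J\<close> are free, so composites and whiskerings need no restriction.\<close>

definition natural ::
  "('o1, 'm1, 'y) cat_scheme \<Rightarrow> ('o, 'm, 'z) cat_scheme \<Rightarrow> ('o1, 'm1, 'o, 'm) ftor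
    \<Rightarrow> ('o1, 'm1, 'o, 'm) ftor \<Rightarrow> ('o1 \<Rightarrow> 'm) \<Rightarrow> bool" where
  "natural J C F G t \<longleftrightarrow> is_functor J C F \<and> is_functor J C G \<and>
    (\<forall>a \<in> Obj J. t a \<in> Hom C (fobj F a) (fobj G a)) \<and>
    (\<forall>f \<in> Arr J. Comp C (t (Cod J f)) (farr F f) = Comp C (farr G f) (t (Dom J f)))"

definition ntrans_of ::
  "('o1, 'm1, 'y) cat_scheme \<Rightarrow> ('o1, 'm1, 'o, 'm) ftor \<Rightarrow> ('o1, 'm1, 'o, 'm) ftor
    \<Rightarrow> ('o1 \<Rightarrow> 'm) \<Rightarrow> ('o1, 'm1, 'o, 'm) ntrans" where
  "ntrans_of J F G t = \<lparr>nsrc = F, ntrg = G, ncmp = restrict t (Obj J)\<rparr>"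

lemma Hom_fun_cat:
  "t \<in> Hom (fun_cat J C) F G \<longleftrightarrow>
    nsrc t = F \<and> ntrg t = G \<and> ncmp t \<in> extensional (Obj J) \<and> natural J C F G (ncmp t)"
  by (auto simp: Hom_def fun_cat_def is_ntrans_def natural_def)

lemma (in category) natural_cong:
  assumes "\<And>a. a \<in> Obj C \<Longrightarrow> s a = t a"
  shows "natural C B F G s \<longleftrightarrow> natural C B F G t"
  using assms Dom_closed Cod_closed by (auto simp: natural_def)

lemma (in category) ntrans_of_Hom:
  "ntrans_of C F G t \<in> Hom (fun_cat C B) F G \<longleftrightarrow> natural C B F G t"
  unfolding Hom_fun_cat using natural_cong[of "restrict t (Obj C)" t B F G]
  by (simp add: ntrans_of_def)

lemma ntrans_of_ncmp: "t \<in> Hom (fun_cat J C) F G \<Longrightarrow> ntrans_of J F G (ncmp t) = t"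
  by (cases t) (auto simp: Hom_fun_cat ntrans_of_def extensional_restrict)

lemma ncmp_ntrans_of: "a \<in> Obj J \<Longrightarrow> ncmp (ntrans_of J F G t) a = t a"
  by (simp add: ntrans_of_def)

lemma Comp_ntrans_of:
  "Comp (fun_cat J C) (ntrans_of J G H s) (ntrans_of J F G' t) =
    ntrans_of J F H (\<lambda>a. Comp C (s a) (t a))"
  by (auto simp: fun_cat_def ntrans_of_def)

lemma ntrans_of_eq_iff: "ntrans_of J F G s = ntrans_of J F G t \<longleftrightarrow> (\<forall>a \<in> Obj J. s a = t a)"
  by (auto simp: ntrans_of_def fun_eq_iff restrict_def)

lemma functor_Hom:
  assumes "is_functor J C F" "f \<in> Hom J a b"
  shows "farr F f \<in> Hom C (fobj F a) (fobj F b)"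
  using assms unfolding is_functor_def Hom_def by auto

lemma functor_Obj: "is_functor J C F \<Longrightarrow> a \<in> Obj J \<Longrightarrow> fobj F a \<in> Obj C"
  by (auto simp: is_functor_def)

lemma functor_Comp:
  assumes "is_functor J C F" "f \<in> Hom J a b" "g \<in> Hom J b c"
  shows "farr F (Comp J g f) = Comp C (farr F g) (farr F f)"
  using assms unfolding is_functor_def Hom_def by auto

lemma natural_Hom: "natural J C F G t \<Longrightarrow> a \<in> Obj J \<Longrightarrow> t a \<in> Hom C (fobj F a) (fobj G a)"
  by (simp add: natural_def)

lemma natural_Comp:
  assumes J: "category J" and C: "category C"
    and s: "natural J C F G s" and t: "natural J C G H t"
  shows "natural J C F H (\<lambda>a. Comp C (t a) (s a))"
  unfolding natural_def
proof (intro conjI ballI)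
  interpret J: category J by fact
  interpret C: category C by fact
  show "is_functor J C F" "is_functor J C H" using s t by (auto simp: natural_def)
  show "Comp C (t a) (s a) \<in> Hom C (fobj F a) (fobj H a)" if "a \<in> Obj J" for a
    using C.Comp_closed natural_Hom[OF s that] natural_Hom[OF t that] by blast
  fix f assume f: "f \<in> Arr J"
  then have f': "f \<in> Hom J (Dom J f) (Cod J f)" by (simp add: Hom_def)
  have d: "Dom J f \<in> Obj J" "Cod J f \<in> Obj J" using f J.Dom_closed J.Cod_closed by auto
  have fn: "is_functor J C F" "is_functor J C G" "is_functor J C H"
    using s t by (auto simp: natural_def)
  note h = functor_Hom[OF fn(1) f'] functor_Hom[OF fn(2) f'] functor_Hom[OF fn(3) f']
    natural_Hom[OF s d(1)] natural_Hom[OF s d(2)] natural_Hom[OF t d(1)] natural_Hom[OF t d(2)]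
  have "Comp C (Comp C (t (Cod J f)) (s (Cod J f))) (farr F f)
      = Comp C (t (Cod J f)) (Comp C (s (Cod J f)) (farr F f))"
    using C.Comp_assoc[OF h(1) h(5) h(7)] by simp
  also have "\<dots> = Comp C (t (Cod J f)) (Comp C (farr G f) (s (Dom J f)))"
    using s f by (simp add: natural_def)
  also have "\<dots> = Comp C (Comp C (t (Cod J f)) (farr G f)) (s (Dom J f))"
    using C.Comp_assoc[OF h(4) h(2) h(7)] by simp
  also have "\<dots> = Comp C (Comp C (farr H f) (t (Dom J f))) (s (Dom J f))"
    using t f by (simp add: natural_def)
  also have "\<dots> = Comp C (farr H f) (Comp C (t (Dom J f)) (s (Dom J f)))"
    using C.Comp_assoc[OF h(4) h(6) h(3)] by simp
  finally show "Comp C (Comp C (t (Cod J f)) (s (Cod J f))) (farr F f)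
      = Comp C (farr H f) (Comp C (t (Dom J f)) (s (Dom J f)))" .
qed

lemma natural_Ide:
  assumes J: "category J" and C: "category C" and F: "is_functor J C F"
  shows "natural J C F F (\<lambda>a. Ide C (fobj F a))"
proof -
  interpret J: category J by fact
  interpret C: category C by fact
  show ?thesis
    unfolding natural_def
  proof (intro conjI ballI F)
    show "Ide C (fobj F a) \<in> Hom C (fobj F a) (fobj F a)" if "a \<in> Obj J" for a
      using C.Ide_closed functor_Obj[OF F that] by blast
    fix f assume "f \<in> Arr J"
    then have "farr F f \<in> Hom C (fobj F (Dom J f)) (fobj F (Cod J f))"
      using F by (simp add: is_functor_def)
    then show "Comp C (Ide C (fobj F (Cod J f))) (farr F f) = Comp C (farr F f) (Ide C (fobj F (Dom J f)))"
      using C.Comp_Ide C.Ide_Comp by simp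
  qed
qed

section \<open>Constant diagrams and cocones\<close>

definition const_functor :: "('o1, 'm1, 'y) cat_scheme \<Rightarrow> ('o, 'm, 'z) cat_scheme \<Rightarrow> 'o
    \<Rightarrow> ('o1, 'm1, 'o, 'm) ftor" where
  "const_functor J C c = \<lparr>fobj = (\<lambda>a \<in> Obj J. c), farr = (\<lambda>f \<in> Arr J. Ide C c)\<rparr>"

lemma fobj_const_functor: "a \<in> Obj J \<Longrightarrow> fobj (const_functor J C c) a = c"
  by (simp add: const_functor_def)

lemma farr_const_functor: "f \<in> Arr J \<Longrightarrow> farr (const_functor J C c) f = Ide C c"
  by (simp add: const_functor_def)

lemma is_functor_const_functor:
  assumes J: "category J" and C: "category C" and c: "c \<in> Obj C"
  shows "is_functor J C (const_functor J C c)"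
proof -
  interpret J: category J by fact
  interpret C: category C by fact
  note c' = C.Ide_closed[OF c]
  have A: "Ide J a \<in> Arr J" if "a \<in> Obj J" for a using J.Ide_closed[OF that] by (simp add: Hom_def)
  have B: "Comp J g f \<in> Arr J" if "f \<in> Arr J" "g \<in> Arr J" "Cod J f = Dom J g" for f g
    using J.Comp_closed[of f "Dom J f" "Cod J f" g "Cod J g"] that by (simp add: Hom_def)
  show ?thesis
    unfolding is_functor_def const_functor_def
    using c c' A B C.Comp_Ide[OF c'] J.Dom_closed J.Cod_closed HomD(1)[OF c'] by auto
qed

text \<open>For empty \<open>J\<close> naturality says nothing about \<open>c\<close>, so
  \<open>c \<in> Obj C\<close> is a separate conjunct.\<close>

lemma natural_const_functor_iff:
  assumes J: "category J" and C: "category C" and F: "is_functor J C F"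
  shows "c \<in> Obj C \<and> natural J C F (const_functor J C c) \<kappa> \<longleftrightarrow> is_cocone C J F c \<kappa>"
proof -
  interpret J: category J by fact
  interpret C: category C by fact
  show ?thesis
    unfolding natural_def is_cocone_def
    using F is_functor_const_functor[OF J C] J.Dom_closed J.Cod_closed C.Ide_Comp
    by (force simp: fobj_const_functor farr_const_functor)
qed

lemma natural_const_functors:
  assumes J: "category J" and C: "category C" and f: "f \<in> Hom C a b"
  shows "natural J C (const_functor J C a) (const_functor J C b) (\<lambda>_. f)"
proof -
  interpret J: category J by fact
  interpret C: category C by fact
  show ?thesis
    unfolding natural_def
    using f C.Hom_Obj[OF f] is_functor_const_functor[OF J C] C.Ide_Comp[OF f] C.Comp_Ide[OF f]
    by (auto simp: fobj_const_functor farr_const_functor)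
qed

section \<open>Projective cofibrancy as a lifting property of components\<close>

lemma projective_simps [simp]:
  "Obj (projective J M) = Obj (fun_cat J M)" "Arr (projective J M) = Arr (fun_cat J M)"
  "Dom (projective J M) = Dom (fun_cat J M)" "Cod (projective J M) = Cod (fun_cat J M)"
  "Ide (projective J M) = Ide (fun_cat J M)" "Comp (projective J M) = Comp (fun_cat J M)"
  "Weq (projective J M) = objectwise J M (Weq M)" "Fib (projective J M) = objectwise J M (Fib M)"
  by (simp_all add: projective_def cat.defs mcat.defs)

lemma Cof_projective:
  "Cof (projective J M) = {i \<in> Arr (fun_cat J M).
    \<forall>p \<in> objectwise J M (Fib M) \<inter> objectwise J M (Weq M). has_lifting (fun_cat J M) i p}"
  by (simp add: projective_def cat.defs mcat.defs)

lemma Hom_projective [simp]: "Hom (projective J M) = Hom (fun_cat J M)"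
  by (simp add: Hom_def fun_eq_iff)

lemma has_lifting_projective [simp]:
  "has_lifting (projective J M) = has_lifting (fun_cat J M)"
  by (simp add: has_lifting_def fun_eq_iff)

lemma is_initial_projective [simp]: "is_initial (projective J M) = is_initial (fun_cat J M)"
  by (simp add: is_initial_def fun_eq_iff)

lemma in_objectwise_iff:
  "t \<in> objectwise J C W \<longleftrightarrow> t \<in> Hom (fun_cat J C) (nsrc t) (ntrg t) \<and> (\<forall>a \<in> Obj J. ncmp t a \<in> W)"
  by (auto simp: objectwise_def fun_cat_def Hom_def)

lemma fun_cat_simps [simp]:
  "Dom (fun_cat J C) = nsrc" "Cod (fun_cat J C) = ntrg" "Obj (fun_cat J C) = {F. is_functor J C F}"
  by (simp_all add: fun_cat_def)

text \<open>The lifting property that characterizes cofibrant diagrams. It makes sense for every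
  shape, whether or not the diagrams are known to form a model category.\<close>

definition projectively_cofibrant ::
  "('o1, 'm1, 'y) cat_scheme \<Rightarrow> ('o, 'm, 'z) mcat_scheme \<Rightarrow> ('o1, 'm1, 'o, 'm) ftor \<Rightarrow> bool" where
  "projectively_cofibrant J M Q \<longleftrightarrow> is_functor J M Q \<and>
    (\<forall>Y Z p v. natural J M Y Z p \<and> (\<forall>a \<in> Obj J. p a \<in> Fib M \<inter> Weq M) \<and> natural J M Q Z v \<longrightarrow>
      (\<exists>h. natural J M Q Y h \<and> (\<forall>a \<in> Obj J. Comp M (p a) (h a) = v a)))"

lemma projectively_cofibrant_iff:
  assumes J: "category J"
  shows "projectively_cofibrant J M Q \<longleftrightarrow> is_functor J M Q \<and>
    (\<forall>p \<in> objectwise J M (Fib M) \<inter> objectwise J M (Weq M). has_left_lifting (fun_cat J M) Q p)"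
    (is "?L \<longleftrightarrow> ?R")
proof
  interpret J: category J by fact
  assume L: ?L
  show ?R
  proof (intro conjI ballI)
    show "is_functor J M Q" using L by (simp add: projectively_cofibrant_def)
    fix p assume p: "p \<in> objectwise J M (Fib M) \<inter> objectwise J M (Weq M)"
    then have p': "p \<in> Hom (fun_cat J M) (nsrc p) (ntrg p)" "natural J M (nsrc p) (ntrg p) (ncmp p)"
      "\<forall>a \<in> Obj J. ncmp p a \<in> Fib M \<inter> Weq M"
      by (auto simp: in_objectwise_iff Hom_fun_cat)
    show "has_left_lifting (fun_cat J M) Q p"
      unfolding has_left_lifting_def fun_cat_simps
    proof
      fix v assume v: "v \<in> Hom (fun_cat J M) Q (ntrg p)"
      then obtain h where h: "natural J M Q (nsrc p) h" "\<forall>a \<in> Obj J. Comp M (ncmp p a) (h a) = ncmp v a"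
        using L p' unfolding projectively_cofibrant_def Hom_fun_cat by blast
      have "Comp (fun_cat J M) (ntrans_of J (nsrc p) (ntrg p) (ncmp p)) (ntrans_of J Q (nsrc p) h)
          = ntrans_of J Q (ntrg p) (ncmp v)"
        unfolding Comp_ntrans_of ntrans_of_eq_iff using h(2) .
      then have "Comp (fun_cat J M) p (ntrans_of J Q (nsrc p) h) = v"
        using ntrans_of_ncmp[OF p'(1)] ntrans_of_ncmp[OF v] by simp
      then show "\<exists>h\<in>Hom (fun_cat J M) Q (nsrc p). Comp (fun_cat J M) p h = v"
        using J.ntrans_of_Hom h(1) by blast
    qed
  qed
next
  interpret J: category J by fact
  assume R: ?R
  show ?L
    unfolding projectively_cofibrant_def
  proof (intro conjI allI impI; (elim conjE)?)
    show "is_functor J M Q" using R by simp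
    fix Y Z p v
    assume p: "natural J M Y Z p" "\<forall>a\<in>Obj J. p a \<in> Fib M \<inter> Weq M" and v: "natural J M Q Z v"
    let ?p = "ntrans_of J Y Z p" and ?v = "ntrans_of J Q Z v"
    have s: "nsrc ?p = Y" "ntrg ?p = Z" by (simp_all add: ntrans_of_def)
    have "?p \<in> objectwise J M (Fib M) \<inter> objectwise J M (Weq M)"
      using p J.ntrans_of_Hom[of Y Z p M] by (simp add: in_objectwise_iff s ncmp_ntrans_of)
    then have "has_left_lifting (fun_cat J M) Q ?p" using R by blast
    then obtain h where h: "h \<in> Hom (fun_cat J M) Q Y" "Comp (fun_cat J M) ?p h = ?v"
      using v J.ntrans_of_Hom[of Q Z v M] unfolding has_left_lifting_def fun_cat_simps s by blast
    have "\<forall>a\<in>Obj J. Comp M (p a) (ncmp h a) = v a"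
      using h(2) Comp_ntrans_of[of J M Y Z p Q Y "ncmp h"] ntrans_of_ncmp[OF h(1)]
      by (simp add: ntrans_of_eq_iff)
    then show "\<exists>h. natural J M Q Y h \<and> (\<forall>a\<in>Obj J. Comp M (p a) (h a) = v a)"
      using h(1) by (auto simp: Hom_fun_cat)
  qed
qed

text \<open>The unique maps out of \<open>c\<close> are automatically natural, since two maps out of
  an initial object with the same target agree.\<close>

lemma fun_cat_initial:
  assumes J: "category J" and C: "category C" and c: "is_initial C c"
  shows "is_initial (fun_cat J C) (const_functor J C c)"
proof -
  interpret J: category J by fact
  interpret C: category C by fact
  have cO: "c \<in> Obj C" and ex: "\<And>b. b \<in> Obj C \<Longrightarrow> \<exists>!f. f \<in> Hom C c b"
    using c by (auto simp: is_initial_def)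
  show ?thesis
    unfolding is_initial_def
  proof (intro conjI ballI)
    show "const_functor J C c \<in> Obj (fun_cat J C)" using is_functor_const_functor[OF J C cO] by simp
    fix G assume "G \<in> Obj (fun_cat J C)"
    then have G: "is_functor J C G" by simp
    define t where "t a = (THE f. f \<in> Hom C c (fobj G a))" for a
    have t: "t a \<in> Hom C c (fobj G a)" if "a \<in> Obj J" for a
      unfolding t_def by (rule theI'[OF ex[OF functor_Obj[OF G that]]])
    have nat: "natural J C (const_functor J C c) G t"
      unfolding natural_def
    proof (intro conjI ballI G is_functor_const_functor[OF J C cO])
      show "t a \<in> Hom C (fobj (const_functor J C c) a) (fobj G a)" if "a \<in> Obj J" for a
        using t[OF that] that by (simp add: fobj_const_functor)
      fix f assume f: "f \<in> Arr J"
      have d: "Dom J f \<in> Obj J" "Cod J f \<in> Obj J" using f J.Dom_closed J.Cod_closed by auto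
      have "farr G f \<in> Hom C (fobj G (Dom J f)) (fobj G (Cod J f))"
        using G f by (simp add: is_functor_def)
      then have "Comp C (farr G f) (t (Dom J f)) \<in> Hom C c (fobj G (Cod J f))"
        using C.Comp_closed t d by blast
      then show "Comp C (t (Cod J f)) (farr (const_functor J C c) f) = Comp C (farr G f) (t (Dom J f))"
        using ex[OF functor_Obj[OF G d(2)]] t[OF d(2)] C.Comp_Ide[OF t[OF d(2)]]
        by (auto simp: farr_const_functor f)
    qed
    show "\<exists>!f. f \<in> Hom (fun_cat J C) (const_functor J C c) G"
    proof (rule ex1I)
      show "ntrans_of J (const_functor J C c) G t \<in> Hom (fun_cat J C) (const_functor J C c) G"
        using nat J.ntrans_of_Hom by blast
      fix s assume s: "s \<in> Hom (fun_cat J C) (const_functor J C c) G"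
      have "ncmp s a = t a" if a: "a \<in> Obj J" for a
      proof -
        have "natural J C (const_functor J C c) G (ncmp s)" using s by (simp add: Hom_fun_cat)
        then have "ncmp s a \<in> Hom C c (fobj G a)"
          using natural_Hom[OF _ a] a by (metis fobj_const_functor)
        then show ?thesis using ex[OF functor_Obj[OF G a]] t[OF a] by blast
      qed
      then have "ntrans_of J (const_functor J C c) G (ncmp s) = ntrans_of J (const_functor J C c) G t"
        by (simp add: ntrans_of_eq_iff)
      then show "s = ntrans_of J (const_functor J C c) G t" using ntrans_of_ncmp[OF s] by simp
    qed
  qed
qed

lemma Comp_fun_cat_Hom:
  assumes J: "category J" and C: "category C"
    and s: "s \<in> Hom (fun_cat J C) F G" and t: "t \<in> Hom (fun_cat J C) G H"
  shows "Comp (fun_cat J C) t s \<in> Hom (fun_cat J C) F H"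
proof -
  interpret J: category J by fact
  have "Comp (fun_cat J C) t s = ntrans_of J F H (\<lambda>a. Comp C (ncmp t a) (ncmp s a))"
    using Comp_ntrans_of[of J C G H "ncmp t" F G "ncmp s"] ntrans_of_ncmp[OF s] ntrans_of_ncmp[OF t]
    by simp
  moreover have "natural J C F H (\<lambda>a. Comp C (ncmp t a) (ncmp s a))"
    using natural_Comp[OF J C, of F G "ncmp s" H "ncmp t"] s t by (simp add: Hom_fun_cat)
  ultimately show ?thesis by (simp add: J.ntrans_of_Hom)
qed

text \<open>Squares out of an initial diagram commute by uniqueness, so lifting against the map from
  it amounts to lifting from \<open>Q\<close> alone. Only \<open>M\<close> has to be a model
  category, which admits shapes outside the universe.\<close>

lemma (in model_category) cofibrant_projective_iff:
  fixes J :: "('o1, 'm1, 'y) cat_scheme"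
  assumes J: "category J"
  shows "cofibrant (projective J M) Q \<longleftrightarrow> projectively_cofibrant J M Q"
proof
  note cC = Comp_fun_cat_Hom[OF J category]
  assume "cofibrant (projective J M) Q"
  then obtain a f where Q: "is_functor J M Q" and a: "is_initial (fun_cat J M) a"
    and f: "f \<in> Hom (fun_cat J M) a Q" and cof: "f \<in> Cof (projective J M)"
    unfolding cofibrant_def projective_simps Hom_projective is_initial_projective fun_cat_simps
    by blast
  have lift: "has_lifting (fun_cat J M) f p"
    if "p \<in> objectwise J M (Fib M) \<inter> objectwise J M (Weq M)" for p
    using cof that by (simp add: Cof_projective)
  show "projectively_cofibrant J M Q"
    unfolding projectively_cofibrant_iff[OF J]
  proof (intro conjI ballI Q)
    fix p assume p: "p \<in> objectwise J M (Fib M) \<inter> objectwise J M (Weq M)"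
    then have p': "p \<in> Hom (fun_cat J M) (nsrc p) (ntrg p)" by (simp add: in_objectwise_iff)
    then have fY: "is_functor J M (nsrc p)" "is_functor J M (ntrg p)" by (auto simp: Hom_fun_cat natural_def)
    obtain u where u: "u \<in> Hom (fun_cat J M) a (nsrc p)"
      using is_initialD(1)[OF a, of "nsrc p"] fY by auto
    show "has_left_lifting (fun_cat J M) Q p"
      unfolding has_left_lifting_def fun_cat_simps
    proof
      fix v assume v: "v \<in> Hom (fun_cat J M) Q (ntrg p)"
      have "Comp (fun_cat J M) p u = Comp (fun_cat J M) v f"
        using is_initialD(2)[OF a _ cC[OF u p'] cC[OF f v]] fY by simp
      moreover have "nsrc f = a" "ntrg f = Q" using f by (simp_all add: Hom_fun_cat)
      ultimately obtain h where "h \<in> Hom (fun_cat J M) Q (nsrc p)" "Comp (fun_cat J M) p h = v"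
        using has_liftingD[OF lift[OF p], unfolded fun_cat_simps] u v by metis
      then show "\<exists>h\<in>Hom (fun_cat J M) Q (nsrc p). Comp (fun_cat J M) p h = v" by blast
    qed
  qed
next
  note cC = Comp_fun_cat_Hom[OF J category]
  assume L: "projectively_cofibrant J M Q"
  then have Q: "is_functor J M Q" by (simp add: projectively_cofibrant_def)
  obtain c where c: "is_initial M c" using small_cocomplete_initial[OF cocomplete] by blast
  let ?a = "const_functor J M c"
  have a: "is_initial (fun_cat J M) ?a" by (rule fun_cat_initial[OF J category c])
  then obtain f where f: "f \<in> Hom (fun_cat J M) ?a Q" using is_initialD(1)[OF a, of Q] Q by auto
  have "f \<in> Cof (projective J M)"
    unfolding Cof_projective
  proof (intro CollectI conjI ballI HomD(1)[OF f])
    fix p assume p: "p \<in> objectwise J M (Fib M) \<inter> objectwise J M (Weq M)"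
    then have p': "p \<in> Hom (fun_cat J M) (nsrc p) (ntrg p)" by (simp add: in_objectwise_iff)
    then have fY: "is_functor J M (nsrc p)" by (auto simp: Hom_fun_cat natural_def)
    have l: "has_left_lifting (fun_cat J M) Q p" using iffD1[OF projectively_cofibrant_iff[OF J] L] p by blast
    have fs: "nsrc f = ?a" "ntrg f = Q" using f by (auto simp: Hom_fun_cat)
    show "has_lifting (fun_cat J M) f p"
      unfolding has_lifting_def fun_cat_simps fs
    proof (intro allI impI, elim conjE)
      fix u v assume u: "u \<in> Hom (fun_cat J M) ?a (nsrc p)" and v: "v \<in> Hom (fun_cat J M) Q (ntrg p)"
      then obtain h where h: "h \<in> Hom (fun_cat J M) Q (nsrc p)" "Comp (fun_cat J M) p h = v"
        using l unfolding has_left_lifting_def fun_cat_simps by blast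
      have "Comp (fun_cat J M) h f = u" using is_initialD(2)[OF a _ cC[OF f h(1)] u] fY by simp
      then show "\<exists>h\<in>Hom (fun_cat J M) Q (nsrc p). Comp (fun_cat J M) h f = u \<and> Comp (fun_cat J M) p h = v"
        using h by blast
    qed
  qed
  then show "cofibrant (projective J M) Q"
    unfolding cofibrant_def projective_simps Hom_projective is_initial_projective fun_cat_simps
    using Q a f by blast
qed

section \<open>Colimits and homotopy invariance\<close>

lemma is_functor_fcomp:
  assumes J: "category J" and S: "is_functor J K S" and F: "is_functor K C F"
  shows "is_functor J C (fcomp J F S)"
proof -
  interpret J: category J by fact
  have A: "Ide J a \<in> Arr J" if "a \<in> Obj J" for a using J.Ide_closed[OF that] by (simp add: Hom_def)
  have B: "Comp J g f \<in> Arr J \<and> Dom J (Comp J g f) = Dom J f \<and> Cod J (Comp J g f) = Cod J g"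
    if "f \<in> Arr J" "g \<in> Arr J" "Cod J f = Dom J g" for f g
    using J.Comp_closed[of f "Dom J f" "Cod J f" g "Cod J g"] that by (simp add: Hom_def)
  have S1: "fobj S a \<in> Obj K" "farr S (Ide J a) = Ide K (fobj S a)" if "a \<in> Obj J" for a
    using S that unfolding is_functor_def by auto
  have S2: "farr S f \<in> Arr K \<and> Dom K (farr S f) = fobj S (Dom J f) \<and> Cod K (farr S f) = fobj S (Cod J f)"
    if "f \<in> Arr J" for f
    using S that unfolding is_functor_def by (auto simp: Hom_def)
  have S3: "farr S (Comp J g f) = Comp K (farr S g) (farr S f)"
    if "f \<in> Arr J" "g \<in> Arr J" "Cod J f = Dom J g" for f g
    using S that unfolding is_functor_def by blast
  have F1: "fobj F a \<in> Obj C" "farr F (Ide K a) = Ide C (fobj F a)" if "a \<in> Obj K" for a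
    using F that unfolding is_functor_def by auto
  have F2: "farr F f \<in> Arr C" "farr F f \<in> Hom C (fobj F (Dom K f)) (fobj F (Cod K f))" if "f \<in> Arr K" for f
    using F that unfolding is_functor_def by auto
  have F3: "farr F (Comp K g f) = Comp C (farr F g) (farr F f)"
    if "f \<in> Arr K" "g \<in> Arr K" "Cod K f = Dom K g" for f g
    using F that unfolding is_functor_def by blast
  have F2': "farr F (farr S f) \<in> Hom C (fobj F (fobj S (Dom J f))) (fobj F (fobj S (Cod J f)))"
    if "f \<in> Arr J" for f
    using F2(2)[of "farr S f"] S2[OF that] by simp
  show ?thesis
    unfolding is_functor_def fcomp_def
    using A B S1 S2 S3 F1 F2(1) F2' F3 J.Dom_closed J.Cod_closed by simp
qed

lemma fobj_fcomp: "a \<in> Obj J \<Longrightarrow> fobj (fcomp J G F) a = fobj G (fobj F a)"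
  by (simp add: fcomp_def)

lemma farr_fcomp: "f \<in> Arr J \<Longrightarrow> farr (fcomp J G F) f = farr G (farr F f)"
  by (simp add: fcomp_def)

lemma functor_Arr:
  assumes "is_functor J K S" "f \<in> Arr J"
  shows "farr S f \<in> Arr K" "Dom K (farr S f) = fobj S (Dom J f)" "Cod K (farr S f) = fobj S (Cod J f)"
  using assms unfolding is_functor_def Hom_def by auto

lemma functor_eqI:
  assumes "is_functor J C F" "is_functor J C G"
    and "\<And>a. a \<in> Obj J \<Longrightarrow> fobj F a = fobj G a" "\<And>f. f \<in> Arr J \<Longrightarrow> farr F f = farr G f"
  shows "F = G"
proof -
  have "fobj F \<in> extensional (Obj J)" "fobj G \<in> extensional (Obj J)"
    "farr F \<in> extensional (Arr J)" "farr G \<in> extensional (Arr J)"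
    using assms(1,2) by (auto simp: is_functor_def PiE_def)
  then have "fobj F = fobj G" "farr F = farr G"
    using assms(3,4) by (auto intro: extensionalityI)
  then show ?thesis by simp
qed

lemma natural_Arr:
  assumes "natural J C F G t" "f \<in> Arr J"
  shows "Comp C (t (Cod J f)) (farr F f) = Comp C (farr G f) (t (Dom J f))"
  using assms by (simp add: natural_def)

lemma natural_fcomp:
  assumes J: "category J" and S: "is_functor J K S" and t: "natural K C F G t"
  shows "natural J C (fcomp J F S) (fcomp J G S) (\<lambda>a. t (fobj S a))"
proof -
  interpret J: category J by fact
  have FG: "is_functor K C F" "is_functor K C G" using t by (auto simp: natural_def)
  show ?thesis
    unfolding natural_def
  proof (intro conjI ballI is_functor_fcomp[OF J S] FG)
    show "t (fobj S a) \<in> Hom C (fobj (fcomp J F S) a) (fobj (fcomp J G S) a)" if "a \<in> Obj J" for a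
      using natural_Hom[OF t functor_Obj[OF S that]] that by (simp add: fobj_fcomp)
    fix f assume f: "f \<in> Arr J"
    show "Comp C (t (fobj S (Cod J f))) (farr (fcomp J F S) f) =
        Comp C (farr (fcomp J G S) f) (t (fobj S (Dom J f)))"
      using natural_Arr[OF t functor_Arr(1)[OF S f]] functor_Arr(2,3)[OF S f] f
      by (simp add: farr_fcomp)
  qed
qed

text \<open>An isomorphism of shapes. The inverse laws are equalities of values on objects and
  arrows, the form in which \<open>functor_eqI\<close> identifies extensional functors.\<close>

definition inverse_functors ::
  "('o1, 'm1, 'y) cat_scheme \<Rightarrow> ('o2, 'm2, 'z) cat_scheme \<Rightarrow> ('o1, 'm1, 'o2, 'm2) ftor
    \<Rightarrow> ('o2, 'm2, 'o1, 'm1) ftor \<Rightarrow> bool" where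
  "inverse_functors J K S S' \<longleftrightarrow> is_functor J K S \<and> is_functor K J S' \<and>
    (\<forall>a \<in> Obj J. fobj S' (fobj S a) = a) \<and> (\<forall>f \<in> Arr J. farr S' (farr S f) = f) \<and>
    (\<forall>a \<in> Obj K. fobj S (fobj S' a) = a) \<and> (\<forall>f \<in> Arr K. farr S (farr S' f) = f)"

lemma inverse_functors_commute: "inverse_functors J K S S' \<Longrightarrow> inverse_functors K J S' S"
  by (simp add: inverse_functors_def)

lemma fcomp_inverse_functors:
  assumes J: "category J" and K: "category K" and S: "inverse_functors J K S S'"
    and D: "is_functor J C D"
  shows "fcomp J (fcomp K D S') S = D"
proof -
  have S1: "is_functor J K S" "is_functor K J S'" using S by (auto simp: inverse_functors_def)
  show ?thesis
  proof (rule functor_eqI[OF is_functor_fcomp[OF J S1(1) is_functor_fcomp[OF K S1(2) D]] D])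
    show "fobj (fcomp J (fcomp K D S') S) a = fobj D a" if "a \<in> Obj J" for a
      using that S functor_Obj[OF S1(1) that] by (simp add: fobj_fcomp inverse_functors_def)
    show "farr (fcomp J (fcomp K D S') S) f = farr D f" if "f \<in> Arr J" for f
      using that S functor_Arr[OF S1(1) that] by (simp add: farr_fcomp inverse_functors_def)
  qed
qed

lemma colimit_cocone: "is_colimit C J D c \<iota> \<Longrightarrow> is_cocone C J D c \<iota>"
  by (simp add: is_colimit_def)

lemma is_cocone_fcomp:
  assumes S: "is_functor K J S" and c: "is_cocone C J D c \<iota>"
  shows "is_cocone C K (fcomp K D S) c (\<lambda>k. \<iota> (fobj S k))"
  using c functor_Obj[OF S] functor_Arr[OF S]
  by (auto simp: is_cocone_def fobj_fcomp farr_fcomp) (metis (no_types, lifting))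

lemma is_colimit_fcomp:
  assumes J: "category J" and K: "category K" and S: "inverse_functors J K S S'"
    and D: "is_functor J C D" and c: "is_colimit C J D c \<iota>"
  shows "is_colimit C K (fcomp K D S') c (\<lambda>k. \<iota> (fobj S' k))"
  unfolding is_colimit_def
proof (intro conjI allI impI)
  have S1: "is_functor J K S" "is_functor K J S'" using S by (auto simp: inverse_functors_def)
  show "is_cocone C K (fcomp K D S') c (\<lambda>k. \<iota> (fobj S' k))"
    by (rule is_cocone_fcomp[OF S1(2) colimit_cocone[OF c]])
  fix d \<kappa> assume "is_cocone C K (fcomp K D S') d \<kappa>"
  then have "is_cocone C J D d (\<lambda>j. \<kappa> (fobj S j))"
    using is_cocone_fcomp[OF S1(1)] fcomp_inverse_functors[OF J K S D] by metis
  then have "\<exists>!h. h \<in> Hom C c d \<and> (\<forall>j\<in>Obj J. Comp C h (\<iota> j) = \<kappa> (fobj S j))"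
    using c unfolding is_colimit_def by blast
  moreover have "(\<forall>k\<in>Obj K. Comp C h (\<iota> (fobj S' k)) = \<kappa> k) \<longleftrightarrow>
      (\<forall>j\<in>Obj J. Comp C h (\<iota> j) = \<kappa> (fobj S j))" for h
    using S functor_Obj[OF S1(1)] functor_Obj[OF S1(2)] unfolding inverse_functors_def
    by (metis (no_types, lifting))
  ultimately show "\<exists>!h. h \<in> Hom C c d \<and> (\<forall>k\<in>Obj K. Comp C h (\<iota> (fobj S' k)) = \<kappa> k)"
    by simp
qed

text \<open>Cocompleteness speaks only of shapes whose objects and arrows lie in \<open>'u\<close>.
  The injections copy \<open>J\<close> to such a shape \<open>K\<close>, and the colimit found there
  is carried back along the isomorphism.\<close>

lemma small_cocomplete_colimit:
  fixes U :: "'u::infinite itself" and f :: "'o1 \<Rightarrow> 'u" and g :: "'m1 \<Rightarrow> 'u"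
  assumes C: "small_cocomplete U C" and J: "category J" and D: "is_functor J C D"
    and f: "inj_on f (Obj J)" and g: "inj_on g (Arr J)"
  shows "\<exists>c \<iota>. is_colimit C J D c \<iota>"
proof -
  interpret J: category J by fact
  define f' g' where "f' = inv_into (Obj J) f" and "g' = inv_into (Arr J) g"
  have f': "f' (f a) = a" if "a \<in> Obj J" for a using that f by (simp add: f'_def)
  have g': "g' (g u) = u" if "u \<in> Arr J" for u using that g by (simp add: g'_def)
  define K :: "('u, 'u) cat" where "K = \<lparr>Obj = f ` Obj J, Arr = g ` Arr J,
    Dom = \<lambda>x. f (Dom J (g' x)), Cod = \<lambda>x. f (Cod J (g' x)), Ide = \<lambda>x. g (Ide J (f' x)),
    Comp = \<lambda>x y. g (Comp J (g' x) (g' y))\<rparr>"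
  have HK: "x \<in> Hom K a b \<longleftrightarrow> (\<exists>u a' b'. u \<in> Hom J a' b' \<and> x = g u \<and> a = f a' \<and> b = f b')" for x a b
    by (auto simp: Hom_def K_def g')
  have Hin: "f a = f b \<longleftrightarrow> a = b" if "a \<in> Obj J" "b \<in> Obj J" for a b
    using f that by (auto simp: inj_on_def)
  have cK: "Comp K (g v) (g u) = g (Comp J v u)" if "u \<in> Arr J" "v \<in> Arr J" for u v
    using that by (simp add: K_def g')
  have iK: "Ide K (f a) = g (Ide J a)" if "a \<in> Obj J" for a using that by (simp add: K_def f')
  have K: "category K"
  proof
    show "Dom K x \<in> Obj K" "Cod K x \<in> Obj K" if "x \<in> Arr K" for x
      using that J.Dom_closed J.Cod_closed by (auto simp: K_def g')
    show "Ide K a \<in> Hom K a a" if "a \<in> Obj K" for a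
      using that J.Ide_closed iK unfolding HK by (force simp: K_def)
    fix x a b assume "x \<in> Hom K a b"
    then obtain u a' b' where u: "u \<in> Hom J a' b'" "x = g u" "a = f a'" "b = f b'" unfolding HK by blast
    note o = J.Hom_Obj[OF u(1)]
    note i = HomD(1)[OF J.Ide_closed[OF o(1)]] HomD(1)[OF J.Ide_closed[OF o(2)]]
    show "Comp K x (Ide K a) = x"
      using u iK[OF o(1)] cK[OF i(1) HomD(1)[OF u(1)]] J.Comp_Ide[OF u(1)] by simp
    show "Comp K (Ide K b) x = x"
      using u iK[OF o(2)] cK[OF HomD(1)[OF u(1)] i(2)] J.Ide_Comp[OF u(1)] by simp
    fix y c assume "y \<in> Hom K b c"
    then obtain v b2 c' where v: "v \<in> Hom J b2 c'" "y = g v" "b = f b2" "c = f c'" unfolding HK by blast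
    have "b2 = b'" using Hin u(4) v(3) J.Hom_Obj[OF v(1)] o by auto
    then have v': "v \<in> Hom J b' c'" using v by simp
    have vu: "Comp J v u \<in> Hom J a' c'" by (rule J.Comp_closed[OF u(1) v'])
    have cvu: "Comp K y x = g (Comp J v u)"
      using u v cK[OF HomD(1)[OF u(1)] HomD(1)[OF v(1)]] by simp
    show "Comp K y x \<in> Hom K a c" unfolding HK cvu using vu u v by blast
    fix z d assume "z \<in> Hom K c d"
    then obtain w c2 d' where w: "w \<in> Hom J c2 d'" "z = g w" "c = f c2" "d = f d'" unfolding HK by blast
    have "c2 = c'" using Hin v(4) w(3) J.Hom_Obj[OF w(1)] J.Hom_Obj[OF v'] by auto
    then have w': "w \<in> Hom J c' d'" using w by simp
    have wv: "Comp J w v \<in> Hom J b' d'" by (rule J.Comp_closed[OF v' w'])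
    have "Comp K z y = g (Comp J w v)"
      using w v cK[OF HomD(1)[OF v(1)] HomD(1)[OF w(1)]] by simp
    then show "Comp K z (Comp K y x) = Comp K (Comp K z y) x"
      using cvu u w cK[OF HomD(1)[OF vu] HomD(1)[OF w(1)]] cK[OF HomD(1)[OF u(1)] HomD(1)[OF wv]]
        J.Comp_assoc[OF u(1) v' w'] by simp
  qed
  let ?S = "\<lparr>fobj = restrict f (Obj J), farr = restrict g (Arr J)\<rparr>"
  let ?S' = "\<lparr>fobj = restrict f' (Obj K), farr = restrict g' (Arr K)\<rparr>"
  have A: "Ide J a \<in> Arr J" if "a \<in> Obj J" for a using J.Ide_closed[OF that] by (simp add: Hom_def)
  have B: "Comp J v u \<in> Arr J" if "u \<in> Arr J" "v \<in> Arr J" "Cod J u = Dom J v" for u v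
    using J.Comp_closed[of u "Dom J u" "Cod J u" v "Cod J v"] that by (simp add: Hom_def)
  have S1: "is_functor J K ?S"
    using A B J.Dom_closed J.Cod_closed
    by (auto simp: is_functor_def Hom_def K_def f' g')
  have S2: "is_functor K J ?S'"
    using A B J.Dom_closed J.Cod_closed Hin
    by (auto simp: is_functor_def Hom_def K_def f' g')
  have S: "inverse_functors J K ?S ?S'"
    using S1 S2 by (auto simp: inverse_functors_def K_def f' g')
  have "is_functor K C (fcomp K D ?S')" by (rule is_functor_fcomp[OF K S2 D])
  then obtain c \<iota> where "is_colimit C K (fcomp K D ?S') c \<iota>"
    using C K unfolding small_cocomplete_def by blast
  then have "is_colimit C J (fcomp J (fcomp K D ?S') ?S) c (\<lambda>j. \<iota> (fobj ?S j))"
    using is_colimit_fcomp[OF K J inverse_functors_commute[OF S] is_functor_fcomp[OF K S2 D]] by blast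
  then show ?thesis unfolding fcomp_inverse_functors[OF J K S D] by blast
qed

section \<open>Maps out of colimits\<close>

lemma colimit_factor:
  assumes "is_colimit C J D c \<iota>" "is_cocone C J D d \<kappa>"
  obtains h where "h \<in> Hom C c d" "\<And>j. j \<in> Obj J \<Longrightarrow> Comp C h (\<iota> j) = \<kappa> j"
  using assms unfolding is_colimit_def by blast

lemma cocone_Hom: "is_cocone C J D d \<kappa> \<Longrightarrow> j \<in> Obj J \<Longrightarrow> \<kappa> j \<in> Hom C (fobj D j) d"
  by (simp add: is_cocone_def)

lemma (in category) cocone_Comp:
  assumes J: "category J" and D: "is_functor J C D" and c: "is_cocone C J D c \<iota>" and h: "h \<in> Hom C c d"
  shows "is_cocone C J D d (\<lambda>j. Comp C h (\<iota> j))"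
proof -
  interpret J: category J by fact
  have c': "\<iota> j \<in> Hom C (fobj D j) c" if "j \<in> Obj J" for j using cocone_Hom[OF c that] .
  show ?thesis
    unfolding is_cocone_def
  proof (intro conjI ballI)
    show "d \<in> Obj C" using Hom_Obj[OF h] by simp
    show "Comp C h (\<iota> j) \<in> Hom C (fobj D j) d" if "j \<in> Obj J" for j
      using Comp_closed[OF c'[OF that] h] .
    fix u assume u: "u \<in> Arr J"
    have "farr D u \<in> Hom C (fobj D (Dom J u)) (fobj D (Cod J u))" using D u by (simp add: is_functor_def)
    from Comp_assoc[OF this c'[OF J.Cod_closed[OF u]] h]
    show "Comp C (Comp C h (\<iota> (Cod J u))) (farr D u) = Comp C h (\<iota> (Dom J u))"
      using c u by (simp add: is_cocone_def)
  qed
qed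

lemma (in category) colimit_eqI:
  assumes J: "category J" and D: "is_functor J C D" and c: "is_colimit C J D c \<iota>"
    and h: "h \<in> Hom C c d" "h' \<in> Hom C c d"
    and eq: "\<And>j. j \<in> Obj J \<Longrightarrow> Comp C h (\<iota> j) = Comp C h' (\<iota> j)"
  shows "h = h'"
proof -
  have "is_cocone C J D d (\<lambda>j. Comp C h (\<iota> j))"
    by (rule cocone_Comp[OF J D colimit_cocone[OF c] h(1)])
  then have "\<exists>!k. k \<in> Hom C c d \<and> (\<forall>j \<in> Obj J. Comp C k (\<iota> j) = Comp C h (\<iota> j))"
    using c unfolding is_colimit_def by blast
  then show ?thesis using h eq by metis
qed

lemma (in category) cocone_natural:
  assumes J: "category J" and t: "natural J C D E t" and c: "is_cocone C J E c \<iota>"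
  shows "is_cocone C J D c (\<lambda>j. Comp C (\<iota> j) (t j))"
proof -
  have D: "is_functor J C D" and E: "is_functor J C E" using t by (auto simp: natural_def)
  have "c \<in> Obj C \<and> natural J C E (const_functor J C c) \<iota>"
    using natural_const_functor_iff[OF J category_axioms E] c by blast
  then have "c \<in> Obj C \<and> natural J C D (const_functor J C c) (\<lambda>j. Comp C (\<iota> j) (t j))"
    using natural_Comp[OF J category_axioms t] by blast
  then show ?thesis using natural_const_functor_iff[OF J category_axioms D] by blast
qed

text \<open>Constant diagrams on fibrations are objectwise fibrations, so the colimit functor inherits
  left lifting properties.\<close>

lemma (in model_category) colimit_trivial_cofibration:
  assumes J: "category J"
    and t: "t \<in> Hom (fun_cat J M) R W"
    and lift: "\<And>p. p \<in> objectwise J M (Fib M) \<Longrightarrow> has_lifting (fun_cat J M) t p"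
    and c: "is_colimit M J R c \<iota>" and d: "is_colimit M J W d \<mu>"
    and h: "h \<in> Hom M c d" "\<And>j. j \<in> Obj J \<Longrightarrow> Comp M h (\<iota> j) = Comp M (\<mu> j) (ncmp t j)"
  shows "h \<in> Weq M"
proof (rule lifting_imp_Weq[OF h(1)])
  interpret J: category J by fact
  have t': "natural J M R W (ncmp t)" "nsrc t = R" "ntrg t = W" using t by (auto simp: Hom_fun_cat)
  have RW: "is_functor J M R" "is_functor J M W" using t' by (auto simp: natural_def)
  fix p assume "p \<in> Fib M"
  then obtain a b where p: "p \<in> Hom M a b" "p \<in> Fib M" using Fib_Arr by (auto simp: Hom_def)
  have ab: "a \<in> Obj M" "b \<in> Obj M" using Hom_Obj[OF p(1)] by auto
  note nc = natural_const_functor_iff[OF J category]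
  show "has_lifting M h p"
    unfolding has_lifting_def HomD[OF h(1)] HomD[OF p(1)]
  proof (intro allI impI, elim conjE)
    fix u v assume u: "u \<in> Hom M c a" and v: "v \<in> Hom M d b" and eq: "Comp M p u = Comp M v h"
    let ?a = "const_functor J M a" and ?b = "const_functor J M b"
    let ?P = "ntrans_of J ?a ?b (\<lambda>_. p)" and ?U = "ntrans_of J R ?a (\<lambda>j. Comp M u (\<iota> j))"
      and ?V = "ntrans_of J W ?b (\<lambda>j. Comp M v (\<mu> j))"
    have P: "?P \<in> Hom (fun_cat J M) ?a ?b"
      unfolding J.ntrans_of_Hom by (rule natural_const_functors[OF J category p(1)])
    have U: "?U \<in> Hom (fun_cat J M) R ?a"
      unfolding J.ntrans_of_Hom using nc[OF RW(1)] cocone_Comp[OF J RW(1) colimit_cocone[OF c] u] by blast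
    have V: "?V \<in> Hom (fun_cat J M) W ?b"
      unfolding J.ntrans_of_Hom using nc[OF RW(2)] cocone_Comp[OF J RW(2) colimit_cocone[OF d] v] by blast
    have P': "nsrc ?P = ?a" "ntrg ?P = ?b" by (simp_all add: ntrans_of_def)
    have PF: "?P \<in> objectwise J M (Fib M)"
      using P p(2) by (simp add: in_objectwise_iff P' ncmp_ntrans_of)
    have io: "\<iota> j \<in> Hom M (fobj R j) c" and mu: "\<mu> j \<in> Hom M (fobj W j) d"
      and tj: "ncmp t j \<in> Hom M (fobj R j) (fobj W j)" if "j \<in> Obj J" for j
      using cocone_Hom[OF colimit_cocone[OF c] that] cocone_Hom[OF colimit_cocone[OF d] that]
        natural_Hom[OF t'(1) that] by auto
    have "Comp M p (Comp M u (\<iota> j)) = Comp M (Comp M v (\<mu> j)) (ncmp t j)" if j: "j \<in> Obj J" for j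
      using Comp_assoc[OF io[OF j] u p(1)] Comp_assoc[OF io[OF j] h(1) v] h(2)[OF j]
        Comp_assoc[OF tj[OF j] mu[OF j] v] eq by simp
    then have "Comp (fun_cat J M) ?P ?U = Comp (fun_cat J M) ?V (ntrans_of J R W (ncmp t))"
      unfolding Comp_ntrans_of ntrans_of_eq_iff by simp
    then have "Comp (fun_cat J M) ?P ?U = Comp (fun_cat J M) ?V t" using ntrans_of_ncmp[OF t] by simp
    then obtain H where H: "H \<in> Hom (fun_cat J M) W ?a" "Comp (fun_cat J M) H t = ?U"
        "Comp (fun_cat J M) ?P H = ?V"
      using has_liftingD[OF lift[OF PF], unfolded fun_cat_simps P' t'(2,3), OF U V] by blast
    have "Comp (fun_cat J M) (ntrans_of J W ?a (ncmp H)) (ntrans_of J R W (ncmp t)) = ?U"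
      "Comp (fun_cat J M) ?P (ntrans_of J W ?a (ncmp H)) = ?V"
      using H ntrans_of_ncmp[OF t] ntrans_of_ncmp[OF H(1)] by simp_all
    then have Ht: "Comp M (ncmp H j) (ncmp t j) = Comp M u (\<iota> j)"
      and PH: "Comp M p (ncmp H j) = Comp M v (\<mu> j)" if "j \<in> Obj J" for j
      using that unfolding Comp_ntrans_of ntrans_of_eq_iff by auto
    \<comment> \<open>With a constant target, the lift \<open>H\<close> is a cocone with apex
      \<open>a\<close>; the map \<open>k\<close> that it induces is the required lift.\<close>
    have "is_cocone M J W a (ncmp H)" using nc[OF RW(2)] H(1) ab by (auto simp: Hom_fun_cat)
    then obtain k where k: "k \<in> Hom M d a" "\<And>j. j \<in> Obj J \<Longrightarrow> Comp M k (\<mu> j) = ncmp H j"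
      using colimit_factor[OF d] by blast
    have "Comp M (Comp M k h) (\<iota> j) = Comp M u (\<iota> j)" if j: "j \<in> Obj J" for j
      using Comp_assoc[OF io[OF j] h(1) k(1)] h(2)[OF j] Comp_assoc[OF tj[OF j] mu[OF j] k(1)]
        k(2)[OF j] Ht[OF j] by simp
    then have "Comp M k h = u" using colimit_eqI[OF J RW(1) c Comp_closed[OF h(1) k(1)] u] by blast
    moreover have "Comp M (Comp M p k) (\<mu> j) = Comp M v (\<mu> j)" if j: "j \<in> Obj J" for j
      using Comp_assoc[OF mu[OF j] k(1) p(1)] k(2)[OF j] PH[OF j] by simp
    then have "Comp M p k = v" using colimit_eqI[OF J RW(2) d Comp_closed[OF k(1) p(1)] v] by blast
    ultimately show "\<exists>h'\<in>Hom M d a. Comp M h' h = u \<and> Comp M p h' = v" using k(1) by blast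
  qed
qed

section \<open>Ken Brown's lemma for colimits over small posets\<close>

lemma inj_prod_infinite: "\<exists>g :: 'u::infinite \<times> 'u \<Rightarrow> 'u. inj g"
proof -
  have "(card_of (UNIV \<times> UNIV :: ('u \<times> 'u) set), card_of (UNIV :: 'u set)) \<in> ordIso"
    by (rule card_of_Times_same_infinite) (rule infinite_UNIV)
  then have "(card_of (UNIV :: ('u \<times> 'u) set), card_of (UNIV :: 'u set)) \<in> ordLeq"
    unfolding UNIV_Times_UNIV by (rule ordIso_imp_ordLeq)
  then show ?thesis unfolding card_of_ordLeq[symmetric] by blast
qed

lemma category_poset_cat:
  assumes refl: "\<And>x. x \<in> carrier L \<Longrightarrow> x \<sqsubseteq>\<^bsub>L\<^esub> x"
    and trans: "\<And>x y z. \<lbrakk>x \<in> carrier L; y \<in> carrier L; z \<in> carrier L; x \<sqsubseteq>\<^bsub>L\<^esub> y; y \<sqsubseteq>\<^bsub>L\<^esub> z\<rbrakk> \<Longrightarrow> x \<sqsubseteq>\<^bsub>L\<^esub> z"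
  shows "category (poset_cat L)"
proof
  fix f g h a b c d
  assume f: "f \<in> Hom (poset_cat L) a b"
  then have f': "f = (a, b)" "a \<in> carrier L" "b \<in> carrier L" "a \<sqsubseteq>\<^bsub>L\<^esub> b"
    by (auto simp: Hom_def poset_cat_def)
  show "Comp (poset_cat L) f (Ide (poset_cat L) a) = f" "Comp (poset_cat L) (Ide (poset_cat L) b) f = f"
    using f' by (simp_all add: poset_cat_def)
  assume "g \<in> Hom (poset_cat L) b c"
  then have g': "g = (b, c)" "c \<in> carrier L" "b \<sqsubseteq>\<^bsub>L\<^esub> c" by (auto simp: Hom_def poset_cat_def)
  show "Comp (poset_cat L) g f \<in> Hom (poset_cat L) a c"
    using f' g' trans[of a b c] by (simp add: Hom_def poset_cat_def)
  assume "h \<in> Hom (poset_cat L) c d"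
  show "Comp (poset_cat L) h (Comp (poset_cat L) g f) = Comp (poset_cat L) (Comp (poset_cat L) h g) f"
    by (simp add: poset_cat_def)
qed (use refl in \<open>auto simp: poset_cat_def Hom_def\<close>)

lemma (in partial_order) category_poset: "category (poset_cat L)"
  by (rule category_poset_cat) (auto intro: le_trans)

text \<open>The maps \<open>hj\<close> and \<open>hs\<close> induced by \<open>j\<close> and
  \<open>s\<close> are weak equivalences, as \<open>j\<close> and \<open>s\<close> are trivial
  cofibrations. Since \<open>p\<close> retracts \<open>s\<close>, two-of-three makes the induced map
  \<open>hp\<close> a weak equivalence too, and \<open>h\<close> is \<open>hp\<close> after
  \<open>hj\<close>.\<close>

lemma colimit_of_cofibrants_Weq:
  fixes U :: "'u::infinite itself" and L :: "'u gorder" and M :: "('o, 'm, 'z) mcat_scheme"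
  assumes good: "good_model_category U M" and L: "partial_order L"
    and R: "projectively_cofibrant (poset_cat L) M R" and D: "projectively_cofibrant (poset_cat L) M D"
    and q: "natural (poset_cat L) M R D q" "\<And>a. a \<in> carrier L \<Longrightarrow> q a \<in> Weq M"
    and c: "is_colimit M (poset_cat L) R c \<iota>" and d: "is_colimit M (poset_cat L) D d \<mu>"
    and h: "h \<in> Hom M c d" "\<And>a. a \<in> carrier L \<Longrightarrow> Comp M h (\<iota> a) = Comp M (\<mu> a) (q a)"
  shows "h \<in> Weq M"
proof -
  let ?J = "poset_cat L"
  interpret partial_order L by fact
  interpret J: category ?J by (rule category_poset)
  note J = J.category_axioms
  interpret M: model_category U M using good by (simp add: good_model_category_def)
  interpret N: model_category U "projective ?J M"
    using good L by (simp add: good_model_category_def)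
  have O: "Obj ?J = carrier L" by (simp add: poset_cat_def)
  have RD: "is_functor ?J M R" "is_functor ?J M D" using q by (auto simp: natural_def)
  let ?q = "ntrans_of ?J R D q"
  have qq: "?q \<in> Hom (projective ?J M) R D" using q(1) by (simp add: J.ntrans_of_Hom)
  have qs: "nsrc ?q = R" "ntrg ?q = D" by (simp_all add: ntrans_of_def)
  have qw: "?q \<in> Weq (projective ?J M)"
    using qq q(2) by (simp add: in_objectwise_iff qs ncmp_ntrans_of O)
  have ll: "has_left_lifting (projective ?J M) X p"
    if "projectively_cofibrant ?J M X" "p \<in> Fib (projective ?J M) \<inter> Weq (projective ?J M)" for X p
    using iffD1[OF projectively_cofibrant_iff[OF J] that(1)] that(2)
    by (simp add: has_left_lifting_def)
  obtain W p j s where p: "p \<in> Hom (fun_cat ?J M) W D" and j: "j \<in> Hom (fun_cat ?J M) R W"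
    and s: "s \<in> Hom (fun_cat ?J M) D W"
    and jW: "j \<in> Cof (projective ?J M) \<inter> Weq (projective ?J M)"
    and sW: "s \<in> Cof (projective ?J M) \<inter> Weq (projective ?J M)"
    and pj: "Comp (fun_cat ?J M) p j = ?q" and ps: "Comp (fun_cat ?J M) p s = Ide (fun_cat ?J M) D"
    using N.Ken_Brown_factorization[OF qq qw ll[OF R] ll[OF D]]
    unfolding projective_simps Hom_projective by blast
  have pn: "natural ?J M W D (ncmp p)" and jn: "natural ?J M R W (ncmp j)"
    and sn: "natural ?J M D W (ncmp s)"
    using p j s by (simp_all add: Hom_fun_cat)
  have W: "is_functor ?J M W" using pn by (simp add: natural_def)
  \<comment> \<open>Arrows of \<open>poset_cat L\<close> are pairs, so they must be coded as points
    of the universe before cocompleteness applies.\<close>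
  obtain g :: "'u \<times> 'u \<Rightarrow> 'u" where g: "inj g" using inj_prod_infinite by blast
  obtain e \<nu> where e: "is_colimit M ?J W e \<nu>"
    using small_cocomplete_colimit[OF M.cocomplete J W inj_on_id inj_on_subset[OF g subset_UNIV]]
    by blast
  note cc = M.cocone_natural[OF J]
  obtain hj where hj: "hj \<in> Hom M c e"
      "\<And>a. a \<in> Obj ?J \<Longrightarrow> Comp M hj (\<iota> a) = Comp M (\<nu> a) (ncmp j a)"
    using colimit_factor[OF c cc[OF jn colimit_cocone[OF e]]] by blast
  obtain hs where hs: "hs \<in> Hom M d e"
      "\<And>a. a \<in> Obj ?J \<Longrightarrow> Comp M hs (\<mu> a) = Comp M (\<nu> a) (ncmp s a)"
    using colimit_factor[OF d cc[OF sn colimit_cocone[OF e]]] by blast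
  obtain hp where hp: "hp \<in> Hom M e d"
      "\<And>a. a \<in> Obj ?J \<Longrightarrow> Comp M hp (\<nu> a) = Comp M (\<mu> a) (ncmp p a)"
    using colimit_factor[OF e cc[OF pn colimit_cocone[OF d]]] by blast
  have lift: "has_lifting (fun_cat ?J M) i r"
    if "i \<in> Cof (projective ?J M) \<inter> Weq (projective ?J M)" "r \<in> objectwise ?J M (Fib M)" for i r
    using N.lifting(2)[OF that(1), of r] that(2) by simp
  have hjW: "hj \<in> Weq M" by (rule M.colimit_trivial_cofibration[OF J j lift[OF jW] c e hj])
  have hsW: "hs \<in> Weq M" by (rule M.colimit_trivial_cofibration[OF J s lift[OF sW] d e hs])
  have pj': "Comp M (ncmp p a) (ncmp j a) = q a" if "a \<in> Obj ?J" for a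
    using arg_cong[OF pj, of "\<lambda>t. ncmp t a"] that by (simp add: fun_cat_def ntrans_of_def)
  have ps': "Comp M (ncmp p a) (ncmp s a) = Ide M (fobj D a)" if "a \<in> Obj ?J" for a
    using arg_cong[OF ps, of "\<lambda>t. ncmp t a"] that by (simp add: fun_cat_def)
  note hom = cocone_Hom[OF colimit_cocone[OF c]] cocone_Hom[OF colimit_cocone[OF d]]
    cocone_Hom[OF colimit_cocone[OF e]] natural_Hom[OF pn] natural_Hom[OF jn] natural_Hom[OF sn]
  have "Comp M (Comp M hp hs) (\<mu> a) = Comp M (Ide M d) (\<mu> a)" if a: "a \<in> Obj ?J" for a
  proof -
    have "Comp M (Comp M hp hs) (\<mu> a) = Comp M hp (Comp M (\<nu> a) (ncmp s a))"
      using M.Comp_assoc[OF hom(2)[OF a] hs(1) hp(1)] hs(2)[OF a] by simp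
    also have "\<dots> = Comp M (\<mu> a) (Comp M (ncmp p a) (ncmp s a))"
      using M.Comp_assoc[OF hom(6)[OF a] hom(3)[OF a] hp(1)] hp(2)[OF a]
        M.Comp_assoc[OF hom(6)[OF a] hom(4)[OF a] hom(2)[OF a]] by simp
    also have "\<dots> = Comp M (Ide M d) (\<mu> a)"
      using ps'[OF a] M.Comp_Ide[OF hom(2)[OF a]] M.Ide_Comp[OF hom(2)[OF a]] by simp
    finally show ?thesis .
  qed
  moreover have dO: "d \<in> Obj M" using M.Hom_Obj[OF h(1)] by simp
  ultimately have "Comp M hp hs = Ide M d"
    using M.colimit_eqI[OF J RD(2) d M.Comp_closed[OF hs(1) hp(1)] M.Ide_closed] by blast
  then have hpW: "hp \<in> Weq M"
    using M.two_of_three(2)[OF hs(1) hp(1) hsW] M.Ide_Weq_Fib(1)[OF dO] by simp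
  have "Comp M (Comp M hp hj) (\<iota> a) = Comp M h (\<iota> a)" if a: "a \<in> Obj ?J" for a
  proof -
    have "Comp M (Comp M hp hj) (\<iota> a) = Comp M hp (Comp M (\<nu> a) (ncmp j a))"
      using M.Comp_assoc[OF hom(1)[OF a] hj(1) hp(1)] hj(2)[OF a] by simp
    also have "\<dots> = Comp M (\<mu> a) (Comp M (ncmp p a) (ncmp j a))"
      using M.Comp_assoc[OF hom(5)[OF a] hom(3)[OF a] hp(1)] hp(2)[OF a]
        M.Comp_assoc[OF hom(5)[OF a] hom(4)[OF a] hom(2)[OF a]] by simp
    finally show ?thesis using pj'[OF a] h(2) a O by simp
  qed
  then have "Comp M hp hj = h"
    using M.colimit_eqI[OF J RD(1) c M.Comp_closed[OF hj(1) hp(1)] h(1)] by blast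
  then show ?thesis using M.two_of_three(1)[OF hj(1) hp(1) hjW hpW] by simp
qed

text \<open>Lifting problems over \<open>K\<close> are pulled back to \<open>J\<close> along
  \<open>S\<close>, solved there and carried back.\<close>

lemma projectively_cofibrant_fcomp:
  assumes J: "category J" and K: "category K" and S: "inverse_functors J K S S'"
    and Q: "projectively_cofibrant J M Q"
  shows "projectively_cofibrant K M (fcomp K Q S')"
  unfolding projectively_cofibrant_def
proof (intro conjI allI impI; (elim conjE)?)
  have S1: "is_functor J K S" "is_functor K J S'" using S by (auto simp: inverse_functors_def)
  have QF: "is_functor J M Q" using Q by (simp add: projectively_cofibrant_def)
  show "is_functor K M (fcomp K Q S')" by (rule is_functor_fcomp[OF K S1(2) QF])
  fix Y Z p v
  assume p: "natural K M Y Z p" "\<forall>a\<in>Obj K. p a \<in> Fib M \<inter> Weq M" and v: "natural K M (fcomp K Q S') Z v"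
  have "natural J M (fcomp J Y S) (fcomp J Z S) (\<lambda>a. p (fobj S a))"
    by (rule natural_fcomp[OF J S1(1) p(1)])
  moreover have "\<forall>a\<in>Obj J. p (fobj S a) \<in> Fib M \<inter> Weq M" using p(2) functor_Obj[OF S1(1)] by blast
  moreover have "natural J M Q (fcomp J Z S) (\<lambda>a. v (fobj S a))"
    using natural_fcomp[OF J S1(1) v] fcomp_inverse_functors[OF J K S QF] by simp
  ultimately obtain h where h: "natural J M Q (fcomp J Y S) h"
      "\<forall>a\<in>Obj J. Comp M (p (fobj S a)) (h a) = v (fobj S a)"
    using Q unfolding projectively_cofibrant_def by blast
  have Y: "is_functor K M Y" using p(1) by (simp add: natural_def)
  have "natural K M (fcomp K Q S') Y (\<lambda>a. h (fobj S' a))"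
    using natural_fcomp[OF K S1(2) h(1)]
      fcomp_inverse_functors[OF K J inverse_functors_commute[OF S] Y] by simp
  moreover have "\<forall>a\<in>Obj K. Comp M (p a) (h (fobj S' a)) = v a"
    using h(2) functor_Obj[OF S1(2)] S unfolding inverse_functors_def by metis
  ultimately show "\<exists>h. natural K M (fcomp K Q S') Y h \<and> (\<forall>a\<in>Obj K. Comp M (p a) (h a) = v a)" by blast
qed

section \<open>Functors on posets\<close>

lemma poset_cat_simps [simp]:
  "Obj (poset_cat L) = carrier L"
  "(x, y) \<in> Arr (poset_cat L) \<longleftrightarrow> x \<in> carrier L \<and> y \<in> carrier L \<and> x \<sqsubseteq>\<^bsub>L\<^esub> y"
  "Dom (poset_cat L) = fst" "Cod (poset_cat L) = snd"
  "Ide (poset_cat L) x = (x, x)" "Comp (poset_cat L) (y', z) (x, y) = (x, z)"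
  by (simp_all add: poset_cat_def)

lemma Arr_poset_catE:
  assumes "f \<in> Arr (poset_cat L)"
  obtains x y where "f = (x, y)" "x \<in> carrier L" "y \<in> carrier L" "x \<sqsubseteq>\<^bsub>L\<^esub> y"
  using assms by (auto simp: poset_cat_def)

lemma Hom_poset_cat: "f \<in> Hom (poset_cat L) x y \<longleftrightarrow> x \<in> carrier L \<and> y \<in> carrier L \<and> x \<sqsubseteq>\<^bsub>L\<^esub> y \<and> f = (x, y)"
  by (auto simp: Hom_def poset_cat_def)

lemma poset_functorD:
  assumes F: "is_functor (poset_cat L) C F"
  shows "\<lbrakk>x \<in> carrier L; y \<in> carrier L; x \<sqsubseteq>\<^bsub>L\<^esub> y\<rbrakk> \<Longrightarrow> farr F (x, y) \<in> Hom C (fobj F x) (fobj F y)"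
    and "x \<in> carrier L \<Longrightarrow> farr F (x, x) = Ide C (fobj F x)"
    and "\<lbrakk>x \<in> carrier L; y \<in> carrier L; z \<in> carrier L; x \<sqsubseteq>\<^bsub>L\<^esub> y; y \<sqsubseteq>\<^bsub>L\<^esub> z\<rbrakk>
      \<Longrightarrow> Comp C (farr F (y, z)) (farr F (x, y)) = farr F (x, z)"
proof -
  show "farr F (x, y) \<in> Hom C (fobj F x) (fobj F y)" if "x \<in> carrier L" "y \<in> carrier L" "x \<sqsubseteq>\<^bsub>L\<^esub> y"
    using functor_Hom[OF F, of "(x, y)" x y] that by (simp add: Hom_poset_cat)
  show "farr F (x, x) = Ide C (fobj F x)" if "x \<in> carrier L"
    using F that by (simp add: is_functor_def)
  show "Comp C (farr F (y, z)) (farr F (x, y)) = farr F (x, z)"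
    if "x \<in> carrier L" "y \<in> carrier L" "z \<in> carrier L" "x \<sqsubseteq>\<^bsub>L\<^esub> y" "y \<sqsubseteq>\<^bsub>L\<^esub> z"
    using functor_Comp[OF F, of "(x, y)" x y "(y, z)" z] that by (simp add: Hom_poset_cat)
qed

definition poset_functor ::
  "('a, 'z) gorder_scheme \<Rightarrow> ('a \<Rightarrow> 'o) \<Rightarrow> ('a \<Rightarrow> 'a \<Rightarrow> 'm) \<Rightarrow> ('a, 'a \<times> 'a, 'o, 'm) ftor" where
  "poset_functor L fo fa = \<lparr>fobj = restrict fo (carrier L),
    farr = restrict (\<lambda>(x, y). fa x y) (Arr (poset_cat L))\<rparr>"

lemma fobj_poset_functor: "x \<in> carrier L \<Longrightarrow> fobj (poset_functor L fo fa) x = fo x"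
  by (simp add: poset_functor_def)

lemma farr_poset_functor:
  "\<lbrakk>x \<in> carrier L; y \<in> carrier L; x \<sqsubseteq>\<^bsub>L\<^esub> y\<rbrakk> \<Longrightarrow> farr (poset_functor L fo fa) (x, y) = fa x y"
  by (simp add: poset_functor_def)

lemma is_functor_poset_functor:
  assumes L: "category (poset_cat L)"
    and fo: "\<And>x. x \<in> carrier L \<Longrightarrow> fo x \<in> Obj C"
    and fa: "\<And>x y. \<lbrakk>x \<in> carrier L; y \<in> carrier L; x \<sqsubseteq>\<^bsub>L\<^esub> y\<rbrakk> \<Longrightarrow> fa x y \<in> Hom C (fo x) (fo y)"
    and ide: "\<And>x. x \<in> carrier L \<Longrightarrow> fa x x = Ide C (fo x)"
    and comp: "\<And>x y z. \<lbrakk>x \<in> carrier L; y \<in> carrier L; z \<in> carrier L; x \<sqsubseteq>\<^bsub>L\<^esub> y; y \<sqsubseteq>\<^bsub>L\<^esub> z\<rbrakk>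
      \<Longrightarrow> Comp C (fa y z) (fa x y) = fa x z"
  shows "is_functor (poset_cat L) C (poset_functor L fo fa)"
proof -
  interpret L: category "poset_cat L" by fact
  have refl: "x \<sqsubseteq>\<^bsub>L\<^esub> x" if "x \<in> carrier L" for x
    using L.Ide_closed[of x] that by (simp add: Hom_poset_cat)
  have trans: "x \<sqsubseteq>\<^bsub>L\<^esub> z" if "x \<in> carrier L" "y \<in> carrier L" "z \<in> carrier L" "x \<sqsubseteq>\<^bsub>L\<^esub> y" "y \<sqsubseteq>\<^bsub>L\<^esub> z" for x y z
    using L.Comp_closed[of "(x, y)" x y "(y, z)" z] that by (simp add: Hom_poset_cat)
  show ?thesis
    unfolding is_functor_def
  proof (intro conjI ballI impI)
    show "fobj (poset_functor L fo fa) \<in> Obj (poset_cat L) \<rightarrow>\<^sub>E Obj C"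
      using fo by (auto simp: poset_functor_def)
    show "farr (poset_functor L fo fa) \<in> Arr (poset_cat L) \<rightarrow>\<^sub>E Arr C"
    proof (intro PiE_I)
      fix f assume "f \<in> Arr (poset_cat L)"
      then obtain x y where "f = (x, y)" "x \<in> carrier L" "y \<in> carrier L" "x \<sqsubseteq>\<^bsub>L\<^esub> y"
        by (rule Arr_poset_catE)
      then show "farr (poset_functor L fo fa) f \<in> Arr C"
        using HomD(1)[OF fa[of x y]] by (simp add: farr_poset_functor)
    qed (simp add: poset_functor_def)
    show "farr (poset_functor L fo fa) f \<in> Hom C (fobj (poset_functor L fo fa) (Dom (poset_cat L) f))
        (fobj (poset_functor L fo fa) (Cod (poset_cat L) f))" if "f \<in> Arr (poset_cat L)" for f
      using that fa by (auto simp: farr_poset_functor fobj_poset_functor elim!: Arr_poset_catE)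
    show "farr (poset_functor L fo fa) (Ide (poset_cat L) a) = Ide C (fobj (poset_functor L fo fa) a)"
      if "a \<in> Obj (poset_cat L)" for a
      using that ide refl by (simp add: farr_poset_functor fobj_poset_functor)
    fix f g assume "f \<in> Arr (poset_cat L)" "g \<in> Arr (poset_cat L)" "Cod (poset_cat L) f = Dom (poset_cat L) g"
    then obtain x y z where "f = (x, y)" "g = (y, z)" "x \<in> carrier L" "y \<in> carrier L" "z \<in> carrier L"
        "x \<sqsubseteq>\<^bsub>L\<^esub> y" "y \<sqsubseteq>\<^bsub>L\<^esub> z"
      by (auto elim!: Arr_poset_catE)
    then show "farr (poset_functor L fo fa) (Comp (poset_cat L) g f) =
        Comp C (farr (poset_functor L fo fa) g) (farr (poset_functor L fo fa) f)"
      using comp[of x y z] trans[of x y z] by (simp add: farr_poset_functor)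
  qed
qed

lemma natural_posetI:
  assumes "is_functor (poset_cat L) C F" "is_functor (poset_cat L) C G"
    and "\<And>x. x \<in> carrier L \<Longrightarrow> t x \<in> Hom C (fobj F x) (fobj G x)"
    and "\<And>x y. \<lbrakk>x \<in> carrier L; y \<in> carrier L; x \<sqsubseteq>\<^bsub>L\<^esub> y\<rbrakk>
      \<Longrightarrow> Comp C (t y) (farr F (x, y)) = Comp C (farr G (x, y)) (t x)"
  shows "natural (poset_cat L) C F G t"
  using assms unfolding natural_def by (auto elim!: Arr_poset_catE)

lemma natural_posetD:
  assumes "natural (poset_cat L) C F G t" "x \<in> carrier L" "y \<in> carrier L" "x \<sqsubseteq>\<^bsub>L\<^esub> y"
  shows "Comp C (t y) (farr F (x, y)) = Comp C (farr G (x, y)) (t x)"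
  using natural_Arr[OF assms(1), of "(x, y)"] assms(2-4) by simp

lemma subset_poset_simps [simp]:
  "carrier (subset_poset S) = S" "a \<sqsubseteq>\<^bsub>subset_poset S\<^esub> b \<longleftrightarrow> a \<subseteq> b"
  by (simp_all add: subset_poset_def)

lemma category_subset_poset: "category (poset_cat (subset_poset S))"
  by (rule category_poset_cat) auto

text \<open>Good model categories only provide model structures on diagrams shaped by posets in the universe;
  a finite poset of sets is isomorphic to such a poset.\<close>

lemma finite_subset_poset_small:
  assumes S: "finite (S :: 'b set set)"
  shows "\<exists>(L :: 'u::infinite gorder) F G. partial_order L \<and>
    inverse_functors (poset_cat (subset_poset S)) (poset_cat L) F G"
proof -
  obtain f :: "'b set \<Rightarrow> 'u" where f: "inj_on f S"
    using arb_inj_on_finite_infinite[OF S] by blast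
  define g where "g = inv_into S f"
  have gf: "g (f a) = a" if "a \<in> S" for a using that f by (simp add: g_def)
  define L :: "'u gorder" where "L = \<lparr>carrier = f ` S, eq = (=), le = (\<lambda>x y. g x \<subseteq> g y)\<rparr>"
  have L: "partial_order L"
    by unfold_locales (auto simp: L_def gf)
  have Lc: "carrier L = f ` S" "\<And>x y. x \<sqsubseteq>\<^bsub>L\<^esub> y \<longleftrightarrow> g x \<subseteq> g y" by (simp_all add: L_def)
  interpret L: partial_order L by fact
  let ?S = "subset_poset S"
  let ?F = "poset_functor ?S f (\<lambda>a b. (f a, f b))" and ?G = "poset_functor L g (\<lambda>x y. (g x, g y))"
  have "is_functor (poset_cat ?S) (poset_cat L) ?F"
    by (rule is_functor_poset_functor[OF category_subset_poset]) (auto simp: Hom_poset_cat Lc gf)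
  moreover have "is_functor (poset_cat L) (poset_cat ?S) ?G"
    by (rule is_functor_poset_functor[OF L.category_poset]) (auto simp: Hom_poset_cat Lc gf)
  ultimately have "inverse_functors (poset_cat ?S) (poset_cat L) ?F ?G"
    unfolding inverse_functors_def
    by (auto simp: fobj_poset_functor farr_poset_functor Lc gf elim!: Arr_poset_catE)
  then show ?thesis using L by blast
qed

text \<open>A cofibrant \<open>D\<close> is its own replacement, so the identity of \<open>d\<close>
  is one model of the comparison map. Any other replacement comes with a weak equivalence of
  cofibrant diagrams to \<open>D\<close>, and Ken Brown's lemma applies to it after transport to a
  poset \<open>L\<close> in the universe.\<close>

lemma hocolim_map_of_cofibrant:
  fixes U :: "'u::infinite itself" and M :: "('o, 'm, 'z) mcat_scheme"
  defines "J S \<equiv> poset_cat (subset_poset S)"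
  assumes good: "good_model_category U M" and S: "finite S"
    and D: "projectively_cofibrant (J S) M D" and d: "is_colimit M (J S) D d \<kappa>"
  shows "\<exists>h. hocolim_map M (J S) D d \<kappa> h"
    and "hocolim_map M (J S) D d \<kappa> h \<Longrightarrow> h \<in> Weq M"
proof -
  interpret M: model_category U M using good by (simp add: good_model_category_def)
  have J: "category (J S)" unfolding J_def by (rule category_subset_poset)
  interpret J: category "J S" by (rule J)
  have DF: "is_functor (J S) M D" using D by (simp add: projectively_cofibrant_def)
  have kd: "\<kappa> a \<in> Hom M (fobj D a) d" if "a \<in> Obj (J S)" for a
    by (rule cocone_Hom[OF colimit_cocone[OF d] that])
  have dO: "d \<in> Obj M" using colimit_cocone[OF d] by (simp add: is_cocone_def)
  let ?i = "ntrans_of (J S) D D (\<lambda>a. Ide M (fobj D a))"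
  have i: "?i \<in> Hom (fun_cat (J S) M) D D"
    unfolding J.ntrans_of_Hom by (rule natural_Ide[OF J M.category_axioms DF])
  have srci: "nsrc ?i = D" "ntrg ?i = D" by (simp_all add: ntrans_of_def)
  have "cofibrant_replacement (projective (J S) M) D D ?i"
    unfolding cofibrant_replacement_def M.cofibrant_projective_iff[OF J] projective_simps Hom_projective
    using D i M.Ide_Weq_Fib(1)[OF functor_Obj[OF DF]] by (simp add: in_objectwise_iff srci ncmp_ntrans_of)
  then have "hocolim_map M (J S) D d \<kappa> (Ide M d)"
    unfolding hocolim_map_def
    by (intro exI[of _ D] exI[of _ ?i] exI[of _ d] exI[of _ \<kappa>])
      (simp add: d M.Ide_closed[OF dO] M.Ide_Comp[OF kd] M.Comp_Ide[OF kd] ncmp_ntrans_of)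
  then show "\<exists>h. hocolim_map M (J S) D d \<kappa> h" by blast
  assume "hocolim_map M (J S) D d \<kappa> h"
  then obtain Q q c \<iota> where Q: "cofibrant_replacement (projective (J S) M) D Q q"
    and c: "is_colimit M (J S) Q c \<iota>" and h: "h \<in> Hom M c d"
      "\<And>j. j \<in> Obj (J S) \<Longrightarrow> Comp M h (\<iota> j) = Comp M (\<kappa> j) (ncmp q j)"
    unfolding hocolim_map_def by blast
  have Qc: "projectively_cofibrant (J S) M Q" and q: "q \<in> Hom (fun_cat (J S) M) Q D"
    and qW: "\<And>a. a \<in> Obj (J S) \<Longrightarrow> ncmp q a \<in> Weq M"
    using Q unfolding cofibrant_replacement_def M.cofibrant_projective_iff[OF J]
      projective_simps Hom_projective by (auto simp: in_objectwise_iff)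
  have QF: "is_functor (J S) M Q" using Qc by (simp add: projectively_cofibrant_def)
  obtain L :: "'u gorder" and F G where L: "partial_order L"
    and FG: "inverse_functors (J S) (poset_cat L) F G"
    using finite_subset_poset_small[OF S] unfolding J_def by blast
  interpret L: partial_order L by fact
  note K = L.category_poset
  have G: "is_functor (poset_cat L) (J S) G" using FG by (simp add: inverse_functors_def)
  have GO: "fobj G a \<in> Obj (J S)" if "a \<in> carrier L" for a
    using functor_Obj[OF G, of a] that by simp
  have qn: "natural (J S) M Q D (ncmp q)" using q by (simp add: Hom_fun_cat)
  show "h \<in> Weq M"
    by (rule colimit_of_cofibrants_Weq[OF good L projectively_cofibrant_fcomp[OF J K FG Qc]
        projectively_cofibrant_fcomp[OF J K FG D] natural_fcomp[OF K G qn] qW[OF GO]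
        is_colimit_fcomp[OF J K FG QF c] is_colimit_fcomp[OF J K FG DF d] h(1) h(2)[OF GO]])
qed

section \<open>Extension by a terminal object\<close>

text \<open>No arrow leads from outside the lower set \<open>B\<close> into \<open>B\<close>, so a
  functor on \<open>B\<close> extends by the terminal object, with the unique maps as the new
  arrows.\<close>

locale lower_extension =
  fixes P :: "('a, 'y) gorder_scheme" and M :: "('o, 'm, 'z) cat_scheme" and one :: 'o and B :: "'a set"
  assumes P: "category (poset_cat P)" and M: "category M" and one: "is_terminal M one"
    and lower: "\<lbrakk>y \<in> B; x \<in> carrier P; y \<in> carrier P; x \<sqsubseteq>\<^bsub>P\<^esub> y\<rbrakk> \<Longrightarrow> x \<in> B"
begin

interpretation M: category M by (rule M)

definition bang :: "'o \<Rightarrow> 'm" where "bang a = (THE f. f \<in> Hom M a one)"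

lemma bang_Hom: "a \<in> Obj M \<Longrightarrow> bang a \<in> Hom M a one"
  unfolding bang_def by (rule theI') (use one in \<open>simp add: is_terminal_def\<close>)

lemma bang_unique:
  assumes f: "f \<in> Hom M a one"
  shows "f = bang a"
proof -
  have a: "a \<in> Obj M" using M.Hom_Obj[OF f] by simp
  then have "\<exists>!f. f \<in> Hom M a one" using one by (simp add: is_terminal_def)
  then show ?thesis using f bang_Hom[OF a] by blast
qed

lemma one_Obj: "one \<in> Obj M" using one by (simp add: is_terminal_def)

lemma Ide_one: "Ide M one = bang one"
  by (rule bang_unique[OF M.Ide_closed[OF one_Obj]])

definition ext_obj :: "('a \<Rightarrow> 'o) \<Rightarrow> 'a \<Rightarrow> 'o" where
  "ext_obj ho x = (if x \<in> B then ho x else one)"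

definition ext :: "('a \<Rightarrow> 'o) \<Rightarrow> ('a \<Rightarrow> 'a \<Rightarrow> 'm) \<Rightarrow> ('a, 'a \<times> 'a, 'o, 'm) ftor" where
  "ext ho ha = poset_functor P (ext_obj ho)
    (\<lambda>x y. if y \<in> B then ha x y else bang (ext_obj ho x))"

text \<open>Functoriality is asked only of arrows with target in \<open>B\<close>; their sources are
  in \<open>B\<close> by \<open>lower\<close>. Elsewhere \<open>ho\<close> and \<open>ha\<close> are
  free, so they may be formulas that mean nothing there.\<close>

definition lower_functor :: "('a \<Rightarrow> 'o) \<Rightarrow> ('a \<Rightarrow> 'a \<Rightarrow> 'm) \<Rightarrow> bool" where
  "lower_functor ho ha \<longleftrightarrow>
    (\<forall>x \<in> carrier P \<inter> B. ho x \<in> Obj M \<and> ha x x = Ide M (ho x)) \<and>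
    (\<forall>x \<in> carrier P. \<forall>y \<in> carrier P \<inter> B. x \<sqsubseteq>\<^bsub>P\<^esub> y \<longrightarrow> ha x y \<in> Hom M (ho x) (ho y)) \<and>
    (\<forall>x \<in> carrier P. \<forall>y \<in> carrier P. \<forall>z \<in> carrier P \<inter> B. x \<sqsubseteq>\<^bsub>P\<^esub> y \<and> y \<sqsubseteq>\<^bsub>P\<^esub> z \<longrightarrow>
      Comp M (ha y z) (ha x y) = ha x z)"

lemma fobj_ext: "x \<in> carrier P \<Longrightarrow> fobj (ext ho ha) x = (if x \<in> B then ho x else one)"
  by (simp add: ext_def fobj_poset_functor ext_obj_def)

lemma farr_ext: "\<lbrakk>x \<in> carrier P; y \<in> carrier P; x \<sqsubseteq>\<^bsub>P\<^esub> y; y \<in> B\<rbrakk> \<Longrightarrow> farr (ext ho ha) (x, y) = ha x y"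
  by (simp add: ext_def farr_poset_functor)

lemma is_functor_ext:
  assumes h: "lower_functor ho ha"
  shows "is_functor (poset_cat P) M (ext ho ha)"
  unfolding ext_def
proof (rule is_functor_poset_functor[OF P])
  have o: "ext_obj ho x \<in> Obj M" if "x \<in> carrier P" for x
    using that h one_Obj by (simp add: ext_obj_def lower_functor_def)
  show "ext_obj ho x \<in> Obj M" if "x \<in> carrier P" for x using o[OF that] .
  let ?a = "\<lambda>x y. if y \<in> B then ha x y else bang (ext_obj ho x)"
  have a: "?a x y \<in> Hom M (ext_obj ho x) (ext_obj ho y)"
    if xy: "x \<in> carrier P" "y \<in> carrier P" "x \<sqsubseteq>\<^bsub>P\<^esub> y" for x y
    using h xy lower[OF _ xy] bang_Hom[OF o[OF xy(1)]] by (simp add: ext_obj_def lower_functor_def)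
  show "?a x y \<in> Hom M (ext_obj ho x) (ext_obj ho y)"
    if "x \<in> carrier P" "y \<in> carrier P" "x \<sqsubseteq>\<^bsub>P\<^esub> y" for x y using a[OF that] .
  show "?a x x = Ide M (ext_obj ho x)" if "x \<in> carrier P" for x
    using that h Ide_one by (simp add: ext_obj_def lower_functor_def)
  fix x y z assume xyz: "x \<in> carrier P" "y \<in> carrier P" "z \<in> carrier P" "x \<sqsubseteq>\<^bsub>P\<^esub> y" "y \<sqsubseteq>\<^bsub>P\<^esub> z"
  show "Comp M (?a y z) (?a x y) = ?a x z"
  proof (cases "z \<in> B")
    case True
    then have "y \<in> B" using lower xyz by blast
    then show ?thesis using True h xyz by (simp add: lower_functor_def)
  next
    case False
    have "Comp M (bang (ext_obj ho y)) (?a x y) \<in> Hom M (ext_obj ho x) one"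
      by (rule M.Comp_closed[OF a[OF xyz(1,2,4)] bang_Hom[OF o[OF xyz(2)]]])
    then show ?thesis using False bang_unique by simp
  qed
qed

text \<open>Off \<open>B\<close> both sides of the naturality square end in the terminal object, so
  only targets in \<open>B\<close> have to be checked.\<close>

lemma natural_ext:
  assumes h: "lower_functor ho ha" and T: "is_functor (poset_cat P) M T"
    and t: "\<And>x. \<lbrakk>x \<in> carrier P; x \<in> B\<rbrakk> \<Longrightarrow> t x \<in> Hom M (fobj T x) (ho x)"
    and nat: "\<And>x y. \<lbrakk>x \<in> carrier P; y \<in> carrier P; x \<sqsubseteq>\<^bsub>P\<^esub> y; y \<in> B\<rbrakk>
      \<Longrightarrow> Comp M (t y) (farr T (x, y)) = Comp M (ha x y) (t x)"
  shows "natural (poset_cat P) M T (ext ho ha) (\<lambda>x. if x \<in> B then t x else bang (fobj T x))"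
proof (rule natural_posetI[OF T is_functor_ext[OF h]])
  let ?t = "\<lambda>x. if x \<in> B then t x else bang (fobj T x)"
  have TO: "fobj T x \<in> Obj M" if "x \<in> carrier P" for x using functor_Obj[OF T, of x] that by simp
  have H: "?t x \<in> Hom M (fobj T x) (fobj (ext ho ha) x)" if "x \<in> carrier P" for x
    using that t bang_Hom[OF TO[OF that]] by (simp add: fobj_ext)
  show "?t x \<in> Hom M (fobj T x) (fobj (ext ho ha) x)" if "x \<in> carrier P" for x using H[OF that] .
  fix x y assume xy: "x \<in> carrier P" "y \<in> carrier P" "x \<sqsubseteq>\<^bsub>P\<^esub> y"
  show "Comp M (?t y) (farr T (x, y)) = Comp M (farr (ext ho ha) (x, y)) (?t x)"
  proof (cases "y \<in> B")
    case True
    then have "x \<in> B" using lower xy by blast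
    then show ?thesis using True nat[OF xy True] xy by (simp add: farr_ext)
  next
    case False
    have 1: "Comp M (?t y) (farr T (x, y)) \<in> Hom M (fobj T x) one"
      using M.Comp_closed[OF poset_functorD(1)[OF T xy] H[OF xy(2)]] False xy by (simp add: fobj_ext)
    have 2: "Comp M (farr (ext ho ha) (x, y)) (?t x) \<in> Hom M (fobj T x) one"
      using M.Comp_closed[OF H[OF xy(1)] poset_functorD(1)[OF is_functor_ext[OF h] xy]] False xy
      by (simp add: fobj_ext)
    show ?thesis using bang_unique[OF 1] bang_unique[OF 2] by metis
  qed
qed

end

section \<open>Left Kan extensions restricted along a meet-preserving diagram\<close>

text \<open>Existence and, in \<open>left_kan_extension_eq\<close>, uniqueness from the universal
  property, for bare components. The two take the place of a pointwise formula for
  \<open>T\<close>.\<close>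

lemma left_kan_extension_ex:
  assumes A: "category A" and T: "is_left_kan_extension A B C K Q T \<eta>"
    and G: "is_functor B C G" and b: "natural A C Q (fcomp A G K) \<beta>"
  shows "\<exists>\<alpha>. natural B C T G \<alpha> \<and> (\<forall>a \<in> Obj A. Comp C (\<alpha> (fobj K a)) (ncmp \<eta> a) = \<beta> a)"
proof -
  interpret A: category A by fact
  let ?b = "ntrans_of A Q (fcomp A G K) \<beta>"
  have "?b \<in> Hom (fun_cat A C) Q (fcomp A G K)" unfolding A.ntrans_of_Hom by (rule b)
  then obtain \<alpha> where a: "\<alpha> \<in> Hom (fun_cat B C) T G" "Comp (fun_cat A C) (whisker A \<alpha> K) \<eta> = ?b"
    using T G unfolding is_left_kan_extension_def by blast
  have "Comp C (ncmp \<alpha> (fobj K x)) (ncmp \<eta> x) = \<beta> x" if "x \<in> Obj A" for x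
    using arg_cong[OF a(2), of "\<lambda>t. ncmp t x"] that by (simp add: fun_cat_def whisker_def ntrans_of_def)
  then show ?thesis using a(1) unfolding Hom_fun_cat by blast
qed

lemma left_kan_extension_eq:
  assumes A: "category A" and B: "category B" and C: "category C" and K: "is_functor A B K"
    and T: "is_left_kan_extension A B C K Q T \<eta>"
    and a: "natural B C T G \<alpha>" and a': "natural B C T G \<alpha>'"
    and eq: "\<And>x. x \<in> Obj A \<Longrightarrow> Comp C (\<alpha> (fobj K x)) (ncmp \<eta> x) = Comp C (\<alpha>' (fobj K x)) (ncmp \<eta> x)"
    and y: "y \<in> Obj B"
  shows "\<alpha> y = \<alpha>' y"
proof -
  interpret A: category A by fact
  interpret B: category B by fact
  have G: "is_functor B C G" using a by (simp add: natural_def)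
  have e: "\<eta> \<in> Hom (fun_cat A C) Q (fcomp A T K)" using T by (simp add: is_left_kan_extension_def)
  then have en: "natural A C Q (fcomp A T K) (ncmp \<eta>)" by (simp add: Hom_fun_cat)
  have es: "nsrc \<eta> = Q" "ntrg \<eta> = fcomp A T K" using e by (simp_all add: Hom_fun_cat)
  let ?b = "ntrans_of A Q (fcomp A G K) (\<lambda>x. Comp C (\<alpha> (fobj K x)) (ncmp \<eta> x))"
  have b: "?b \<in> Hom (fun_cat A C) Q (fcomp A G K)"
    unfolding A.ntrans_of_Hom by (rule natural_Comp[OF A C en natural_fcomp[OF A K a]])
  have ba: "Comp (fun_cat A C) (whisker A (ntrans_of B T G \<gamma>) K) \<eta> = ?b"
    if "\<And>x. x \<in> Obj A \<Longrightarrow> Comp C (\<gamma> (fobj K x)) (ncmp \<eta> x) = Comp C (\<alpha> (fobj K x)) (ncmp \<eta> x)" for \<gamma>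
    using that functor_Obj[OF K]
    by (auto simp: fun_cat_def whisker_def ntrans_of_def es intro!: restrict_ext)
  have "\<exists>!\<gamma>. \<gamma> \<in> Hom (fun_cat B C) T G \<and> Comp (fun_cat A C) (whisker A \<gamma> K) \<eta> = ?b"
    using T G b unfolding is_left_kan_extension_def by blast
  moreover have "ntrans_of B T G \<alpha> \<in> Hom (fun_cat B C) T G" "ntrans_of B T G \<alpha>' \<in> Hom (fun_cat B C) T G"
    unfolding B.ntrans_of_Hom by (fact a, fact a')
  ultimately have "ntrans_of B T G \<alpha> = ntrans_of B T G \<alpha>'"
    using ba[of \<alpha>, OF refl] ba[of \<alpha>', OF eq[symmetric]] by blast
  then show ?thesis using y by (simp add: ntrans_of_eq_iff)
qed

lemma fobj_inclusion: "a \<in> Obj J \<Longrightarrow> fobj (inclusion J) a = a"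
  by (simp add: inclusion_def)

lemma farr_inclusion: "f \<in> Arr J \<Longrightarrow> farr (inclusion J) f = f"
  by (simp add: inclusion_def)

lemma is_functor_inclusion_poset:
  assumes A: "category (poset_cat A)" and sub: "carrier A \<subseteq> carrier P"
    and le: "\<And>x y. \<lbrakk>x \<in> carrier A; y \<in> carrier A; x \<sqsubseteq>\<^bsub>A\<^esub> y\<rbrakk> \<Longrightarrow> x \<sqsubseteq>\<^bsub>P\<^esub> y"
  shows "is_functor (poset_cat A) (poset_cat P) (inclusion (poset_cat A))"
proof -
  have "inclusion (poset_cat A) = poset_functor A (\<lambda>x. x) (\<lambda>x y. (x, y))"
    by (simp add: inclusion_def poset_functor_def id_def)
  then show ?thesis
    using is_functor_poset_functor[OF A, of "\<lambda>x. x" "poset_cat P" "\<lambda>x y. (x, y)"] sub le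
    by (auto simp: Hom_poset_cat subset_iff)
qed

text \<open>The hypothesis \<open>Galois\<close> says that the right Kan extension along the diagram \<open>X\<close> is computed by
  composition with \<open>\<sigma>\<close> on the lower set \<open>B\<close> and is terminal elsewhere.\<close>

locale kan_diagram = model_category U M
  for U :: "'u::infinite itself" and M :: "('o, 'm, 'z) mcat_scheme" +
  fixes P :: "('a, 'y) gorder_scheme" and A :: "('a, 'w) gorder_scheme"
    and J :: "('j, 'x) gorder_scheme"
    and Q T :: "('a, 'a \<times> 'a, 'o, 'm) ftor" and \<eta> :: "('a, 'a \<times> 'a, 'o, 'm) ntrans"
    and X :: "'j \<Rightarrow> 'a" and B :: "'a set" and \<sigma> :: "'a \<Rightarrow> 'j"
  assumes P: "category (poset_cat P)" and A: "category (poset_cat A)" and J: "category (poset_cat J)"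
    and A_subset: "carrier A \<subseteq> carrier P"
    and A_le: "\<lbrakk>x \<in> carrier A; y \<in> carrier A; x \<sqsubseteq>\<^bsub>A\<^esub> y\<rbrakk> \<Longrightarrow> x \<sqsubseteq>\<^bsub>P\<^esub> y"
    and X_closed: "S \<in> carrier J \<Longrightarrow> X S \<in> carrier P"
    and X_mono: "\<lbrakk>S \<in> carrier J; S' \<in> carrier J; S \<sqsubseteq>\<^bsub>J\<^esub> S'\<rbrakk> \<Longrightarrow> X S \<sqsubseteq>\<^bsub>P\<^esub> X S'"
    and Galois: "\<lbrakk>x \<in> carrier P; S \<in> carrier J\<rbrakk> \<Longrightarrow> x \<sqsubseteq>\<^bsub>P\<^esub> X S \<longleftrightarrow> x \<in> B \<and> \<sigma> x \<sqsubseteq>\<^bsub>J\<^esub> S"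
    and sigma_closed: "\<lbrakk>x \<in> carrier P; x \<in> B\<rbrakk> \<Longrightarrow> \<sigma> x \<in> carrier J"
    and Q: "projectively_cofibrant (poset_cat A) M Q"
    and T: "is_left_kan_extension (poset_cat A) (poset_cat P) M (inclusion (poset_cat A)) Q T \<eta>"
begin

text \<open>In the theorem this becomes the punctured diagram of \<open>T\<close> composed with the
  cube. \<open>X\<close> is a map on objects and not a functor, since in a poset monotonicity
  determines the arrows.\<close>

definition D :: "('j, 'j \<times> 'j, 'o, 'm) ftor" where
  "D = poset_functor J (\<lambda>S. fobj T (X S)) (\<lambda>S S'. farr T (X S, X S'))"

abbreviation KA :: "('a, 'a \<times> 'a, 'a, 'a \<times> 'a) ftor" where
  "KA \<equiv> inclusion (poset_cat A)"

lemma P_refl: "x \<in> carrier P \<Longrightarrow> x \<sqsubseteq>\<^bsub>P\<^esub> x"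
  using category.Ide_closed[OF P, of x] by (simp add: Hom_poset_cat)

lemma P_trans: "\<lbrakk>x \<in> carrier P; y \<in> carrier P; z \<in> carrier P; x \<sqsubseteq>\<^bsub>P\<^esub> y; y \<sqsubseteq>\<^bsub>P\<^esub> z\<rbrakk> \<Longrightarrow> x \<sqsubseteq>\<^bsub>P\<^esub> z"
  using category.Comp_closed[OF P, of "(x, y)" x y "(y, z)" z] by (simp add: Hom_poset_cat)

lemma J_refl: "S \<in> carrier J \<Longrightarrow> S \<sqsubseteq>\<^bsub>J\<^esub> S"
  using category.Ide_closed[OF J, of S] by (simp add: Hom_poset_cat)

lemma KA: "is_functor (poset_cat A) (poset_cat P) KA"
  by (rule is_functor_inclusion_poset[OF A A_subset A_le])

lemma T_functor: "is_functor (poset_cat P) M T"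
  using T by (simp add: is_left_kan_extension_def)

lemmas T_Hom = poset_functorD(1)[OF T_functor]
lemmas T_Ide = poset_functorD(2)[OF T_functor]
lemmas T_Comp = poset_functorD(3)[OF T_functor]

lemma D_functor: "is_functor (poset_cat J) M D"
  unfolding D_def
proof (rule is_functor_poset_functor[OF J])
  show "fobj T (X S) \<in> Obj M" if "S \<in> carrier J" for S
    using functor_Obj[OF T_functor, of "X S"] X_closed that by simp
qed (simp_all add: T_Hom T_Ide T_Comp X_closed X_mono)

lemma fobj_D: "S \<in> carrier J \<Longrightarrow> fobj D S = fobj T (X S)"
  by (simp add: D_def fobj_poset_functor)

lemma farr_D: "\<lbrakk>S \<in> carrier J; S' \<in> carrier J; S \<sqsubseteq>\<^bsub>J\<^esub> S'\<rbrakk> \<Longrightarrow> farr D (S, S') = farr T (X S, X S')"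
  by (simp add: D_def farr_poset_functor)

lemma eta_natural: "natural (poset_cat A) M Q (fcomp (poset_cat A) T KA) (ncmp \<eta>)"
  using T by (simp add: is_left_kan_extension_def Hom_fun_cat)

lemma eta_Hom: "a \<in> carrier A \<Longrightarrow> ncmp \<eta> a \<in> Hom M (fobj Q a) (fobj T a)"
  using natural_Hom[OF eta_natural, of a] by (simp add: fobj_fcomp fobj_inclusion)

lemma le_X_sigma: "\<lbrakk>x \<in> carrier P; x \<in> B\<rbrakk> \<Longrightarrow> x \<sqsubseteq>\<^bsub>P\<^esub> X (\<sigma> x)"
  using Galois[of x "\<sigma> x"] sigma_closed J_refl by simp

lemma X_in_B: "S \<in> carrier J \<Longrightarrow> X S \<in> B"
  using Galois[of "X S" S] X_closed P_refl by simp

lemma sigma_X: "S \<in> carrier J \<Longrightarrow> \<sigma> (X S) \<sqsubseteq>\<^bsub>J\<^esub> S"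
  using Galois[of "X S" S] X_closed P_refl by simp

text \<open>The element \<open>x\<close> lies below the vertex \<open>X (\<sigma> y)\<close>, so
  \<open>Galois\<close> gives both conclusions.\<close>

lemma B_lower:
  assumes "y \<in> B" "x \<in> carrier P" "y \<in> carrier P" "x \<sqsubseteq>\<^bsub>P\<^esub> y"
  shows "x \<in> B" "\<sigma> x \<sqsubseteq>\<^bsub>J\<^esub> \<sigma> y"
proof -
  have "x \<sqsubseteq>\<^bsub>P\<^esub> X (\<sigma> y)"
    using P_trans[of x y "X (\<sigma> y)"] assms le_X_sigma X_closed sigma_closed by simp
  then show "x \<in> B" "\<sigma> x \<sqsubseteq>\<^bsub>J\<^esub> \<sigma> y"
    using Galois[of x "\<sigma> y"] assms sigma_closed by simp_all
qed

text \<open>\<open>X (\<sigma> (X S))\<close> and \<open>X S\<close> lie below each other, although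
  \<open>\<sigma> (X S)\<close> may be strictly below \<open>S\<close>. The locale works with a
  preorder on \<open>P\<close>, so the two are linked by inverse arrows instead of being
  equated.\<close>

lemma T_X_sigma_X:
  assumes S: "S \<in> carrier J"
  shows "Comp M (farr T (X (\<sigma> (X S)), X S)) (farr T (X S, X (\<sigma> (X S)))) = Ide M (fobj T (X S))"
  using T_Comp[of "X S" "X (\<sigma> (X S))" "X S"] T_Ide[of "X S"] S X_closed sigma_closed X_in_B
    le_X_sigma[of "X S"] X_mono[OF _ S sigma_X[OF S]] by simp

text \<open>A round trip of the adjunction: transposing \<open>v\<close> to \<open>P\<close> and
  back along the arrow from \<open>\<sigma> (X S)\<close> to \<open>S\<close> returns
  \<open>v\<close>.\<close>

lemma natural_D_transpose:
  assumes v: "natural (poset_cat J) M D Z v" and S: "S \<in> carrier J"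
  shows "Comp M (farr Z (\<sigma> (X S), S)) (Comp M (v (\<sigma> (X S))) (farr T (X S, X (\<sigma> (X S))))) = v S"
proof -
  let ?s = "\<sigma> (X S)"
  have s: "?s \<in> carrier J" "X ?s \<in> carrier P" "X S \<in> carrier P" "?s \<sqsubseteq>\<^bsub>J\<^esub> S" "X ?s \<sqsubseteq>\<^bsub>P\<^esub> X S"
    "X S \<sqsubseteq>\<^bsub>P\<^esub> X ?s"
    using sigma_closed X_closed S X_in_B sigma_X X_mono le_X_sigma by auto
  have Z: "is_functor (poset_cat J) M Z" using v by (simp add: natural_def)
  have vs: "v ?s \<in> Hom M (fobj T (X ?s)) (fobj Z ?s)" and vS: "v S \<in> Hom M (fobj T (X S)) (fobj Z S)"
    using natural_Hom[OF v] s S fobj_D by auto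
  note h1 = T_Hom[OF s(3,2,6)] and h2 = T_Hom[OF s(2,3,5)] and h3 = poset_functorD(1)[OF Z s(1) S s(4)]
  have "Comp M (farr Z (?s, S)) (Comp M (v ?s) (farr T (X S, X ?s))) =
      Comp M (Comp M (farr Z (?s, S)) (v ?s)) (farr T (X S, X ?s))"
    by (rule Comp_assoc[OF h1 vs h3])
  also have "\<dots> = Comp M (Comp M (v S) (farr T (X ?s, X S))) (farr T (X S, X ?s))"
    using natural_posetD[OF v s(1) S s(4)] farr_D[OF s(1) S s(4)] by simp
  also have "\<dots> = Comp M (v S) (Comp M (farr T (X ?s, X S)) (farr T (X S, X ?s)))"
    by (rule Comp_assoc[OF h1 h2 vS, symmetric])
  also have "\<dots> = v S" using T_X_sigma_X[OF S] Comp_Ide[OF vS] by simp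
  finally show ?thesis .
qed

text \<open>The transpose of \<open>v\<close> at \<open>x\<close> is \<open>v (\<sigma> x)\<close>
  after \<open>T\<close> of the unit from \<open>x\<close> to \<open>X (\<sigma> x)\<close>. Both
  sides equal \<open>v (\<sigma> y)\<close> after the single arrow of \<open>T\<close> from
  \<open>x\<close> to \<open>X (\<sigma> y)\<close>.\<close>

lemma transpose_natural:
  assumes D': "natural (poset_cat J) M D Z v" and x: "x \<in> carrier P" and y: "y \<in> carrier P" and le: "x \<sqsubseteq>\<^bsub>P\<^esub> y"
    and yB: "y \<in> B"
  shows "Comp M (Comp M (v (\<sigma> y)) (farr T (y, X (\<sigma> y)))) (farr T (x, y)) =
    Comp M (farr Z (\<sigma> x, \<sigma> y)) (Comp M (v (\<sigma> x)) (farr T (x, X (\<sigma> x))))"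
proof -
  have xB: "x \<in> B" and sle: "\<sigma> x \<sqsubseteq>\<^bsub>J\<^esub> \<sigma> y" using B_lower[OF yB x y le] by auto
  have s: "\<sigma> x \<in> carrier J" "\<sigma> y \<in> carrier J" using sigma_closed x y xB yB by auto
  have X: "X (\<sigma> x) \<in> carrier P" "X (\<sigma> y) \<in> carrier P" "X (\<sigma> x) \<sqsubseteq>\<^bsub>P\<^esub> X (\<sigma> y)"
    using X_closed X_mono s sle by auto
  have lx: "x \<sqsubseteq>\<^bsub>P\<^esub> X (\<sigma> x)" and ly: "y \<sqsubseteq>\<^bsub>P\<^esub> X (\<sigma> y)" using le_X_sigma x y xB yB by auto
  have Z: "is_functor (poset_cat J) M Z" using D' by (simp add: natural_def)
  have vx: "v (\<sigma> x) \<in> Hom M (fobj T (X (\<sigma> x))) (fobj Z (\<sigma> x))"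
    and vy: "v (\<sigma> y) \<in> Hom M (fobj T (X (\<sigma> y))) (fobj Z (\<sigma> y))"
    using natural_Hom[OF D'] s fobj_D by auto
  have "Comp M (Comp M (v (\<sigma> y)) (farr T (y, X (\<sigma> y)))) (farr T (x, y)) =
      Comp M (v (\<sigma> y)) (farr T (x, X (\<sigma> y)))"
    using Comp_assoc[OF T_Hom[OF x y le] T_Hom[OF y X(2) ly] vy] T_Comp[OF x y X(2) le ly] by simp
  also have "\<dots> = Comp M (Comp M (v (\<sigma> y)) (farr D (\<sigma> x, \<sigma> y))) (farr T (x, X (\<sigma> x)))"
    using Comp_assoc[OF T_Hom[OF x X(1) lx] T_Hom[OF X] vy] T_Comp[OF x X(1,2) lx X(3)]
      farr_D[OF s sle] by simp
  also have "\<dots> = Comp M (farr Z (\<sigma> x, \<sigma> y)) (Comp M (v (\<sigma> x)) (farr T (x, X (\<sigma> x))))"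
    using natural_posetD[OF D' s sle]
      Comp_assoc[OF T_Hom[OF x X(1) lx] vx poset_functorD(1)[OF Z s sle]] by simp
  finally show ?thesis .
qed

lemma transpose_Hom:
  assumes v: "natural (poset_cat J) M D Z v" and x: "x \<in> carrier P" and xB: "x \<in> B"
  shows "Comp M (v (\<sigma> x)) (farr T (x, X (\<sigma> x))) \<in> Hom M (fobj T x) (fobj Z (\<sigma> x))"
  using Comp_closed[OF T_Hom[OF x X_closed[OF sigma_closed[OF x xB]] le_X_sigma[OF x xB]]]
    natural_Hom[OF v, of "\<sigma> x"] sigma_closed[OF x xB] by (simp add: fobj_D)

text \<open>A lifting problem for \<open>D\<close> is transposed to \<open>P\<close> and restricted
  along \<open>\<eta>\<close> to \<open>A\<close>, where cofibrancy of \<open>Q\<close> solves it.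
  The solution extends to \<open>T\<close> by the existence half of the Kan property; the uniqueness
  half shows that the extension solves the transposed problem, and it is then transposed
  back.\<close>

lemma D_projectively_cofibrant: "projectively_cofibrant (poset_cat J) M D"
  unfolding projectively_cofibrant_def
proof (intro conjI allI impI D_functor; elim conjE)
  fix Y Z p v
  assume p: "natural (poset_cat J) M Y Z p" and pFW: "\<forall>a\<in>Obj (poset_cat J). p a \<in> Fib M \<inter> Weq M"
    and v: "natural (poset_cat J) M D Z v"
  obtain one where one: "is_terminal M one" using small_complete_terminal[OF complete] by blast
  interpret E: lower_extension P M one B
    by (rule lower_extension.intro[OF P category one B_lower(1)])
  have YZ: "is_functor (poset_cat J) M Y" "is_functor (poset_cat J) M Z"
    using p by (auto simp: natural_def)
  have low: "E.lower_functor (\<lambda>x. fobj F (\<sigma> x)) (\<lambda>x y. farr F (\<sigma> x, \<sigma> y))"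
    if F: "is_functor (poset_cat J) M F" for F
    unfolding E.lower_functor_def
  proof (intro conjI ballI impI; (elim conjE IntE)?)
    show "fobj F (\<sigma> x) \<in> Obj M" "farr F (\<sigma> x, \<sigma> x) = Ide M (fobj F (\<sigma> x))"
      if "x \<in> carrier P" "x \<in> B" for x
      using functor_Obj[OF F, of "\<sigma> x"] poset_functorD(2)[OF F] sigma_closed[OF that] by simp_all
    fix x y assume xy: "x \<in> carrier P" "y \<in> carrier P" "y \<in> B" "x \<sqsubseteq>\<^bsub>P\<^esub> y"
    note b = B_lower[OF xy(3,1,2,4)]
    show "farr F (\<sigma> x, \<sigma> y) \<in> Hom M (fobj F (\<sigma> x)) (fobj F (\<sigma> y))"
      using poset_functorD(1)[OF F] sigma_closed xy b by simp
  next
    fix x y z assume xyz: "x \<in> carrier P" "y \<in> carrier P" "z \<in> carrier P" "z \<in> B" "x \<sqsubseteq>\<^bsub>P\<^esub> y" "y \<sqsubseteq>\<^bsub>P\<^esub> z"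
    note b = B_lower[OF xyz(4,2,3,6)]
    note b' = B_lower[OF b(1) xyz(1,2,5)]
    show "Comp M (farr F (\<sigma> y, \<sigma> z)) (farr F (\<sigma> x, \<sigma> y)) = farr F (\<sigma> x, \<sigma> z)"
      using poset_functorD(3)[OF F] sigma_closed xyz b b' by simp
  qed
  define R where "R F = E.ext (\<lambda>x. fobj F (\<sigma> x)) (\<lambda>x y. farr F (\<sigma> x, \<sigma> y))" for F :: "('j, 'j \<times> 'j, 'o, 'm) ftor"
  have RF: "is_functor (poset_cat P) M (R Y)" "is_functor (poset_cat P) M (R Z)"
    unfolding R_def by (rule E.is_functor_ext[OF low[OF YZ(1)]], rule E.is_functor_ext[OF low[OF YZ(2)]])
  have Ro: "fobj (R F) x = fobj F (\<sigma> x)" if "x \<in> carrier P" "x \<in> B" for x F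
    using that by (simp add: R_def E.fobj_ext)
  have Ra: "farr (R F) (x, y) = farr F (\<sigma> x, \<sigma> y)"
    if "x \<in> carrier P" "y \<in> carrier P" "y \<in> B" "x \<sqsubseteq>\<^bsub>P\<^esub> y" for x y F
    using that by (simp add: R_def E.farr_ext)
  define v' where "v' x = (if x \<in> B then Comp M (v (\<sigma> x)) (farr T (x, X (\<sigma> x))) else E.bang (fobj T x))" for x
  define p' where "p' x = (if x \<in> B then p (\<sigma> x) else E.bang (fobj (R Y) x))" for x
  have v'n: "natural (poset_cat P) M T (R Z) v'"
    unfolding v'_def R_def
    by (rule E.natural_ext[OF low[OF YZ(2)] T_functor transpose_Hom[OF v] transpose_natural[OF v]])
  have p'n: "natural (poset_cat P) M (R Y) (R Z) p'"
    unfolding p'_def R_def[of Z]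
  proof (rule E.natural_ext[OF low[OF YZ(2)] RF(1)])
    show "p (\<sigma> x) \<in> Hom M (fobj (R Y) x) (fobj Z (\<sigma> x))" if "x \<in> carrier P" "x \<in> B" for x
      using natural_Hom[OF p, of "\<sigma> x"] sigma_closed[OF that] Ro[OF that] by simp
    show "Comp M (p (\<sigma> y)) (farr (R Y) (x, y)) = Comp M (farr Z (\<sigma> x, \<sigma> y)) (p (\<sigma> x))"
      if xy: "x \<in> carrier P" "y \<in> carrier P" "x \<sqsubseteq>\<^bsub>P\<^esub> y" "y \<in> B" for x y
      using natural_posetD[OF p] sigma_closed xy B_lower[OF xy(4,1,2,3)] Ra by simp
  qed
  have p'FW: "p' x \<in> Fib M \<inter> Weq M" if x: "x \<in> carrier P" for x
  proof (cases "x \<in> B")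
    case True
    then show ?thesis using pFW sigma_closed[OF x] by (simp add: p'_def)
  next
    case False
    then have "p' x = Ide M one" using x E.Ide_one by (simp add: p'_def R_def E.fobj_ext)
    then show ?thesis using Ide_Weq_Fib[OF E.one_Obj] by simp
  qed
  note Kn = natural_fcomp[OF A KA]
  have "natural (poset_cat A) M Q (fcomp (poset_cat A) (R Z) KA) (\<lambda>a. Comp M (v' (fobj KA a)) (ncmp \<eta> a))"
    by (rule natural_Comp[OF A category eta_natural Kn[OF v'n]])
  moreover have "\<forall>a \<in> Obj (poset_cat A). p' (fobj KA a) \<in> Fib M \<inter> Weq M"
    using p'FW A_subset by (auto simp: fobj_inclusion)
  ultimately obtain g where g: "natural (poset_cat A) M Q (fcomp (poset_cat A) (R Y) KA) g"
      "\<forall>a \<in> Obj (poset_cat A). Comp M (p' (fobj KA a)) (g a) = Comp M (v' (fobj KA a)) (ncmp \<eta> a)"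
    using Q Kn[OF p'n] unfolding projectively_cofibrant_def by blast
  obtain \<alpha> where \<alpha>: "natural (poset_cat P) M T (R Y) \<alpha>"
      "\<forall>a \<in> Obj (poset_cat A). Comp M (\<alpha> (fobj KA a)) (ncmp \<eta> a) = g a"
    using left_kan_extension_ex[OF A T RF(1) g(1)] by blast
  have \<alpha>H: "\<alpha> x \<in> Hom M (fobj T x) (fobj (R Y) x)" and p'H: "p' x \<in> Hom M (fobj (R Y) x) (fobj (R Z) x)"
    if "x \<in> carrier P" for x
    using natural_Hom[OF \<alpha>(1), of x] natural_Hom[OF p'n, of x] that by auto
  have p\<alpha>: "Comp M (p' x) (\<alpha> x) = v' x" if "x \<in> carrier P" for x
  proof (rule left_kan_extension_eq[OF A P category KA T natural_Comp[OF P category \<alpha>(1) p'n] v'n])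
    show "x \<in> Obj (poset_cat P)" using that by simp
    fix a assume a: "a \<in> Obj (poset_cat A)"
    then have aP: "a \<in> carrier P" "a \<in> carrier A" using A_subset by auto
    have "Comp M (Comp M (p' a) (\<alpha> a)) (ncmp \<eta> a) = Comp M (p' a) (Comp M (\<alpha> a) (ncmp \<eta> a))"
      by (rule Comp_assoc[OF eta_Hom[OF aP(2)] \<alpha>H[OF aP(1)] p'H[OF aP(1)], symmetric])
    then show "Comp M (Comp M (p' (fobj KA a)) (\<alpha> (fobj KA a))) (ncmp \<eta> a) =
        Comp M (v' (fobj KA a)) (ncmp \<eta> a)"
      using g(2) \<alpha>(2) a by (simp add: fobj_inclusion)
  qed
  \<comment> \<open>Transposing back: \<open>R Y\<close> at \<open>X S\<close> is \<open>Y\<close>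
    at \<open>\<sigma> (X S)\<close>, and the arrow from there to \<open>S\<close> is the
    counit.\<close>
  define h where "h S = Comp M (farr Y (\<sigma> (X S), S)) (\<alpha> (X S))" for S
  have sX: "\<sigma> (X S) \<in> carrier J" "X S \<in> carrier P" "X S \<in> B" "\<sigma> (X S) \<sqsubseteq>\<^bsub>J\<^esub> S" if "S \<in> carrier J" for S
    using that X_closed X_in_B sigma_closed sigma_X by auto
  have YH: "farr Y (\<sigma> (X S), S) \<in> Hom M (fobj Y (\<sigma> (X S))) (fobj Y S)" if "S \<in> carrier J" for S
    using poset_functorD(1)[OF YZ(1) sX(1)[OF that] that sX(4)[OF that]] .
  have \<alpha>X: "\<alpha> (X S) \<in> Hom M (fobj T (X S)) (fobj Y (\<sigma> (X S)))" if "S \<in> carrier J" for S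
    using \<alpha>H[OF sX(2)[OF that]] Ro[OF sX(2)[OF that] sX(3)[OF that]] by simp
  have "natural (poset_cat J) M D Y h"
  proof (rule natural_posetI[OF D_functor YZ(1)])
    show "h S \<in> Hom M (fobj D S) (fobj Y S)" if "S \<in> carrier J" for S
      using Comp_closed[OF \<alpha>X[OF that] YH[OF that]] by (simp add: h_def fobj_D that)
    fix S S' assume S: "S \<in> carrier J" "S' \<in> carrier J" "S \<sqsubseteq>\<^bsub>J\<^esub> S'"
    note s = sX[OF S(1)] and s' = sX[OF S(2)] and le = X_mono[OF S]
    have sle: "\<sigma> (X S) \<sqsubseteq>\<^bsub>J\<^esub> \<sigma> (X S')" using B_lower(2)[OF s'(3) s(2) s'(2) le] .
    have "Comp M (h S') (farr D (S, S')) =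
        Comp M (farr Y (\<sigma> (X S'), S')) (Comp M (\<alpha> (X S')) (farr T (X S, X S')))"
      using Comp_assoc[OF T_Hom[OF s(2) s'(2) le] \<alpha>X[OF S(2)] YH[OF S(2)]] farr_D[OF S]
      by (simp add: h_def)
    also have "\<dots> = Comp M (farr Y (\<sigma> (X S'), S')) (Comp M (farr Y (\<sigma> (X S), \<sigma> (X S'))) (\<alpha> (X S)))"
      using natural_posetD[OF \<alpha>(1) s(2) s'(2) le] Ra[OF s(2) s'(2,3) le] by simp
    also have "\<dots> = Comp M (farr Y (\<sigma> (X S), S')) (\<alpha> (X S))"
      using Comp_assoc[OF \<alpha>X[OF S(1)] poset_functorD(1)[OF YZ(1) s(1) s'(1) sle] YH[OF S(2)]]
        poset_functorD(3)[OF YZ(1) s(1) s'(1) S(2) sle s'(4)] by simp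
    also have "\<dots> = Comp M (farr Y (S, S')) (h S)"
      using Comp_assoc[OF \<alpha>X[OF S(1)] YH[OF S(1)] poset_functorD(1)[OF YZ(1) S]]
        poset_functorD(3)[OF YZ(1) s(1) S(1,2) s(4) S(3)] by (simp add: h_def)
    finally show "Comp M (h S') (farr D (S, S')) = Comp M (farr Y (S, S')) (h S)" .
  qed
  moreover have "Comp M (p S) (h S) = v S" if S: "S \<in> carrier J" for S
  proof -
    note s = sX[OF S]
    have pH: "p S \<in> Hom M (fobj Y S) (fobj Z S)"
      "p (\<sigma> (X S)) \<in> Hom M (fobj Y (\<sigma> (X S))) (fobj Z (\<sigma> (X S)))"
      using natural_Hom[OF p] S s by auto
    have "Comp M (p S) (h S) = Comp M (farr Z (\<sigma> (X S), S)) (Comp M (p (\<sigma> (X S))) (\<alpha> (X S)))"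
      using Comp_assoc[OF \<alpha>X[OF S] YH[OF S] pH(1)] natural_posetD[OF p s(1) S s(4)]
        Comp_assoc[OF \<alpha>X[OF S] pH(2) poset_functorD(1)[OF YZ(2) s(1) S s(4)]] by (simp add: h_def)
    also have "Comp M (p (\<sigma> (X S))) (\<alpha> (X S)) = Comp M (v (\<sigma> (X S))) (farr T (X S, X (\<sigma> (X S))))"
      using p\<alpha>[OF s(2)] s(3) by (simp add: p'_def v'_def)
    finally show ?thesis using natural_D_transpose[OF v S] by simp
  qed
  ultimately show "\<exists>h. natural (poset_cat J) M D Y h \<and> (\<forall>a\<in>Obj (poset_cat J). Comp M (p a) (h a) = v a)"
    by auto
qed

text \<open>Cocones under \<open>D\<close> with apex \<open>z\<close> are transformations from
  \<open>T\<close> to the functor that is \<open>z\<close> on \<open>B\<close> and terminal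
  elsewhere. Maps from \<open>fobj T t\<close> to \<open>z\<close> are transformations to the
  functor that is \<open>z\<close> below \<open>t\<close> and terminal elsewhere. By
  \<open>At\<close> the two targets agree on \<open>A\<close>, so by the Kan property they receive
  the same transformations from \<open>T\<close>.\<close>

lemma D_colimit:
  assumes t: "t \<in> carrier P" and Xt: "\<And>S. S \<in> carrier J \<Longrightarrow> X S \<sqsubseteq>\<^bsub>P\<^esub> t"
    and At: "\<And>a. \<lbrakk>a \<in> carrier A; a \<sqsubseteq>\<^bsub>P\<^esub> t\<rbrakk> \<Longrightarrow> a \<in> B"
  shows "is_colimit M (poset_cat J) D (fobj T t) (\<lambda>S. farr T (X S, t))"
  unfolding is_colimit_def
proof (intro conjI allI impI)
  have TtO: "fobj T t \<in> Obj M" using functor_Obj[OF T_functor, of t] t by simp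
  show "is_cocone M (poset_cat J) D (fobj T t) (\<lambda>S. farr T (X S, t))"
    unfolding is_cocone_def
  proof (intro conjI ballI TtO)
    show "farr T (X S, t) \<in> Hom M (fobj D S) (fobj T t)" if "S \<in> Obj (poset_cat J)" for S
      using T_Hom[OF X_closed t Xt, of S] that by (simp add: fobj_D)
    fix u assume "u \<in> Arr (poset_cat J)"
    then obtain S S' where S: "u = (S, S')" "S \<in> carrier J" "S' \<in> carrier J" "S \<sqsubseteq>\<^bsub>J\<^esub> S'"
      by (rule Arr_poset_catE)
    then show "Comp M (farr T (X (Cod (poset_cat J) u), t)) (farr D u) = farr T (X (Dom (poset_cat J) u), t)"
      using T_Comp[OF X_closed X_closed t X_mono Xt, of S S'] by (simp add: farr_D)
  qed
  obtain one where one: "is_terminal M one" using small_complete_terminal[OF complete] by blast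
  interpret E: lower_extension P M one B
    by (rule lower_extension.intro[OF P category one B_lower(1)])
  define B' where "B' = {x \<in> carrier P. x \<sqsubseteq>\<^bsub>P\<^esub> t}"
  interpret E': lower_extension P M one B'
  proof (rule lower_extension.intro[OF P category one])
    show "x \<in> B'" if "y \<in> B'" "x \<in> carrier P" "y \<in> carrier P" "x \<sqsubseteq>\<^bsub>P\<^esub> y" for x y
      using that P_trans[OF that(2,3) t that(4)] by (simp add: B'_def)
  qed
  have BB': "x \<in> B'" if "x \<in> carrier P" "x \<in> B" for x
    using that P_trans[OF that(1) X_closed t le_X_sigma[OF that] Xt] sigma_closed[OF that]
    by (simp add: B'_def)
  fix z \<kappa> assume \<kappa>: "is_cocone M (poset_cat J) D z \<kappa>"
  have z: "z \<in> Obj M" using \<kappa> by (simp add: is_cocone_def)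
  note iz = Ide_closed[OF z]
  have low: "E.lower_functor (\<lambda>_. z) (\<lambda>_ _. Ide M z)" "E'.lower_functor (\<lambda>_. z) (\<lambda>_ _. Ide M z)"
    using z iz Comp_Ide[OF iz] by (simp_all add: E.lower_functor_def E'.lower_functor_def)
  let ?R = "E.ext (\<lambda>_. z) (\<lambda>_ _. Ide M z)" and ?R' = "E'.ext (\<lambda>_. z) (\<lambda>_ _. Ide M z)"
  note RF = E.is_functor_ext[OF low(1)] E'.is_functor_ext[OF low(2)]
  let ?A = "poset_cat A"
  have AB: "a \<in> B \<longleftrightarrow> a \<in> B'" if "a \<in> carrier A" for a
    using that At BB' A_subset by (auto simp: B'_def)
  have AR: "fcomp ?A ?R KA = fcomp ?A ?R' KA"
  proof (rule functor_eqI[OF is_functor_fcomp[OF A KA RF(1)] is_functor_fcomp[OF A KA RF(2)]])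
    show "fobj (fcomp ?A ?R KA) a = fobj (fcomp ?A ?R' KA) a" if "a \<in> Obj ?A" for a
      using that A_subset AB by (auto simp: fobj_fcomp fobj_inclusion E.fobj_ext E'.fobj_ext)
    show "farr (fcomp ?A ?R KA) f = farr (fcomp ?A ?R' KA) f" if f: "f \<in> Arr ?A" for f
    proof -
      from f obtain a b where ab: "f = (a, b)" "a \<in> carrier A" "b \<in> carrier A" "a \<sqsubseteq>\<^bsub>A\<^esub> b"
        by (rule Arr_poset_catE)
      then have "a \<in> carrier P" "b \<in> carrier P" "a \<sqsubseteq>\<^bsub>P\<^esub> b" using A_subset A_le by auto
      then show ?thesis using f ab AB
        by (simp add: farr_fcomp farr_inclusion E.ext_def E'.ext_def farr_poset_functor
            E.ext_obj_def E'.ext_obj_def)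
    qed
  qed
  have v: "natural (poset_cat J) M D (const_functor (poset_cat J) M z) \<kappa>"
    using natural_const_functor_iff[OF J category D_functor] \<kappa> by blast
  define v' where "v' x = (if x \<in> B then Comp M (\<kappa> (\<sigma> x)) (farr T (x, X (\<sigma> x))) else E.bang (fobj T x))" for x
  have v'n: "natural (poset_cat P) M T ?R v'"
    unfolding v'_def
  proof (rule E.natural_ext[OF low(1) T_functor])
    show "Comp M (\<kappa> (\<sigma> x)) (farr T (x, X (\<sigma> x))) \<in> Hom M (fobj T x) z"
      if "x \<in> carrier P" "x \<in> B" for x
      using transpose_Hom[OF v that] sigma_closed[OF that] by (simp add: fobj_const_functor)
    show "Comp M (Comp M (\<kappa> (\<sigma> y)) (farr T (y, X (\<sigma> y)))) (farr T (x, y)) =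
        Comp M (Ide M z) (Comp M (\<kappa> (\<sigma> x)) (farr T (x, X (\<sigma> x))))"
      if xy: "x \<in> carrier P" "y \<in> carrier P" "x \<sqsubseteq>\<^bsub>P\<^esub> y" "y \<in> B" for x y
      using transpose_natural[OF v xy] sigma_closed xy B_lower[OF xy(4,1,2,3)]
      by (simp add: farr_const_functor)
  qed
  have "natural ?A M Q (fcomp ?A ?R' KA) (\<lambda>a. Comp M (v' (fobj KA a)) (ncmp \<eta> a))"
    using natural_Comp[OF A category eta_natural natural_fcomp[OF A KA v'n]] AR by simp
  then obtain \<alpha> where \<alpha>: "natural (poset_cat P) M T ?R' \<alpha>"
      "\<forall>a \<in> Obj ?A. Comp M (\<alpha> (fobj KA a)) (ncmp \<eta> a) = Comp M (v' (fobj KA a)) (ncmp \<eta> a)"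
    using left_kan_extension_ex[OF A T RF(2)] by blast
  \<comment> \<open>The comparison \<open>r\<close> from \<open>?R'\<close> to \<open>?R\<close> is
    the identity on \<open>B\<close> and forced elsewhere. After it, \<open>\<alpha>\<close> becomes
    the transpose \<open>v'\<close> of \<open>\<kappa>\<close>, which determines
    \<open>\<alpha>\<close> at each \<open>X S\<close>.\<close>
  define r where "r x = (if x \<in> B then Ide M z else E.bang (fobj ?R' x))" for x
  have rn: "natural (poset_cat P) M ?R' ?R r"
    unfolding r_def
  proof (rule E.natural_ext[OF low(1) RF(2)])
    show "Ide M z \<in> Hom M (fobj ?R' x) z" if "x \<in> carrier P" "x \<in> B" for x
      using BB'[OF that] that iz by (simp add: E'.fobj_ext)
    show "Comp M (Ide M z) (farr ?R' (x, y)) = Comp M (Ide M z) (Ide M z)"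
      if "x \<in> carrier P" "y \<in> carrier P" "x \<sqsubseteq>\<^bsub>P\<^esub> y" "y \<in> B" for x y
      using BB'[OF that(2,4)] that by (simp add: E'.farr_ext)
  qed
  have H: "\<alpha> x \<in> Hom M (fobj T x) (fobj ?R' x)" "v' x \<in> Hom M (fobj T x) (fobj ?R x)"
    "r x \<in> Hom M (fobj ?R' x) (fobj ?R x)" if "x \<in> carrier P" for x
    using natural_Hom[OF \<alpha>(1), of x] natural_Hom[OF v'n, of x] natural_Hom[OF rn, of x] that by auto
  have r\<alpha>: "Comp M (r x) (\<alpha> x) = v' x" if "x \<in> carrier P" for x
  proof (rule left_kan_extension_eq[OF A P category KA T natural_Comp[OF P category \<alpha>(1) rn] v'n])
    show "x \<in> Obj (poset_cat P)" using that by simp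
    fix a assume a: "a \<in> Obj (poset_cat A)"
    then have aP: "a \<in> carrier P" "a \<in> carrier A" using A_subset by auto
    note e = eta_Hom[OF aP(2)] and Ha = H[OF aP(1)]
    have "Comp M (Comp M (r a) (\<alpha> a)) (ncmp \<eta> a) = Comp M (v' a) (ncmp \<eta> a)"
    proof (cases "a \<in> B")
      case True
      then have "fobj ?R' a = z" using BB' aP by (simp add: E'.fobj_ext)
      then have "Comp M (r a) (\<alpha> a) = \<alpha> a" using True Ide_Comp Ha(1) by (simp add: r_def)
      then show ?thesis using \<alpha>(2) a by (simp add: fobj_inclusion)
    next
      case False
      then have o: "fobj ?R a = one" using aP by (simp add: E.fobj_ext)
      show ?thesis
        using E.bang_unique[OF Comp_closed[OF e Comp_closed[OF Ha(1) Ha(3)[unfolded o]]]]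
          E.bang_unique[OF Comp_closed[OF e Ha(2)[unfolded o]]] by simp
    qed
    then show "Comp M (Comp M (r (fobj KA a)) (\<alpha> (fobj KA a))) (ncmp \<eta> a) =
        Comp M (v' (fobj KA a)) (ncmp \<eta> a)"
      using a by (simp add: fobj_inclusion)
  qed
  have tB': "t \<in> B'" using t P_refl by (simp add: B'_def)
  have \<alpha>X: "\<alpha> (X S) = \<kappa> S" if S: "S \<in> carrier J" for S
  proof -
    have s: "X S \<in> carrier P" "X S \<in> B" "\<sigma> (X S) \<in> carrier J" "\<sigma> (X S) \<sqsubseteq>\<^bsub>J\<^esub> S"
      using S X_closed X_in_B sigma_closed sigma_X by auto
    have "\<alpha> (X S) \<in> Hom M (fobj T (X S)) z"
      using H(1)[OF s(1)] BB'[OF s(1,2)] s by (simp add: E'.fobj_ext)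
    then have "\<alpha> (X S) = Comp M (\<kappa> (\<sigma> (X S))) (farr T (X S, X (\<sigma> (X S))))"
      using r\<alpha>[OF s(1)] s(2) Ide_Comp by (simp add: r_def v'_def)
    moreover have "Comp M (\<kappa> (\<sigma> (X S))) (farr T (X S, X (\<sigma> (X S)))) \<in> Hom M (fobj T (X S)) z"
      using transpose_Hom[OF v s(1,2)] s(3) by (simp add: fobj_const_functor)
    ultimately show ?thesis
      using natural_D_transpose[OF v S] Ide_Comp S s(3,4) by (simp add: farr_const_functor)
  qed
  show "\<exists>!h. h \<in> Hom M (fobj T t) z \<and> (\<forall>S\<in>Obj (poset_cat J). Comp M h (farr T (X S, t)) = \<kappa> S)"
  proof (rule ex_ex1I)
    have "Comp M (\<alpha> t) (farr T (X S, t)) = \<kappa> S" if S: "S \<in> carrier J" for S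
    proof -
      have "\<alpha> (X S) \<in> Hom M (fobj T (X S)) z"
        using H(1)[OF X_closed[OF S]] BB'[OF X_closed[OF S] X_in_B[OF S]] X_closed[OF S]
        by (simp add: E'.fobj_ext)
      then have "Comp M (Ide M z) (\<alpha> (X S)) = \<alpha> (X S)" by (rule Ide_Comp)
      then show ?thesis
        using natural_posetD[OF \<alpha>(1) X_closed[OF S] t Xt[OF S]] E'.farr_ext[OF X_closed[OF S] t Xt[OF S] tB']
          \<alpha>X[OF S] by simp
    qed
    moreover have "\<alpha> t \<in> Hom M (fobj T t) z" using H(1)[OF t] t tB' by (simp add: E'.fobj_ext)
    ultimately show "\<exists>h. h \<in> Hom M (fobj T t) z \<and>
        (\<forall>S\<in>Obj (poset_cat J). Comp M h (farr T (X S, t)) = \<kappa> S)" by auto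
  next
    fix h h'
    assume h: "h \<in> Hom M (fobj T t) z \<and> (\<forall>S\<in>Obj (poset_cat J). Comp M h (farr T (X S, t)) = \<kappa> S)"
      and h': "h' \<in> Hom M (fobj T t) z \<and> (\<forall>S\<in>Obj (poset_cat J). Comp M h' (farr T (X S, t)) = \<kappa> S)"
    \<comment> \<open>Each map \<open>h\<close> out of \<open>fobj T t\<close> extends to a
      transformation whose value at \<open>t\<close> is \<open>h\<close> itself, so two such maps
      can be compared on \<open>A\<close>.\<close>
    define f where "f h x = (if x \<in> B' then Comp M h (farr T (x, t)) else E'.bang (fobj T x))" for h x
    have fn: "natural (poset_cat P) M T ?R' (f h)" if h: "h \<in> Hom M (fobj T t) z" for h
      unfolding f_def
    proof (rule E'.natural_ext[OF low(2) T_functor])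
      have hx: "Comp M h (farr T (x, t)) \<in> Hom M (fobj T x) z" if "x \<in> carrier P" "x \<in> B'" for x
        using Comp_closed[OF T_Hom[OF that(1) t] h] that by (simp add: B'_def)
      then show "Comp M h (farr T (x, t)) \<in> Hom M (fobj T x) z" if "x \<in> carrier P" "x \<in> B'" for x
        using that .
      fix x y assume xy: "x \<in> carrier P" "y \<in> carrier P" "x \<sqsubseteq>\<^bsub>P\<^esub> y" "y \<in> B'"
      then have yt: "y \<sqsubseteq>\<^bsub>P\<^esub> t" by (simp add: B'_def)
      have "x \<in> B'" using P_trans[OF xy(1,2) t xy(3) yt] xy(1) by (simp add: B'_def)
      then show "Comp M (Comp M h (farr T (y, t))) (farr T (x, y)) = Comp M (Ide M z) (Comp M h (farr T (x, t)))"
        using Comp_assoc[OF T_Hom[OF xy(1-3)] T_Hom[OF xy(2) t yt] h] T_Comp[OF xy(1,2) t xy(3) yt]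
          Ide_Comp[OF hx[OF xy(1)]] by simp
    qed
    have "f h t = f h' t"
    proof (rule left_kan_extension_eq[OF A P category KA T fn fn])
      show "h \<in> Hom M (fobj T t) z" "h' \<in> Hom M (fobj T t) z" using h h' by auto
      show "t \<in> Obj (poset_cat P)" using t by simp
      fix a assume a: "a \<in> Obj ?A"
      then have aP: "a \<in> carrier P" "a \<in> carrier A" using A_subset by auto
      have "f h a = f h' a"
      proof (cases "a \<in> B'")
        case True
        then have aB: "a \<in> B" using AB aP by blast
        note s = sigma_closed[OF aP(1) aB] and l = le_X_sigma[OF aP(1) aB]
        \<comment> \<open>An element of \<open>A\<close> below \<open>t\<close> lies in
          \<open>B\<close>, so its arrow to \<open>t\<close> passes through the vertex
          \<open>X (\<sigma> a)\<close>, where \<open>k\<close> is prescribed by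
          \<open>\<kappa>\<close>.\<close>
        have *: "Comp M k (farr T (a, t)) = Comp M (\<kappa> (\<sigma> a)) (farr T (a, X (\<sigma> a)))"
          if "k \<in> Hom M (fobj T t) z \<and> (\<forall>S\<in>Obj (poset_cat J). Comp M k (farr T (X S, t)) = \<kappa> S)" for k
          using Comp_assoc[OF T_Hom[OF aP(1) X_closed[OF s] l] T_Hom[OF X_closed[OF s] t Xt[OF s]], of k z]
            T_Comp[OF aP(1) X_closed[OF s] t l Xt[OF s]] that s by simp
        show ?thesis using *[OF h] *[OF h'] True by (simp add: f_def)
      qed (simp add: f_def)
      then show "Comp M (f h (fobj KA a)) (ncmp \<eta> a) = Comp M (f h' (fobj KA a)) (ncmp \<eta> a)"
        using a by (simp add: fobj_inclusion)
    qed
    moreover have "f k t = k" if "k \<in> Hom M (fobj T t) z" for k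
      using tB' Comp_Ide[OF that] T_Ide[OF t] by (simp add: f_def)
    ultimately show "h = h'" using h h' by metis
  qed
qed

end

section \<open>Join-dimension and strongly bicartesian cubes\<close>

context distributive_lattice
begin

text \<open>Distributivity splits \<open>p\<close> as the join of its meets with \<open>a\<close>
  and \<open>b\<close>; by irreducibility one of these meets is all of \<open>p\<close>.\<close>

lemma join_irreducible_prime:
  assumes p: "join_irreducible L p" and ab: "a \<in> carrier L" "b \<in> carrier L" and le: "p \<sqsubseteq> a \<squnion> b"
  shows "p \<sqsubseteq> a \<or> p \<sqsubseteq> b"
proof -
  have pc: "p \<in> carrier L" using p by (simp add: join_irreducible_def)
  have ab': "a \<squnion> b \<in> carrier L" by (rule join_closed[OF ab])
  have "p = p \<sqinter> (a \<squnion> b)"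
    by (rule le_antisym[OF meet_le[OF le_refl[OF pc] le pc ab' pc] meet_left[OF pc ab'] pc
        meet_closed[OF pc ab']])
  also have "\<dots> = (p \<sqinter> a) \<squnion> (p \<sqinter> b)" by (rule meet_join_distrib[OF pc ab])
  finally have eq: "p = (p \<sqinter> a) \<squnion> (p \<sqinter> b)" .
  have "\<not> (p \<sqinter> a \<sqsubset> p \<and> p \<sqinter> b \<sqsubset> p)"
    using p eq meet_closed[OF pc ab(1)] meet_closed[OF pc ab(2)]
    unfolding join_irreducible_def by blast
  then have "p \<sqinter> a = p \<or> p \<sqinter> b = p"
    using meet_left[OF pc ab(1)] meet_left[OF pc ab(2)] unfolding lless_eq by blast
  then show ?thesis using meet_right[OF pc ab(1)] meet_right[OF pc ab(2)] by metis
qed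

lemma finite_join_least:
  assumes "finite A" "A \<noteq> {}" "A \<subseteq> carrier L"
  shows "\<Squnion>A \<in> carrier L" "a \<in> A \<Longrightarrow> a \<sqsubseteq> \<Squnion>A"
    and "\<lbrakk>u \<in> carrier L; \<And>a. a \<in> A \<Longrightarrow> a \<sqsubseteq> u\<rbrakk> \<Longrightarrow> \<Squnion>A \<sqsubseteq> u"
proof -
  have l: "least L (\<Squnion>A) (Upper L A)" by (rule finite_sup_least[OF assms(1,3,2)])
  show "\<Squnion>A \<in> carrier L" using l by (rule least_closed)
  show "a \<sqsubseteq> \<Squnion>A" if "a \<in> A" by (rule least_Upper_above[OF l that assms(3)])
  show "\<Squnion>A \<sqsubseteq> u" if "u \<in> carrier L" "\<And>a. a \<in> A \<Longrightarrow> a \<sqsubseteq> u"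
    by (rule least_le[OF l]) (use that in \<open>simp add: Upper_memI\<close>)
qed

lemma join_irreducible_prime_finite:
  assumes p: "join_irreducible L p" and A: "finite A" "A \<noteq> {}" "A \<subseteq> carrier L" and le: "p \<sqsubseteq> \<Squnion>A"
  shows "\<exists>a \<in> A. p \<sqsubseteq> a"
  using A le
proof (induction A rule: finite_ne_induct)
  case (singleton x)
  have pc: "p \<in> carrier L" using p by (simp add: join_irreducible_def)
  have "\<Squnion>{x} \<sqsubseteq> x" using finite_join_least(3)[of "{x}" x] singleton by simp
  then have "p \<sqsubseteq> x" using le_trans[OF singleton(2)] pc singleton finite_join_least(1)[of "{x}"] by simp
  then show ?case by simp
next
  case (insert x F)
  have pc: "p \<in> carrier L" using p by (simp add: join_irreducible_def)
  have xF: "x \<in> carrier L" "F \<subseteq> carrier L" using insert by auto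
  note F = finite_join_least[OF insert(1,2) xF(2)]
  note xF' = finite_join_least[of "insert x F", OF _ _ insert(5)]
  have j: "x \<squnion> \<Squnion>F \<in> carrier L" using xF(1) F(1) by simp
  have "a \<sqsubseteq> x \<squnion> \<Squnion>F" if a: "a \<in> insert x F" for a
  proof (cases "a = x")
    case True
    then show ?thesis using join_left xF(1) F(1) by simp
  next
    case False
    then have aF: "a \<in> F" using a by simp
    show ?thesis
      by (rule le_trans[OF F(2)[OF aF] join_right[OF xF(1) F(1)]]) (use aF xF F(1) j in auto)
  qed
  then have "\<Squnion>(insert x F) \<sqsubseteq> x \<squnion> \<Squnion>F" using xF'(3)[OF _ _ j] insert(1) by simp
  then have "p \<sqsubseteq> x \<squnion> \<Squnion>F" using le_trans[OF insert(6)] pc j xF'(1) insert(1) by simp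
  then show ?case using join_irreducible_prime[OF p xF(1) F(1)] insert(4)[OF xF(2)] by blast
qed

text \<open>If \<open>p i\<close> lay below a different member \<open>p j\<close>, omitting it would
  not change the join.\<close>

lemma reduced_inj:
  assumes jd: "join_decomposition L v k p" and red: "reduced_decomposition L v k p"
    and i: "i < k" "j < k" and le: "p i \<sqsubseteq> p j"
  shows "i = j"
proof (rule ccontr)
  assume ij: "i \<noteq> j"
  \<comment> \<open>For \<open>k = 1\<close> reducedness refers to minimality instead of omission;
    two distinct indices rule this case out.\<close>
  then have k: "k \<noteq> 1" using i by auto
  have pc: "p l \<in> carrier L" if "l < k" for l using jd that by (simp add: join_decomposition_def)
  have v: "v = \<Squnion>(p ` {..<k})" using jd by (simp add: join_decomposition_def)
  let ?A = "p ` ({..<k} - {i})" and ?B = "p ` {..<k}"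
  have A: "finite ?A" "?A \<noteq> {}" "?A \<subseteq> carrier L" using i ij pc by auto
  have B: "finite ?B" "?B \<noteq> {}" "?B \<subseteq> carrier L" using i pc by auto
  note lA = finite_join_least[OF A] and lB = finite_join_least[OF B]
  have "\<Squnion>?A \<sqsubseteq> \<Squnion>?B" by (rule lA(3)[OF lB(1)]) (use lB(2) in auto)
  moreover have "\<Squnion>?B \<sqsubseteq> \<Squnion>?A"
  proof (rule lB(3)[OF lA(1)])
    fix a assume "a \<in> ?B"
    then obtain l where l: "l < k" "a = p l" by auto
    show "a \<sqsubseteq> \<Squnion>?A"
    proof (cases "l = i")
      case True
      have "p j \<sqsubseteq> \<Squnion>?A" using lA(2) i ij by simp
      then show ?thesis using le_trans[OF le] pc i lA(1) l True by simp
    qed (use lA(2) l in auto)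
  qed
  ultimately have "\<Squnion>?A = v" using v lA(1) lB(1) le_antisym by simp
  then show False using red k i by (simp add: reduced_decomposition_def)
qed

text \<open>By primeness each \<open>p i\<close> lies below some \<open>p' j\<close>, which lies
  below some \<open>p l\<close>. Reducedness forces \<open>i = l\<close>, so
  \<open>p i = p' j\<close> and the first family embeds in the second. By symmetry the size is
  unique.\<close>

lemma has_rid_size_le:
  assumes "has_rid_of_size L v k" "has_rid_of_size L v k'"
  shows "k \<le> k'"
proof -
  obtain p p' where p: "join_decomposition L v k p" "reduced_decomposition L v k p"
      "indecomposable_decomposition L k p"
    and p': "join_decomposition L v k' p'" "indecomposable_decomposition L k' p'"
    using assms unfolding has_rid_of_size_def by blast
  have below: "\<exists>j < n. q \<sqsubseteq> r j"
    if "join_decomposition L v n r" "join_irreducible L q" "q \<sqsubseteq> v" for n q and r :: "nat \<Rightarrow> 'a"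
  proof -
    have "finite (r ` {..<n})" "r ` {..<n} \<noteq> {}" "r ` {..<n} \<subseteq> carrier L" "q \<sqsubseteq> \<Squnion>(r ` {..<n})"
      using that by (auto simp: join_decomposition_def lessThan_empty_iff)
    from join_irreducible_prime_finite[OF that(2) this] show ?thesis by auto
  qed
  have le: "r j \<sqsubseteq> v" if "join_decomposition L v n r" "j < n" for n j and r :: "nat \<Rightarrow> 'a"
  proof -
    have "finite (r ` {..<n})" "r ` {..<n} \<noteq> {}" "r ` {..<n} \<subseteq> carrier L" "r j \<in> r ` {..<n}"
      using that by (auto simp: join_decomposition_def)
    from finite_join_least(2)[OF this] show ?thesis using that by (simp add: join_decomposition_def)
  qed
  have pc: "p i \<in> carrier L" if "i < k" for i using p(1) that by (simp add: join_decomposition_def)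
  have pc': "p' i \<in> carrier L" if "i < k'" for i using p'(1) that by (simp add: join_decomposition_def)
  have "\<exists>j < k'. p i = p' j" if i: "i < k" for i
  proof -
    obtain j where j: "j < k'" "p i \<sqsubseteq> p' j"
      using below[OF p'(1) _ le[OF p(1) i]] p(3) i unfolding indecomposable_decomposition_def by blast
    obtain l where l: "l < k" "p' j \<sqsubseteq> p l"
      using below[OF p(1) _ le[OF p'(1) j(1)]] p'(2) j unfolding indecomposable_decomposition_def by blast
    have "i = l" by (rule reduced_inj[OF p(1,2) i l(1) le_trans[OF j(2) l(2) pc[OF i] pc'[OF j(1)] pc[OF l(1)]]])
    then have "p i = p' j" by (intro le_antisym[OF j(2) _ pc[OF i] pc'[OF j(1)]]) (use l in simp)
    then show ?thesis using j(1) by blast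
  qed
  then have "p ` {..<k} \<subseteq> p' ` {..<k'}" by blast
  moreover have "inj_on p {..<k}"
  proof (rule inj_onI)
    fix i j assume "i \<in> {..<k}" "j \<in> {..<k}" "p i = p j"
    then show "i = j" using reduced_inj[OF p(1,2), of i j] le_refl[OF pc, of i] by simp
  qed
  ultimately have "card {..<k} \<le> card (p' ` {..<k'})" using card_inj_on_le by blast
  also have "\<dots> \<le> card {..<k'}" by (rule card_image_le) simp
  finally show ?thesis by simp
qed

text \<open>Uniqueness of the size makes the value chosen by \<open>THE\<close> an actual size, so a
  bound on \<open>jdim\<close> yields a decomposition.\<close>

lemma jdim_leE:
  assumes "jdim L v \<le> enat k"
  obtains "is_minimal L v" | m where "m \<le> k" "has_rid_of_size L v m"
proof (cases "is_minimal L v")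
  case False
  then have ex: "\<exists>m. has_rid_of_size L v m" using assms by (auto simp: jdim_def split: if_splits)
  then obtain m where m: "has_rid_of_size L v m" ..
  have "has_rid_of_size L v (THE m. has_rid_of_size L v m)"
  proof (rule theI[where P = "has_rid_of_size L v", OF m])
    show "m' = m" if "has_rid_of_size L v m'" for m'
      using has_rid_size_le[OF m that] has_rid_size_le[OF that m] by (rule order_antisym[rotated])
  qed
  moreover have "(THE m. has_rid_of_size L v m) \<le> k" using assms False ex by (simp add: jdim_def)
  ultimately show thesis using that by blast
qed (use that in blast)

text \<open>The meet of \<open>v\<close> with \<open>u\<close> cannot be strictly below
  \<open>v\<close>, so it equals \<open>v\<close>.\<close>

lemma minimal_le:
  assumes "is_minimal L v" "u \<in> carrier L"
  shows "v \<sqsubseteq> u"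
proof -
  have v: "v \<in> carrier L" using assms by (simp add: is_minimal_def)
  have vu: "v \<sqinter> u \<in> carrier L" by (rule meet_closed[OF v assms(2)])
  then have "\<not> v \<sqinter> u \<sqsubset> v" using assms(1) unfolding is_minimal_def by blast
  then have "v \<sqinter> u = v" using meet_left[OF v assms(2)] unfolding lless_eq by blast
  then show ?thesis using meet_right[OF v assms(2)] by metis
qed

end

section \<open>Strongly bicartesian cubes as inequalities in a lattice\<close>

locale lattice_cube = distributive_lattice +
  fixes n :: nat and x :: "nat set \<Rightarrow> 'a"
  assumes closed: "S \<subseteq> {0..n} \<Longrightarrow> x S \<in> carrier L"
    and mono: "\<lbrakk>S \<subseteq> S'; S' \<subseteq> {0..n}\<rbrakk> \<Longrightarrow> x S \<sqsubseteq> x S'"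
    \<comment> \<open>\<open>cart\<close> and \<open>cocart\<close> record the universal half of
      being the meet or the join of a punctured face; the bounding half is
      \<open>mono\<close>.\<close>
    and cart: "\<lbrakk>S \<subseteq> S'; S' \<subseteq> {0..n}; 2 \<le> card (S' - S); z \<in> carrier L;
      \<And>V. V \<in> {S<..S'} \<Longrightarrow> z \<sqsubseteq> x V\<rbrakk> \<Longrightarrow> z \<sqsubseteq> x S"
    and cocart: "\<lbrakk>S \<subseteq> S'; S' \<subseteq> {0..n}; 2 \<le> card (S' - S); z \<in> carrier L;
      \<And>V. V \<in> {S..<S'} \<Longrightarrow> x V \<sqsubseteq> z\<rbrakk> \<Longrightarrow> x S' \<sqsubseteq> z"
begin

lemma le_mono: "\<lbrakk>z \<in> carrier L; z \<sqsubseteq> x S; S \<subseteq> S'; S' \<subseteq> {0..n}\<rbrakk> \<Longrightarrow> z \<sqsubseteq> x S'"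
  using le_trans[OF _ mono] closed by (meson subset_trans)

text \<open>Every vertex of the face strictly above \<open>U\<close> contains
  \<open>insert a U\<close> or \<open>insert b U\<close>, so these two bounds suffice for
  \<open>cart\<close>.\<close>

lemma square:
  assumes z: "z \<in> carrier L" and ab: "a \<noteq> b" "a \<notin> U" "b \<notin> U" "insert a (insert b U) \<subseteq> {0..n}"
    and le: "z \<sqsubseteq> x (insert a U)" "z \<sqsubseteq> x (insert b U)"
  shows "z \<sqsubseteq> x U"
proof (rule cart[OF _ ab(4) _ z])
  have "insert a (insert b U) - U = {a, b}" using ab by auto
  then show "2 \<le> card (insert a (insert b U) - U)" using ab(1) by simp
  fix V assume V: "V \<in> {U<..insert a (insert b U)}"
  then have Vn: "V \<subseteq> {0..n}" using ab(4) by auto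
  have "insert a U \<subseteq> V \<or> insert b U \<subseteq> V" using V by auto
  then show "z \<sqsubseteq> x V" using le_mono[OF z le(1) _ Vn] le_mono[OF z le(2) _ Vn] by blast
qed auto

text \<open>Squares are pasted along one direction: the induction hypothesis with base
  \<open>insert b U\<close> bounds \<open>z\<close> there, and one square then removes
  \<open>b\<close>. In \<open>meet_disjoint\<close> such strips are pasted along the other
  direction.\<close>

lemma meet_insert:
  assumes z: "z \<in> carrier L" and B: "finite B" "B \<inter> U = {}" "a \<notin> B" "a \<notin> U" "insert a (U \<union> B) \<subseteq> {0..n}"
    and le: "z \<sqsubseteq> x (insert a U)" "z \<sqsubseteq> x (U \<union> B)"
  shows "z \<sqsubseteq> x U"
  using B le
proof (induction B arbitrary: U rule: finite_induct)
  case (insert b B)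
  have "z \<sqsubseteq> x (insert b U)"
  proof (rule insert.IH)
    show "z \<sqsubseteq> x (insert a (insert b U))" by (rule le_mono[OF z insert.prems(5)]) (use insert.prems in auto)
  qed (use insert in auto)
  then show ?case using square[OF z, of a b U] insert by auto
qed simp

lemma meet_disjoint:
  assumes z: "z \<in> carrier L" and A: "finite A" "A \<inter> U = {}" "A \<inter> B = {}" and B: "B \<inter> U = {}" "U \<union> A \<union> B \<subseteq> {0..n}"
    and le: "z \<sqsubseteq> x (U \<union> A)" "z \<sqsubseteq> x (U \<union> B)"
  shows "z \<sqsubseteq> x U"
  using A B le
proof (induction A arbitrary: U rule: finite_induct)
  case (insert a A)
  have "z \<sqsubseteq> x (insert a U)"
  proof (rule insert.IH)
    show "z \<sqsubseteq> x (insert a U \<union> B)" by (rule le_mono[OF z insert.prems(6)]) (use insert.prems in auto)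
  qed (use insert in auto)
  moreover have "finite B" using insert.prems(4) finite_subset by blast
  ultimately show ?case using meet_insert[OF z, of B U a] insert by auto
qed simp

lemma meet:
  assumes z: "z \<in> carrier L" and S: "S \<subseteq> {0..n}" "S' \<subseteq> {0..n}" and le: "z \<sqsubseteq> x S" "z \<sqsubseteq> x S'"
  shows "z \<sqsubseteq> x (S \<inter> S')"
proof (rule meet_disjoint[OF z, of "S - S'" _ "S' - S"])
  have "S \<inter> S' \<union> (S - S') = S" "S \<inter> S' \<union> (S' - S) = S'" by auto
  then show "z \<sqsubseteq> x (S \<inter> S' \<union> (S - S'))" "z \<sqsubseteq> x (S \<inter> S' \<union> (S' - S))" using le by simp_all
  show "finite (S - S')" using S finite_subset by blast
qed (use S in auto)

text \<open>This becomes the map \<open>\<sigma>\<close> of \<open>kan_diagram\<close>. If no vertex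
  lies above \<open>z\<close>, the intersection over the empty family is \<open>UNIV\<close>; hence
  the vertex \<open>S0\<close> in \<open>le_iff_support\<close>.\<close>

definition support :: "'a \<Rightarrow> nat set" where
  "support z = \<Inter>{S. S \<subseteq> {0..n} \<and> z \<sqsubseteq> x S}"

text \<open>By \<open>meet\<close>, a finite nonempty intersection of vertices above
  \<open>z\<close> is again above \<open>z\<close>, so the support itself is such a vertex.\<close>

lemma le_iff_support:
  assumes z: "z \<in> carrier L" and S0: "S0 \<subseteq> {0..n}" "z \<sqsubseteq> x S0" and S: "S \<subseteq> {0..n}"
  shows "z \<sqsubseteq> x S \<longleftrightarrow> support z \<subseteq> S"
proof
  assume "z \<sqsubseteq> x S"
  then show "support z \<subseteq> S" using S by (auto simp: support_def)
next
  let ?F = "{S. S \<subseteq> {0..n} \<and> z \<sqsubseteq> x S}"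
  have "finite F \<Longrightarrow> F \<noteq> {} \<Longrightarrow> F \<subseteq> ?F \<Longrightarrow> \<Inter>F \<subseteq> {0..n} \<and> z \<sqsubseteq> x (\<Inter>F)" for F
  proof (induction F rule: finite_ne_induct)
    case (insert S' F)
    then show ?case using meet[OF z, of S' "\<Inter>F"] by auto
  qed auto
  moreover have "finite ?F" by (rule finite_subset[of _ "Pow {0..n}"]) auto
  moreover have "?F \<noteq> {}" using S0 by blast
  ultimately have s: "z \<sqsubseteq> x (support z)" unfolding support_def by blast
  assume "support z \<subseteq> S"
  then show "z \<sqsubseteq> x S" by (rule le_mono[OF z s _ S])
qed

text \<open>Otherwise each of the \<open>n + 1\<close> maximal proper vertices fails to lie above
  some irreducible part of \<open>v\<close>. There are at most \<open>n\<close> parts, so one part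
  fails for two vertices; being join-prime, it is not below their join, which bounds the top from
  above.\<close>

lemma jdim_le_imp_le_proper:
  assumes v: "v \<in> carrier L" "jdim L v \<le> enat n" and le: "v \<sqsubseteq> x {0..n}"
  shows "\<exists>S. S \<subset> {0..n} \<and> v \<sqsubseteq> x S"
  using v(2)
proof (cases rule: jdim_leE)
  case 1
  have "v \<sqsubseteq> x {}" by (rule minimal_le[OF 1 closed]) simp
  \<comment> \<open>The empty vertex is proper even for \<open>n = 0\<close>, where
    \<open>{0..n}\<close> has one element.\<close>
  moreover have "{} \<subset> {0..n}" by auto
  ultimately show ?thesis by blast
next
  case (2 m)
  then obtain p where p: "join_decomposition L v m p" "indecomposable_decomposition L m p"
    unfolding has_rid_of_size_def by blast
  have m: "1 \<le> m" and pc: "\<And>l. l < m \<Longrightarrow> p l \<in> carrier L" and veq: "v = \<Squnion>(p ` {..<m})"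
    using p(1) unfolding join_decomposition_def by blast+
  have "0 \<in> {..<m}" using m by simp
  then have pA: "finite (p ` {..<m})" "p ` {..<m} \<noteq> {}" "p ` {..<m} \<subseteq> carrier L"
    using pc by blast+
  note pA = pA veq
  note lub = finite_join_least[OF pA(1-3)]
  let ?y = "\<lambda>i. x ({0..n} - {i})"
  have y: "?y i \<in> carrier L" for i by (rule closed) auto
  show ?thesis
  proof (rule ccontr)
    assume not: "\<not> ?thesis"
    have "\<exists>l. l < m \<and> \<not> p l \<sqsubseteq> ?y i" if i: "i \<in> {0..n}" for i
    proof (rule ccontr)
      assume "\<not> (\<exists>l. l < m \<and> \<not> p l \<sqsubseteq> ?y i)"
      then have "a \<sqsubseteq> ?y i" if "a \<in> p ` {..<m}" for a using that by blast
      then have "v \<sqsubseteq> ?y i" unfolding veq by (rule lub(3)[OF y])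
      moreover have "{0..n} - {i} \<subset> {0..n}" using i by blast
      ultimately have "\<exists>S. S \<subset> {0..n} \<and> v \<sqsubseteq> x S" by blast
      then show False using not by contradiction
    qed
    then have "\<exists>f. \<forall>i \<in> {0..n}. f i < m \<and> \<not> p (f i) \<sqsubseteq> ?y i"
      by (intro bchoice[where Q = "\<lambda>i l. l < m \<and> \<not> p l \<sqsubseteq> ?y i"] ballI)
    then obtain f where f: "f i < m" "\<not> p (f i) \<sqsubseteq> ?y i" if "i \<in> {0..n}" for i by blast
    have "card (f ` {0..n}) \<le> card {..<m}" by (rule card_mono) (use f(1) in auto)
    then have "card (f ` {0..n}) \<noteq> card {0..n}" using 2(1) by simp
    then have "\<not> inj_on f {0..n}" using card_image by blast
    then obtain i j where ij: "i \<in> {0..n}" "j \<in> {0..n}" "i \<noteq> j" "f i = f j" unfolding inj_on_def by blast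
    have pl: "join_irreducible L (p (f i))" "p (f i) \<in> carrier L"
      using p(2) pc f(1)[OF ij(1)] unfolding indecomposable_decomposition_def by blast+
    have yy: "?y i \<squnion> ?y j \<in> carrier L" by (rule join_closed[OF y y])
    \<comment> \<open>The face from \<open>{0..n} - {i, j}\<close> to \<open>{0..n}\<close> is a
      square, and each of its vertices other than the top lies below one of the two maximal
      ones.\<close>
    have top: "x {0..n} \<sqsubseteq> ?y i \<squnion> ?y j"
    proof (rule cocart[of "{0..n} - {i, j}", OF _ _ _ yy])
      have d: "{0..n} - ({0..n} - {i, j}) = {i, j}" using ij(1,2) by blast
      show "2 \<le> card ({0..n} - ({0..n} - {i, j}))" unfolding d using ij(3) by simp
      fix V assume V: "V \<in> {{0..n} - {i, j}..<{0..n}}"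
      then have Vn: "V \<subseteq> {0..n}" "{0..n} - {i, j} \<subseteq> V" "V \<noteq> {0..n}"
        unfolding atLeastLessThan_iff less_le by blast+
      then have xV: "x V \<in> carrier L" by (intro closed)
      have "V \<subseteq> {0..n} - {i} \<or> V \<subseteq> {0..n} - {j}" using Vn by blast
      then show "x V \<sqsubseteq> ?y i \<squnion> ?y j"
      proof
        assume "V \<subseteq> {0..n} - {i}"
        then show ?thesis
          by (rule le_trans[OF mono[OF _ Diff_subset] join_left[OF y y] xV y yy])
      next
        assume "V \<subseteq> {0..n} - {j}"
        then show ?thesis
          by (rule le_trans[OF mono[OF _ Diff_subset] join_right[OF y y] xV y yy])
      qed
    qed blast+
    note tc = closed[OF subset_refl]
    have "p (f i) \<sqsubseteq> v" using lub(2)[of "p (f i)"] veq f(1)[OF ij(1)] by simp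
    then have "p (f i) \<sqsubseteq> x {0..n}" by (rule le_trans[OF _ le pl(2) v(1) tc])
    then have "p (f i) \<sqsubseteq> ?y i \<squnion> ?y j" by (rule le_trans[OF _ top pl(2) tc yy])
    then have "p (f i) \<sqsubseteq> ?y i \<or> p (f i) \<sqsubseteq> ?y j" by (rule join_irreducible_prime[OF pl(1) y y])
    then show False using f(2)[OF ij(1)] f(2)[OF ij(2)] ij(4) by simp
  qed
qed

end

section \<open>Limits and colimits in a poset read as inequalities\<close>

lemma limit_factor:
  assumes "is_limit C J D c \<pi>" "is_cone C J D d \<kappa>"
  obtains h where "h \<in> Hom C d c" "\<And>j. j \<in> Obj J \<Longrightarrow> Comp C (\<pi> j) h = \<kappa> j"
  using assms unfolding is_limit_def by blast

text \<open>An upper bound \<open>z\<close> of the punctured face is the apex of a cocone, so the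
  colimit \<open>c\<close> lies below \<open>z\<close>; the inverse of the isomorphism puts the last
  vertex below \<open>c\<close>.\<close>

lemma (in partial_order) cube_cocartesian:
  assumes X: "is_functor (cube_shape n) (poset_cat L) X" and S: "S \<subseteq> S'" "S' \<subseteq> {0..n}"
    and c: "cocartesian (poset_cat L) X S S'" and z: "z \<in> carrier L"
    and le: "\<And>V. V \<in> {S..<S'} \<Longrightarrow> fobj X V \<sqsubseteq> z"
  shows "fobj X S' \<sqsubseteq> z"
proof -
  let ?J = "poset_cat (subset_poset {S..<S'})"
  have X': "is_functor (poset_cat (subset_poset (Pow {0..n}))) (poset_cat L) X"
    using X by (simp add: cube_shape_def)
  obtain c \<iota> h where c: "is_colimit (poset_cat L) ?J (fcomp ?J X (inclusion ?J)) c \<iota>"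
    and h: "h \<in> Hom (poset_cat L) c (fobj X S')" "is_iso (poset_cat L) h"
    using c by (auto simp: cocartesian_def Let_def)
  have "is_cocone (poset_cat L) ?J (fcomp ?J X (inclusion ?J)) z (\<lambda>V. (fobj X V, z))"
    unfolding is_cocone_def
  proof (intro conjI ballI)
    have XV: "fobj X V \<in> carrier L" if "V \<in> {S..<S'}" for V
      using functor_Obj[OF X', of V] that S by auto
    show "z \<in> Obj (poset_cat L)" using z by simp
    show "(fobj X V, z) \<in> Hom (poset_cat L) (fobj (fcomp ?J X (inclusion ?J)) V) z" if "V \<in> Obj ?J" for V
      using that XV le z by (simp add: Hom_poset_cat fobj_fcomp fobj_inclusion)
    fix u assume u: "u \<in> Arr ?J"
    then obtain V W where VW: "u = (V, W)" "V \<in> {S..<S'}" "W \<in> {S..<S'}" "V \<subseteq> W"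
      by (auto elim: Arr_poset_catE)
    then have "V \<subseteq> {0..n}" "W \<subseteq> {0..n}"
      using S(2) unfolding atLeastLessThan_iff greaterThanAtMost_iff less_le by blast+
    then have "farr X (V, W) = (fobj X V, fobj X W)"
      using poset_functorD(1)[OF X', of V W] VW(4) by (simp add: Hom_poset_cat)
    then show "Comp (poset_cat L) (fobj X (Cod ?J u), z) (farr (fcomp ?J X (inclusion ?J)) u) = (fobj X (Dom ?J u), z)"
      using u VW by (simp add: farr_fcomp farr_inclusion)
  qed
  then obtain k where "k \<in> Hom (poset_cat L) c z" using colimit_factor[OF c] by blast
  then have "c \<sqsubseteq> z" "c \<in> carrier L" by (simp_all add: Hom_poset_cat)
  moreover have "fobj X S' \<sqsubseteq> c" "fobj X S' \<in> carrier L"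
    using h by (auto simp: is_iso_def Hom_poset_cat)
  ultimately show ?thesis using le_trans z by blast
qed

lemma (in partial_order) cube_cartesian:
  assumes X: "is_functor (cube_shape n) (poset_cat L) X" and S: "S \<subseteq> S'" "S' \<subseteq> {0..n}"
    and c: "cartesian (poset_cat L) X S S'" and z: "z \<in> carrier L"
    and le: "\<And>V. V \<in> {S<..S'} \<Longrightarrow> z \<sqsubseteq> fobj X V"
  shows "z \<sqsubseteq> fobj X S"
proof -
  let ?J = "poset_cat (subset_poset {S<..S'})"
  have X': "is_functor (poset_cat (subset_poset (Pow {0..n}))) (poset_cat L) X"
    using X by (simp add: cube_shape_def)
  obtain c \<pi> h where c: "is_limit (poset_cat L) ?J (fcomp ?J X (inclusion ?J)) c \<pi>"
    and h: "h \<in> Hom (poset_cat L) (fobj X S) c" "is_iso (poset_cat L) h"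
    using c by (auto simp: cartesian_def Let_def)
  have "is_cone (poset_cat L) ?J (fcomp ?J X (inclusion ?J)) z (\<lambda>V. (z, fobj X V))"
    unfolding is_cone_def
  proof (intro conjI ballI)
    have XV: "fobj X V \<in> carrier L" if "V \<in> {S<..S'}" for V
      using functor_Obj[OF X', of V] that S by auto
    show "z \<in> Obj (poset_cat L)" using z by simp
    show "(z, fobj X V) \<in> Hom (poset_cat L) z (fobj (fcomp ?J X (inclusion ?J)) V)" if "V \<in> Obj ?J" for V
      using that XV le z by (simp add: Hom_poset_cat fobj_fcomp fobj_inclusion)
    fix u assume u: "u \<in> Arr ?J"
    then obtain V W where VW: "u = (V, W)" "V \<in> {S<..S'}" "W \<in> {S<..S'}" "V \<subseteq> W"
      by (auto elim: Arr_poset_catE)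
    then have "V \<subseteq> {0..n}" "W \<subseteq> {0..n}"
      using S(2) unfolding atLeastLessThan_iff greaterThanAtMost_iff less_le by blast+
    then have "farr X (V, W) = (fobj X V, fobj X W)"
      using poset_functorD(1)[OF X', of V W] VW(4) by (simp add: Hom_poset_cat)
    then show "Comp (poset_cat L) (farr (fcomp ?J X (inclusion ?J)) u) (z, fobj X (Dom ?J u)) = (z, fobj X (Cod ?J u))"
      using u VW by (simp add: farr_fcomp farr_inclusion)
  qed
  then obtain k where "k \<in> Hom (poset_cat L) z c" using limit_factor[OF c] by blast
  then have "z \<sqsubseteq> c" "c \<in> carrier L" by (simp_all add: Hom_poset_cat)
  moreover have "c \<sqsubseteq> fobj X S" "fobj X S \<in> carrier L"
    using h by (auto simp: is_iso_def Hom_poset_cat)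
  ultimately show ?thesis using le_trans z by blast
qed

lemma (in distributive_lattice) lattice_cube_of_functor:
  assumes X: "is_functor (cube_shape n) (poset_cat L) X" and bi: "strongly_bicartesian (poset_cat L) n X"
  shows "lattice_cube L n (fobj X)"
proof
  have X': "is_functor (poset_cat (subset_poset (Pow {0..n}))) (poset_cat L) X"
    using X by (simp add: cube_shape_def)
  show "fobj X S \<in> carrier L" if "S \<subseteq> {0..n}" for S using functor_Obj[OF X', of S] that by simp
  show "fobj X S \<sqsubseteq> fobj X S'" if "S \<subseteq> S'" "S' \<subseteq> {0..n}" for S S'
    using poset_functorD(1)[OF X', of S S'] that by (auto simp: Hom_poset_cat)
  show "z \<sqsubseteq> fobj X S" if "S \<subseteq> S'" "S' \<subseteq> {0..n}" "2 \<le> card (S' - S)" "z \<in> carrier L"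
    "\<And>V. V \<in> {S<..S'} \<Longrightarrow> z \<sqsubseteq> fobj X V" for S S' z
    using cube_cartesian[OF X that(1,2) _ that(4,5)] bi that(1-3) by (simp add: strongly_bicartesian_def)
  show "fobj X S' \<sqsubseteq> z" if "S \<subseteq> S'" "S' \<subseteq> {0..n}" "2 \<le> card (S' - S)" "z \<in> carrier L"
    "\<And>V. V \<in> {S..<S'} \<Longrightarrow> fobj X V \<sqsubseteq> z" for S S' z
    using cube_cocartesian[OF X that(1,2) _ that(4,5)] bi that(1-3) by (simp add: strongly_bicartesian_def)
qed

section \<open>The punctured cube of the codegree approximation\<close>

lemma is_colimit_cong:
  assumes J: "category J" and eq: "\<And>j. j \<in> Obj J \<Longrightarrow> \<iota> j = \<iota>' j" and c: "is_colimit C J D c \<iota>"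
  shows "is_colimit C J D c \<iota>'"
proof -
  interpret category J by fact
  have "is_cocone C J D c \<iota>'"
    unfolding is_cocone_def
  proof (intro conjI ballI)
    show "c \<in> Obj C" using colimit_cocone[OF c] by (simp add: is_cocone_def)
    show "\<iota>' j \<in> Hom C (fobj D j) c" if "j \<in> Obj J" for j
      using cocone_Hom[OF colimit_cocone[OF c] that] eq[OF that] by simp
    fix u assume u: "u \<in> Arr J"
    then have "Comp C (\<iota> (Cod J u)) (farr D u) = \<iota> (Dom J u)"
      using colimit_cocone[OF c] by (simp add: is_cocone_def)
    then show "Comp C (\<iota>' (Cod J u)) (farr D u) = \<iota>' (Dom J u)"
      unfolding eq[OF Dom_closed[OF u]] eq[OF Cod_closed[OF u]] .
  qed
  moreover have "(\<forall>j \<in> Obj J. Comp C h (\<iota>' j) = \<kappa> j) \<longleftrightarrow> (\<forall>j \<in> Obj J. Comp C h (\<iota> j) = \<kappa> j)" for h \<kappa>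
    using eq by simp
  ultimately show ?thesis using c unfolding is_colimit_def by simp
qed

theorem theorem1:
  fixes P :: "'u::infinite gorder"
    and M :: "('o, 'm) mcat"
    and F T\<^sub>k\<^sub>F :: "('u, 'u \<times> 'u, 'o, 'm) ftor"
    and k :: nat
  assumes "distributive_lattice P"
    and "good_model_category TYPE('u) M"
    and "is_functor (poset_cat P) M F"
    and "is_codegree_approximation P M k F T\<^sub>k\<^sub>F"
  shows "codegree P M k T\<^sub>k\<^sub>F"
proof -
  interpret L: distributive_lattice P by fact
  interpret M: model_category "TYPE('u)" M using assms(2) by (simp add: good_model_category_def)
  let ?T = "T\<^sub>k\<^sub>F" and ?P = "poset_cat P" and ?A = "poset_cat (jdim_le P k)"
  have P: "category ?P" by (rule L.category_poset)
  have Ac: "carrier (jdim_le P k) = {v \<in> carrier P. jdim P v \<le> enat k}"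
    and Al: "x \<sqsubseteq>\<^bsub>jdim_le P k\<^esub> y \<longleftrightarrow> x \<sqsubseteq>\<^bsub>P\<^esub> y" for x y
    by (simp_all add: jdim_le_def)
  have A: "category ?A"
  proof (rule category_poset_cat)
    show "x \<sqsubseteq>\<^bsub>jdim_le P k\<^esub> z" if "x \<in> carrier (jdim_le P k)" "y \<in> carrier (jdim_le P k)"
      "z \<in> carrier (jdim_le P k)" "x \<sqsubseteq>\<^bsub>jdim_le P k\<^esub> y" "y \<sqsubseteq>\<^bsub>jdim_le P k\<^esub> z" for x y z
      using L.le_trans[of x y z] that by (simp add: Ac Al)
  qed (simp add: Ac Al)
  obtain Q q \<eta> where "cofibrant_replacement (projective ?A M) (fcomp ?A F (inclusion ?A)) Q q"
    and T: "is_left_kan_extension ?A ?P M (inclusion ?A) Q ?T \<eta>"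
    using assms(4) unfolding is_codegree_approximation_def is_homotopy_left_kan_extension_def Let_def
    by blast
  then have Q: "projectively_cofibrant ?A M Q"
    using M.cofibrant_projective_iff[OF A] by (simp add: cofibrant_replacement_def)
  have TF: "is_functor ?P M ?T" using T by (simp add: is_left_kan_extension_def)
  have "homotopy_cocartesian M k (fcomp (cube_shape k) ?T X)"
    if X: "is_functor (cube_shape k) ?P X" and bi: "strongly_bicartesian ?P k X" for X
  proof -
    interpret X: lattice_cube P k "fobj X" by (rule L.lattice_cube_of_functor[OF X bi])
    define S where "S = {{}..<{0..k}}"
    have S: "V \<in> S \<longleftrightarrow> V \<subset> {0..k}" for V by (auto simp: S_def)
    let ?J = "subset_poset S"
    define B where "B = {x \<in> carrier P. \<exists>V \<in> S. x \<sqsubseteq>\<^bsub>P\<^esub> fobj X V}"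
    have sub: "V \<subseteq> {0..k}" if "V \<in> S" for V using that S by blast
    have SX: "fobj X V \<in> carrier P" if "V \<in> S" for V by (rule X.closed[OF sub[OF that]])
    have top: "fobj X {0..k} \<in> carrier P" by (rule X.closed[OF subset_refl])
    have galois: "x \<sqsubseteq>\<^bsub>P\<^esub> fobj X V \<longleftrightarrow> x \<in> B \<and> X.support x \<subseteq> V" if x: "x \<in> carrier P" and V: "V \<in> S" for x V
    proof -
      have "x \<sqsubseteq>\<^bsub>P\<^esub> fobj X V \<longleftrightarrow> X.support x \<subseteq> V" if xB: "x \<in> B"
      proof -
        obtain W where W: "W \<in> S" "x \<sqsubseteq>\<^bsub>P\<^esub> fobj X W" using xB unfolding B_def by blast
        show ?thesis by (rule X.le_iff_support[OF x sub[OF W(1)] W(2) sub[OF V]])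
      qed
      moreover have "x \<in> B" if "x \<sqsubseteq>\<^bsub>P\<^esub> fobj X V" using that x V unfolding B_def by blast
      ultimately show ?thesis by blast
    qed
    have support_S: "X.support x \<in> S" if "x \<in> B" for x
    proof -
      obtain V where V: "V \<in> S" "x \<in> carrier P" "x \<sqsubseteq>\<^bsub>P\<^esub> fobj X V" using \<open>x \<in> B\<close> unfolding B_def by blast
      have "X.support x \<subseteq> V" using iffD1[OF galois[OF V(2,1)] V(3)] by simp
      then show ?thesis using V(1) unfolding S by (rule subset_psubset_trans)
    qed
    \<comment> \<open>Apart from monotonicity, the Kan argument sees the cube through
      \<open>galois\<close>, which rests on the cartesian faces; the cocartesian ones enter through
      \<open>jdim_le_imp_le_proper\<close>.\<close>
    interpret K: kan_diagram "TYPE('u)" M P "jdim_le P k" ?J Q ?T \<eta> "fobj X" B X.support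
    proof (rule kan_diagram.intro[OF M.model_category_axioms], rule kan_diagram_axioms.intro[OF P A
        category_subset_poset _ _ _ _ _ _ Q T])
      show "carrier (jdim_le P k) \<subseteq> carrier P" by (auto simp: Ac)
      show "fobj X V \<sqsubseteq>\<^bsub>P\<^esub> fobj X W" if "V \<in> carrier ?J" "W \<in> carrier ?J" "V \<sqsubseteq>\<^bsub>?J\<^esub> W" for V W
        using X.mono[of V W] that sub by simp
    qed (simp_all add: Al SX galois support_S)
    let ?JC = "poset_cat ?J" and ?TX = "fcomp (cube_shape k) ?T X"
    have X': "is_functor (poset_cat (subset_poset (Pow {0..k}))) ?P X"
      using X by (simp add: cube_shape_def)
    have XA: "farr X (V, W) = (fobj X V, fobj X W)" if "V \<subseteq> W" "W \<subseteq> {0..k}" for V W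
      using poset_functorD(1)[OF X', of V W] that by (auto simp: Hom_poset_cat)
    have TXA: "farr ?TX (V, W) = farr ?T (fobj X V, fobj X W)" if "V \<subseteq> W" "W \<subseteq> {0..k}" for V W
      using that XA[OF that] by (auto simp: farr_fcomp cube_shape_def)
    have TXO: "fobj ?TX V = fobj ?T (fobj X V)" if "V \<subseteq> {0..k}" for V
      using that by (simp add: fobj_fcomp cube_shape_def)
    have "category (cube_shape k)" unfolding cube_shape_def by (rule category_subset_poset)
    then have "is_functor (cube_shape k) M ?TX" by (rule is_functor_fcomp[OF _ X TF])
    moreover have "is_functor ?JC (cube_shape k) (inclusion ?JC)"
      unfolding cube_shape_def
      by (rule is_functor_inclusion_poset[OF category_subset_poset]) (use sub in auto)
    ultimately have "is_functor ?JC M (fcomp ?JC ?TX (inclusion ?JC))"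
      using is_functor_fcomp category_subset_poset by blast
    \<comment> \<open>\<open>homotopy_cocartesian\<close> restricts the composite cube to
      \<open>S\<close>; by extensionality this restriction equals \<open>K.D\<close>, so the results
      on \<open>K.D\<close> apply by rewriting.\<close>
    then have D: "fcomp ?JC ?TX (inclusion ?JC) = K.D"
    proof (rule functor_eqI[OF _ K.D_functor])
      show "fobj (fcomp ?JC ?TX (inclusion ?JC)) V = fobj K.D V" if "V \<in> Obj ?JC" for V
        using that sub by (simp add: fobj_fcomp[of V ?JC] fobj_inclusion K.fobj_D TXO)
      show "farr (fcomp ?JC ?TX (inclusion ?JC)) f = farr K.D f" if f: "f \<in> Arr ?JC" for f
      proof -
        obtain V W where VW: "f = (V, W)" "V \<in> S" "W \<in> S" "V \<subseteq> W"
          using f by (auto elim: Arr_poset_catE)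
        then show ?thesis
          using f sub
          by (simp add: farr_fcomp[of "(V, W)" ?JC] farr_inclusion[of "(V, W)" ?JC] K.farr_D TXA)
      qed
    qed
    have colim: "is_colimit M ?JC K.D (fobj ?T (fobj X {0..k})) (\<lambda>V. farr ?T (fobj X V, fobj X {0..k}))"
    proof (rule K.D_colimit[OF top])
      show "fobj X V \<sqsubseteq>\<^bsub>P\<^esub> fobj X {0..k}" if "V \<in> carrier ?J" for V
        using X.mono[of V "{0..k}"] that sub by simp
      show "v \<in> B" if v: "v \<in> carrier (jdim_le P k)" "v \<sqsubseteq>\<^bsub>P\<^esub> fobj X {0..k}" for v
      proof -
        have vP: "v \<in> carrier P" "jdim P v \<le> enat k" using v(1) by (simp_all add: Ac)
        obtain V where "V \<subset> {0..k}" "v \<sqsubseteq>\<^bsub>P\<^esub> fobj X V"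
          using X.jdim_le_imp_le_proper[OF vP v(2)] by blast
        then have "\<exists>V \<in> S. v \<sqsubseteq>\<^bsub>P\<^esub> fobj X V" by (intro bexI[of _ V]) (simp_all only: S)
        then show ?thesis using vP(1) by (simp add: B_def)
      qed
    qed
    have colim': "is_colimit M ?JC K.D (fobj ?TX {0..k}) (\<lambda>V. farr ?TX (V, {0..k}))"
      unfolding TXO[OF subset_refl]
    proof (rule is_colimit_cong[OF category_subset_poset _ colim])
      show "farr ?T (fobj X V, fobj X {0..k}) = farr ?TX (V, {0..k})" if "V \<in> Obj ?JC" for V
        using TXA[OF sub[of V] subset_refl] that by simp
    qed
    have fin: "finite S" by (simp add: finite_subset[of S "Pow {0..k}"] subsetI sub)
    show ?thesis
      unfolding homotopy_cocartesian_def Let_def S_def[symmetric] D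
      by (intro conjI allI impI
          hocolim_map_of_cofibrant[OF assms(2) fin K.D_projectively_cofibrant colim'])
  qed
  then show ?thesis using TF by (simp add: codegree_def)
qed

end
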